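(* Let $S=\mathbb C[h(-1),h(-2),\dots]$ be the rank-one Heisenberg vertex operator algebra, let $v_0=h(-1)\in S$, and let $\bar L^{(y_1,y_2)}(x)=\frac12\,{}^{+}_{+}h(e^{y_1}x)h(e^{y_2}x)\,{}^{+}_{+}=\frac12X(Y[v_0,y_1-y_2]v_0,e^{y_2}x)$. Then, with $x_1,x_2,y_1,y_2,y_3,y_4,w$ commuting formal variables, the residue formula $$\begin{aligned} &[\bar L^{(y_1,y_2)}(x_1),\bar L^{(y_3,y_4)}(x_2)]=\tfrac14[X(Y[v_0,y_1-y_2]v_0,e^{y_2}x_1),\,X(Y[v_0,y_3-y_4]v_0,e^{y_4}x_2)]\\ &\quad=\tfrac14\,\mathrm{Res}_{w}\,\delta\!\left(e^{-w}\frac{e^{y_2}x_1}{e^{y_4}x_2}\right)X\bigl(Y[Y[v_0,y_1-y_2]v_0,w]\,Y[v_0,y_3-y_4]v_0,\;e^{y_4}x_2\bigr) \end{aligned}$$ yields precisely $$\begin{aligned} [\bar L^{(y_1,y_2)}(x_1),\bar L^{(y_3,y_4)}(x_2)] ={}&-\frac12\frac{\partial}{\partial y_1}\left(\bar L^{(-y_1+y_2+y_3,\,y_4)}(x_2)\,\delta\!\left(\frac{e^{y_1}x_1}{e^{y_3}x_2}\right)+\bar L^{(-y_1+y_2+y_4,\,y_3)}(x_2)\,\delta\!\left(\frac{e^{y_1}x_1}{e^{y_4}x_2}\right)\right)\\ &-\frac12\frac{\partial}{\partial y_2}\left(\bar L^{(y_1-y_2+y_3,\,y_4)}(x_2)\,\delta\!\left(\frac{e^{y_2}x_1}{e^{y_3}x_2}\right)+\bar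 L^{(y_1-y_2+y_4,\,y_3)}(x_2)\,\delta\!\left(\frac{e^{y_2}x_1}{e^{y_4}x_2}\right)\right); \end{aligned}$$ that is, both displayed chains of equalities hold.
   Context: Heisenberg setting: the Heisenberg Lie algebra has basis $h(n)$ ($n\in\mathbb Z$) and a central element $1$, with $[h(m),h(n)]=m\delta_{m+n,0}1$. It acts on $S=\mathbb C[h(-1),h(-2),\dots]$: for $n<0$, $h(n)$ acts by multiplication; for $n>0$, $h(n)$ acts as $n\frac{\partial}{\partial h(-n)}$; $h(0)$ acts as $0$; $1$ acts as the identity. Put $h(x)=\sum_{n\in\mathbb Z}h(n)x^{-n}$. The normal-ordered product ${}^{\bullet}_{\bullet}\cdots{}^{\bullet}_{\bullet}$ reorders so that the $h(n)$ with $n>0$ act to the right of the $h(n)$ with $n<0$. Vertex operator algebra structure: $S$ is a vertex operator algebra of rank $1$ (in the sense of Frenkel-Lepowsky-Meurman and Frenkel-Huang-Lepowsky) with vacuum $\mathbf 1=1$, $\omega=\frac12h(-1)^2$, and vertex operator map $Y$ with $Y(h(-1),x)=\sum_{n\in\mathbb Z}h(n)x^{-n-1}$; $L(n)$ is defined by $Y(\omega,x)=\sum_nL(n)x^{-n-2}$, and $L(0)$ acts as multiplication by the weight, where $\mathrm{wt}\,h(-j)=j$ for $j>0$. For $v\in S$, $X(v,x)=Y(x^{L(0)}v,x)$, i.e. $X(v,x)=x^{\mathrm{wt}\,v}Y(v,x)$ for homogeneous $v$; thus $X(v_0,x)=h(x)$. For $u\in S$, $Y[u,y]=Y(e^{yL(0)}u,e^y-1)$,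 where powers $(e^y-1)^n$, $n\in\mathbb Z$, are expanded as Laurent series in $y$ with finitely many negative powers. $X(\cdot,x)$ and $Y[\cdot,y]$ are extended coefficientwise to formal series with coefficients in $S$. Modified normal ordering: $${}^{+}_{+}h(e^{y_1}x)h(e^{y_2}x)\,{}^{+}_{+}={}^{\bullet}_{\bullet}h(e^{y_1}x)h(e^{y_2}x)\,{}^{\bullet}_{\bullet}-\frac{\partial}{\partial y_1}\frac{1}{1-e^{-y_1+y_2}},$$ where $\frac1{1-e^{-y_1+y_2}}=(y_1-y_2)^{-1}F(y_1,y_2)$ with $F$ a formal power series and $(y_1-y_2)^{-1}$ expanded in nonnegative powers of $y_2$. One has ${}^{+}_{+}h(e^{y}x)h(e^{w}x)\,{}^{+}_{+}=X(Y[v_0,y-w]v_0,e^{w}x)$, with powers of $y-w$ expanded in nonnegative powers of $w$. Other conventions: $\delta(x)=\sum_{n\in\mathbb Z}x^n$; substituting $e^{y}x$ for $x$ replaces $x^n$ by $e^{ny}x^n$ and exponentials are expanded in nonnegative powers of the exponent variables; $\mathrm{Res}_w$ is the coefficient of $w^{-1}$. $\bar L^{(a,b)}(x)$ with $a,b$ linear combinations of the $y_i$ denotes the corresponding substitution; on the right-hand side of the last formula, the negative powers of $a-b$ that occur (namely of $\pm(y_1-y_2-y_3+y_4)$ and $\pm(y_1-y_2+y_3-y_4)$) are all expanded in nonnegative powers of $y_2,y_3,y_4$. *)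

theory Defs
  imports
    Complex_Main
    "HOL-Library.Poly_Mapping"
    "HOL-Library.Function_Algebras"
    "HOL-Computational_Algebra.Formal_Laurent_Series"
begin

section \<open>Vertex operator algebras\<close>

text \<open>
  Vertex operator algebras in the sense of Frenkel-Lepowsky-Meurman and Frenkel-Huang-Lepowsky,
  over the complex numbers. \<open>Y v n w\<close> is the mode \<open>v\<^sub>n w\<close>, that is,
  \<open>Y(v,x)w = \<Sum>n\<in>\<int>. (Y v n w) x^(-n-1)\<close>; \<open>L(n)\<close> is \<open>Y \<omega> (n + 1)\<close>.

  \<open>jacobi\<close> is the coefficient of \<open>x\<^sub>0^(-l-1) x\<^sub>1^(-m-1) x\<^sub>2^(-n-1)\<close> in the Jacobi identity
  \<open>x\<^sub>0^(-1) \<delta>((x\<^sub>1-x\<^sub>2)/x\<^sub>0) Y(u,x\<^sub>1)Y(v,x\<^sub>2) - x\<^sub>0^(-1) \<delta>((x\<^sub>2-x\<^sub>1)/(-x\<^sub>0)) Y(v,x\<^sub>2)Y(u,x\<^sub>1)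
    = x\<^sub>2^(-1) \<delta>((x\<^sub>1-x\<^sub>0)/x\<^sub>2) Y(Y(u,x\<^sub>0)v,x\<^sub>2)\<close>
  applied to \<open>w\<close>. The sums over \<open>i\<close> have finite support by \<open>truncation\<close>, as \<open>Sum_any\<close> requires.
\<close>

locale vertex_operator_algebra = vector_space scale
  for scale :: "complex \<Rightarrow> 'v::ab_group_add \<Rightarrow> 'v" +
  fixes V :: "int \<Rightarrow> 'v set"
    and Y :: "'v \<Rightarrow> int \<Rightarrow> 'v \<Rightarrow> 'v"
    and vac :: 'v
    and \<omega> :: 'v
    and rank :: complex
  assumes graded_subspace: "subspace (V n)"
    and graded_direct_sum:
      "\<exists>!f. finite {n. f n \<noteq> 0} \<and> (\<forall>n. f n \<in> V n) \<and> v = Sum_any f"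
    and graded_finite_dim: "\<exists>B. finite B \<and> V n \<subseteq> span B"
    and graded_lower_bound: "\<exists>N. \<forall>n<N. V n = {0}"
    and Y_linear_left: "Vector_Spaces.linear scale scale (\<lambda>u. Y u n v)"
    and Y_linear_right: "Vector_Spaces.linear scale scale (Y u n)"
    and truncation: "\<exists>N. \<forall>n\<ge>N. Y u n v = 0"
    and vac_weight: "vac \<in> V 0"
    and vacuum: "Y vac n v = (if n = -1 then v else 0)"
    and creation_regular: "n \<ge> 0 \<Longrightarrow> Y v n vac = 0"
    and creation: "Y v (-1) vac = v"
    and jacobi:
      "Sum_any (\<lambda>i::nat. scale ((-1) ^ i * (of_int l gchoose i))
          (Y u (l + m - int i) (Y v (n + int i) w)
            - scale ((-1) powi l) (Y v (l + n - int i) (Y u (m + int i) w))))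
       = Sum_any (\<lambda>i::nat. scale (of_int m gchoose i) (Y (Y u (l + int i) v) (m + n - int i) w))"
    and omega_weight: "\<omega> \<in> V 2"
    and virasoro:
      "Y \<omega> (m + 1) (Y \<omega> (n + 1) v) - Y \<omega> (n + 1) (Y \<omega> (m + 1) v)
       = scale (of_int (m - n)) (Y \<omega> (m + n + 1) v)
         + (if m + n = 0 then scale (of_int (m ^ 3 - m) / 12 * rank) v else 0)"
    and L0_weight: "v \<in> V n \<Longrightarrow> Y \<omega> 1 v = scale (of_int n) v"
    and L_minus1_derivative: "Y (Y \<omega> 0 v) n w = scale (- of_int n) (Y v (n - 1) w)"


section \<open>The Heisenberg algebra acting on a polynomial space\<close>

text \<open>
  \<open>S = \<complex>[h(-1), h(-2), \<dots>]\<close>. The indeterminates are indexed from 0: exponent \<open>lookup \<mu> i\<close> of a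
  monomial \<open>\<mu>\<close> belongs to \<open>h(-(i+1))\<close>.
\<close>

type_synonym heis = "(nat \<Rightarrow>\<^sub>0 nat) \<Rightarrow>\<^sub>0 complex"

definition scal :: "complex \<Rightarrow> heis \<Rightarrow> heis" where
  "scal c s = Poly_Mapping.single 0 c * s"

definition indet :: "nat \<Rightarrow> heis" where
  "indet i = Poly_Mapping.single (Poly_Mapping.single i 1) 1"

definition pdiff :: "nat \<Rightarrow> heis \<Rightarrow> heis" where
  "pdiff i s = (\<Sum>\<mu>\<in>Poly_Mapping.keys s. Poly_Mapping.single (\<mu> - Poly_Mapping.single i 1)
      (of_nat (Poly_Mapping.lookup \<mu> i) * Poly_Mapping.lookup s \<mu>))"

definition h :: "int \<Rightarrow> heis \<Rightarrow> heis" where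
  "h n s = (if n < 0 then indet (nat (- n) - 1) * s
            else if n > 0 then scal (of_int n) (pdiff (nat n - 1) s)
            else 0)"

definition v\<^sub>0 :: heis where
  "v\<^sub>0 = indet 0"

definition monom_wt :: "(nat \<Rightarrow>\<^sub>0 nat) \<Rightarrow> int" where
  "monom_wt \<mu> = (\<Sum>i\<in>Poly_Mapping.keys \<mu>. (int i + 1) * int (Poly_Mapping.lookup \<mu> i))"

definition heis_grading :: "int \<Rightarrow> heis set" where
  "heis_grading n = {s. \<forall>\<mu>\<in>Poly_Mapping.keys s. monom_wt \<mu> = n}"

definition wt_part :: "int \<Rightarrow> heis \<Rightarrow> heis" where
  "wt_part n s = (\<Sum>\<mu> | \<mu> \<in> Poly_Mapping.keys s \<and> monom_wt \<mu> = n.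
      Poly_Mapping.single \<mu> (Poly_Mapping.lookup s \<mu>))"

text \<open>
  \<open>Y\<close> is the vertex operator map of the rank-one Heisenberg vertex operator algebra:
  \<open>Y(h(-1),x) = \<Sum>n. h(n) x^(-n-1)\<close>, vacuum \<open>1\<close> and \<open>\<omega> = h(-1)\<^sup>2/2\<close>. Since \<open>h(-1)\<close> generates
  \<open>S\<close>, these conditions determine \<open>Y\<close>.
\<close>

definition heisenberg_voa :: "(heis \<Rightarrow> int \<Rightarrow> heis \<Rightarrow> heis) \<Rightarrow> bool" where
  "heisenberg_voa Y \<longleftrightarrow>
     vertex_operator_algebra scal heis_grading Y 1 (scal (1/2) (v\<^sub>0 ^ 2)) 1 \<and>
     (\<forall>n. Y v\<^sub>0 n = h n)"

lemma vector_space_scal: "vector_space scal"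
  by standard
    (simp_all add: scal_def algebra_simps mult_single single_add single_one
      flip: mult.assoc)


section \<open>Formal series\<close>

text \<open>
  A formal series assigns a coefficient to every exponent vector in the seven commuting
  variables below; all integral exponents are allowed, without support conditions. Sums, differences
  and negatives are the pointwise ones of \<open>Function_Algebras\<close>. Coefficients of series of
  operators are maps \<open>heis \<Rightarrow> heis\<close>; infinite sums of such maps are formed after application to a
  vector, where \<open>Sum_any\<close> needs only finitely many nonzero terms.
\<close>

datatype fvar = X1 | X2 | Y1 | Y2 | Y3 | Y4 | W

instance fvar :: finite
proof
  have "(UNIV :: fvar set) \<subseteq> {X1, X2, Y1, Y2, Y3, Y4, W}"
    using fvar.exhaust by blast
  then show "finite (UNIV :: fvar set)"
    by (rule finite_subset) simp
qed

type_synonym expo = "fvar \<Rightarrow> int"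
type_synonym linform = "fvar \<Rightarrow> complex"  \<comment> \<open>\<open>c\<close> stands for the linear form \<open>\<Sum>i. c i \<cdot> i\<close>\<close>
type_synonym opseries = "expo \<Rightarrow> heis \<Rightarrow> heis"

definition var :: "fvar \<Rightarrow> linform" where
  "var i = (\<lambda>j. if j = i then 1 else 0)"

text \<open>\<open>e^c\<close>, expanded in nonnegative powers of all the variables\<close>

definition fexp :: "linform \<Rightarrow> expo \<Rightarrow> complex" where
  "fexp c m = (if \<forall>i. 0 \<le> m i then \<Prod>i\<in>UNIV. c i ^ nat (m i) / fact (nat (m i)) else 0)"

text \<open>
  \<open>c^n\<close> expanded in nonnegative powers of all variables other than \<open>j\<close>, for \<open>c j \<noteq> 0\<close>: writing
  \<open>c = c\<^sub>j j + r\<close>, this is \<open>\<Sum>k\<ge>0. (n choose k) (c\<^sub>j j)^(n-k) r^k\<close>, with \<open>r^k\<close> given by the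
  multinomial theorem.
\<close>

definition lin_powi :: "fvar \<Rightarrow> linform \<Rightarrow> int \<Rightarrow> expo \<Rightarrow> complex" where
  "lin_powi j c n m =
     (let k = (\<Sum>i\<in>-{j}. nat (m i)) in
      if (\<forall>i. i \<noteq> j \<longrightarrow> 0 \<le> m i) \<and> m j = n - int k
      then (of_int n gchoose k) * c j powi (n - int k)
             * (fact k * (\<Prod>i\<in>-{j}. c i ^ nat (m i) / fact (nat (m i))))
      else 0)"

text \<open>Substitution of \<open>c\<close>, expanded as above, into the Laurent series \<open>\<Sum>n. a\<^sub>n y^n\<close>, with
  complex coefficients and with coefficients in \<open>S\<close>, respectively\<close>

definition lin_subst :: "fvar \<Rightarrow> linform \<Rightarrow> complex fls \<Rightarrow> expo \<Rightarrow> complex" where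
  "lin_subst j c a m = Sum_any (\<lambda>n::int. lin_powi j c n m * fls_nth a n)"

definition lin_subst_heis :: "fvar \<Rightarrow> linform \<Rightarrow> (int \<Rightarrow> heis) \<Rightarrow> expo \<Rightarrow> heis" where
  "lin_subst_heis j c a m = Sum_any (\<lambda>n::int. scal (lin_powi j c n m) (a n))"

text \<open>\<open>\<delta>(e^c x/x') = \<Sum>n\<in>\<int>. e^(n c) x^n x'^(-n)\<close>\<close>

definition fdelta :: "linform \<Rightarrow> fvar \<Rightarrow> fvar \<Rightarrow> expo \<Rightarrow> complex" where
  "fdelta c x x' m =
     (if m x' = - m x then fexp (\<lambda>i. of_int (m x) * c i) (m(x := 0, x' := 0)) else 0)"

definition op_scale :: "complex \<Rightarrow> opseries \<Rightarrow> opseries" where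
  "op_scale c A = (\<lambda>m s. scal c (A m s))"

definition op_mult :: "opseries \<Rightarrow> opseries \<Rightarrow> opseries" where
  "op_mult A B = (\<lambda>m s. Sum_any (\<lambda>k. A k (B (m - k) s)))"

definition op_comm :: "opseries \<Rightarrow> opseries \<Rightarrow> opseries" where
  "op_comm A B = op_mult A B - op_mult B A"

definition ser_mult :: "(expo \<Rightarrow> complex) \<Rightarrow> opseries \<Rightarrow> opseries" where
  "ser_mult f A = (\<lambda>m s. Sum_any (\<lambda>k. scal (f k) (A (m - k) s)))"

definition op_deriv :: "fvar \<Rightarrow> opseries \<Rightarrow> opseries" where
  "op_deriv i A = (\<lambda>m s. scal (of_int (m i + 1)) (A (m(i := m i + 1)) s))"

definition op_Res :: "fvar \<Rightarrow> opseries \<Rightarrow> opseries" where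
  "op_Res i A = (\<lambda>m s. if m i = 0 then A (m(i := -1)) s else 0)"


section \<open>The operators \<open>X(v,x)\<close> and \<open>Y[u,y]\<close>\<close>

text \<open>Coefficient of \<open>x^p\<close> in \<open>X(v,x) = Y(x^L(0) v, x) = \<Sum>k. x^k Y(v\<^sub>(\<^sub>k\<^sub>), x)\<close>, where \<open>v\<^sub>(\<^sub>k\<^sub>)\<close> is the
  component of weight \<open>k\<close>\<close>

definition X_coeff :: "(heis \<Rightarrow> int \<Rightarrow> heis \<Rightarrow> heis) \<Rightarrow> heis \<Rightarrow> int \<Rightarrow> heis \<Rightarrow> heis" where
  "X_coeff Y v p s = Sum_any (\<lambda>k::int. Y (wt_part k v) (k - p - 1) s)"

text \<open>\<open>X(f, e^c x) = \<Sum>p. X_coeff f p e^(p c) x^p\<close> for a formal series \<open>f\<close> with coefficients in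
  \<open>S\<close>; the exponent vectors \<open>k\<close> and \<open>m - k\<close> come from \<open>f\<close> and from \<open>e^(p c) x^p\<close>.\<close>

definition X_series ::
    "(heis \<Rightarrow> int \<Rightarrow> heis \<Rightarrow> heis) \<Rightarrow> (expo \<Rightarrow> heis) \<Rightarrow> linform \<Rightarrow> fvar \<Rightarrow> opseries" where
  "X_series Y f c x = (\<lambda>m s. Sum_any (\<lambda>k. let p = (m - k) x in
      scal (fexp (\<lambda>i. of_int p * c i) ((m - k)(x := 0))) (X_coeff Y (f k) p s)))"

text \<open>Coefficient of \<open>y^p\<close> in
  \<open>Y[u,y]v = Y(e^(y L(0)) u, e^y - 1)v = \<Sum>k n. e^(k y) (e^y - 1)^(-n-1) (u\<^sub>(\<^sub>k\<^sub>))\<^sub>n v\<close>\<close>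

definition Y_br :: "(heis \<Rightarrow> int \<Rightarrow> heis \<Rightarrow> heis) \<Rightarrow> heis \<Rightarrow> heis \<Rightarrow> int \<Rightarrow> heis" where
  "Y_br Y u v p = Sum_any (\<lambda>(k::int, n::int).
      scal (fls_nth (fps_to_fls (fps_exp (of_int k)) * fps_to_fls (fps_exp 1 - 1) powi (- n - 1)) p)
        (Y (wt_part k u) n v))"

text \<open>\<open>Y[f,w]g\<close> for formal series \<open>f\<close>, \<open>g\<close> with coefficients in \<open>S\<close>\<close>

definition Y_br_series ::
    "(heis \<Rightarrow> int \<Rightarrow> heis \<Rightarrow> heis) \<Rightarrow> (expo \<Rightarrow> heis) \<Rightarrow> fvar \<Rightarrow> (expo \<Rightarrow> heis) \<Rightarrow> expo \<Rightarrow> heis" where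
  "Y_br_series Y f w g m = Sum_any (\<lambda>(k, l).
      if \<forall>i. i \<noteq> w \<longrightarrow> (m - k - l) i = 0 then Y_br Y (f k) (g l) ((m - k - l) w) else 0)"


section \<open>Normal ordering and the operators \<open>\<bar>L\<close>\<close>

definition normal_ord :: "int \<Rightarrow> int \<Rightarrow> heis \<Rightarrow> heis" where
  "normal_ord k l = (if k > 0 \<and> l < 0 then h l \<circ> h k else h k \<circ> h l)"

text \<open>Normal ordered \<open>h(e^a x) h(e^b x)\<close>, where \<open>h(e^a x) = \<Sum>k. h(k) e^(-k a) x^(-k)\<close>\<close>

definition hh_normal :: "linform \<Rightarrow> linform \<Rightarrow> fvar \<Rightarrow> opseries" where
  "hh_normal a b x = (\<lambda>m s. Sum_any (\<lambda>(k, l).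
      if m x = - k - l
      then scal (fexp (\<lambda>i. - of_int k * a i - of_int l * b i) (m(x := 0))) (normal_ord k l s)
      else 0))"

text \<open>
  The modified normal ordering subtracts \<open>\<partial>/\<partial>y\<^sub>1 (1 / (1 - e^(-y\<^sub>1+y\<^sub>2)))\<close> at
  \<open>y\<^sub>1 = a\<close>, \<open>y\<^sub>2 = b\<close>, which is the derivative of the Laurent series \<open>1 / (1 - e^(-t))\<close> at
  \<open>t = a - b\<close>. The powers of \<open>a - b\<close> are expanded in nonnegative powers of all variables other than \<open>j\<close>.
\<close>

definition hh_plus :: "fvar \<Rightarrow> linform \<Rightarrow> linform \<Rightarrow> fvar \<Rightarrow> opseries" where
  "hh_plus j a b x = hh_normal a b x -
     (\<lambda>m. scal (lin_subst j (a - b) (fls_deriv (1 / (1 - fps_to_fls (fps_exp (-1))))) m))"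

definition Lbar :: "fvar \<Rightarrow> linform \<Rightarrow> linform \<Rightarrow> fvar \<Rightarrow> opseries" where
  "Lbar j a b x = op_scale (1/2) (hh_plus j a b x)"

end

theory Submission
  imports Defs
begin

text \<open>
The modes of the Heisenberg algebra satisfy \<open>[h(m), h(n)] = m\<close> if \<open>m + n = 0\<close>, and commute otherwise.
Every equality below is an equality of coefficients; the support conditions built into the
expansions make each coefficient a finite sum once it is applied to a vector.

For the first equalities: since \<open>h(n)v\<^sub>0\<close> is the vacuum for \<open>n = 1\<close> and vanishes
for the other \<open>n \<ge> 0\<close>, the series \<open>Y[v\<^sub>0,y]v\<^sub>0\<close> is \<open>e^y/(e^y-1)\<^sup>2 + \<Sum>r\<ge>1. e^y (e^y-1)^(r-1) h(-r)v\<^sub>0\<close>.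
The Jacobi identity writes the vertex operator of \<open>h(-r)v\<^sub>0\<close> as a combination of normally ordered
products of modes whose coefficients are binomial; summed over \<open>r\<close>, these are the binomial
expansions of \<open>(1 + (e^y-1))^j\<close>, and what remains is the normally ordered product with weights
\<open>e^(-ky)\<close> (\<open>X_coeff_Y_br_v0\<close>). The leading term \<open>e^y/(e^y-1)\<^sup>2\<close> is the scalar that the modified normal
ordering adds. Substituting \<open>y = y\<^sub>1 - y\<^sub>2\<close> gives \<open>hh_plus_eq_X_series\<close>, hence the first equalities.

For the residue formula, the commutator formula expresses the bracket of two modes as
\<open>[u\<^sub>m, v\<^sub>n] = \<Sum>i. (m choose i) (u\<^sub>iv)\<^sub>m\<^sub>+\<^sub>n\<^sub>-\<^sub>i\<close>. In the normalization of \<open>X\<close> the binomial coefficient becomes the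
residue of \<open>e^(jw) (e^w-1)^(-i-1)\<close>, by the substitution \<open>z = e^w - 1\<close> (\<open>residue_exp\<close>). This turns the
sum over \<open>i\<close> into the residue of \<open>e^(-pw) X(Y[u,w]v,x)\<close> (\<open>X_commutator\<close>), and collecting the factors
\<open>e^(-pw)\<close> into a delta function gives \<open>X_series_commutator_residue\<close>.

For the explicit formula, the bracket of two normally ordered products of modes consists of four
normally ordered products, one for each way of contracting a mode of the first factor with one of
the second, and of scalars coming from two contractions (\<open>normal_ord_commutator\<close>). The four kinds of
operator terms agree, mode by mode, with the four derivatives on the right-hand side
(\<open>hh_plus_commutator\<close>, \<open>mode_commutator_sum\<close>, \<open>op_deriv_ser_mult_Lbar\<close>). The scalars on the right are
singular, and are paired: writing \<open>\<alpha> = y\<^sub>1 - y\<^sub>3\<close>, \<open>\<beta> = y\<^sub>2 - y\<^sub>4\<close> and \<open>G(t) = d/dt 1/(1 - e^(-t))\<close>, which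
is even, the coefficient of \<open>x\<^sub>1^P x\<^sub>2^(-P)\<close> is a quarter of
\<open>\<partial>/\<partial>\<alpha> (G(\<alpha>-\<beta>) e^(P\<alpha>)) + \<partial>/\<partial>\<beta> (G(\<alpha>-\<beta>) e^(P\<beta>))\<close>. Since \<open>e^(P\<beta>) = e^(P\<alpha>) e^(-P(\<alpha>-\<beta>))\<close>, it equals \<open>e^(P\<alpha>)\<close>
times a Laurent series in \<open>\<alpha> - \<beta>\<close>, and that series is a finite sum of exponentials, which are
exactly the double contractions (\<open>pair_fls_commutator_identity\<close>, \<open>scalar_part\<close>). The other pair
arises by exchanging \<open>y\<^sub>3\<close> and \<open>y\<^sub>4\<close>.
\<close>


section \<open>Sums of finite support\<close>

text \<open>
An injection whose range contains the support of \<open>f\<close> maps the support of \<open>f \<circ> g\<close> bijectively onto it,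
so either both sums are finite and agree, or both are zero by convention.
\<close>

lemma Sum_any_reindex:
  assumes "inj g" and "\<And>x. x \<notin> range g \<Longrightarrow> f x = 0"
  shows "Sum_any f = Sum_any (\<lambda>y. f (g y))"
proof -
  have supp: "{x. f x \<noteq> 0} = g ` {y. f (g y) \<noteq> 0}"
  proof (intro set_eqI iffI)
    fix x assume "x \<in> {x. f x \<noteq> 0}"
    then show "x \<in> g ` {y. f (g y) \<noteq> 0}"
      using assms(2)[of x] by auto
  qed auto
  have "inj_on g {y. f (g y) \<noteq> 0}"
    using assms(1) by (rule inj_on_subset) simp
  then have "sum f (g ` {y. f (g y) \<noteq> 0}) = sum (\<lambda>y. f (g y)) {y. f (g y) \<noteq> 0}"
    by (simp add: sum.reindex)
  then show ?thesis
    unfolding Sum_any.expand_set supp .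
qed

lemma Sum_any_eq_single:
  assumes "\<And>x. x \<noteq> a \<Longrightarrow> f x = 0"
  shows "Sum_any f = f a"
  using Sum_any.expand_superset[of "{a}" f] assms by auto

lemma Sum_any_eq_sum:
  assumes "finite A" and "\<And>x. x \<notin> A \<Longrightarrow> f x = 0"
  shows "Sum_any f = sum f A"
  using assms by (intro Sum_any.expand_superset) auto

lemma Sum_any_graph:
  "Sum_any (\<lambda>(k, p). if p = g k then f k else 0) = Sum_any f"
  by (subst Sum_any_reindex[of "\<lambda>k. (k, g k)"]) (auto simp: inj_on_def)

lemma finite_support_graph:
  assumes "finite {k. f k \<noteq> (0 :: 'a :: zero)}"
  shows "finite {x. (case x of (k, p) \<Rightarrow> if p = g k then f k else 0) \<noteq> 0}"
  by (rule finite_subset[OF _ finite_imageI[OF assms, of "\<lambda>k. (k, g k)"]]) (auto split: if_splits)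

lemma Sum_any_uminus: "Sum_any (\<lambda>x. - f x) = - Sum_any (f :: 'b \<Rightarrow> 'a :: ab_group_add)"
  unfolding Sum_any.expand_set by (simp add: sum_negf)

lemma Sum_any_reflect: "Sum_any (\<lambda>k::int. f (c - k)) = Sum_any f"
proof (rule sym, rule Sum_any.reindex_cong)
  show "bij (\<lambda>k::int. c - k)"
    by (rule bij_betw_byWitness[of _ "\<lambda>k. c - k"]) auto
qed (simp add: o_def)

section \<open>Laurent series in an exponential\<close>

abbreviation exp_fls :: "complex \<Rightarrow> complex fls" where
  "exp_fls c \<equiv> fps_to_fls (fps_exp c)"

lemma exp_fls_add: "exp_fls (a + b) = exp_fls a * exp_fls b"
  by (simp add: fps_exp_add_mult fls_times_fps_to_fls)

lemma fls_deriv_exp_fls: "fls_deriv (exp_fls c) = fls_const c * exp_fls c"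
  by (simp add: fls_deriv_fps_to_fls fls_times_fps_to_fls)

text \<open>
Summing over all \<open>k\<close> avoids any mention of the order of \<open>f\<close>; only finitely many terms are nonzero.
\<close>

lemma exp_fls_mult_nth:
  "fls_nth (exp_fls c * f) n = Sum_any (\<lambda>k::nat. c ^ k / fact k * fls_nth f (n - int k))"
proof (cases "exp_fls c * f = 0")
  case True
  then have "f = 0" by simp
  then show ?thesis by simp
next
  case False
  let ?d = "fls_subdegree f"
  have sd: "fls_subdegree (exp_fls c) = 0"
    by (simp add: fls_subdegree_fls_to_fps)
  have "fls_nth (exp_fls c * f) n = (\<Sum>i=0..n - ?d. fls_nth (exp_fls c) i * fls_nth f (n - i))"
    by (subst fls_times_nth(2)) (simp add: sd)
  also have "\<dots> = (\<Sum>k\<in>{k. int k \<le> n - ?d}. c ^ k / fact k * fls_nth f (n - int k))"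
    by (rule sum.reindex_bij_witness[of _ int nat]) auto
  also have "\<dots> = Sum_any (\<lambda>k::nat. c ^ k / fact k * fls_nth f (n - int k))"
  proof (rule Sum_any_eq_sum[symmetric])
    show "finite {k. int k \<le> n - ?d}"
      by (rule finite_subset[of _ "{..nat (n - ?d)}"]) auto
  qed auto
  finally show ?thesis .
qed

text \<open>
Under \<open>z = e^w - 1\<close> this is \<open>Res\<^sub>z (1+z)^(j-1) z^(-n-1)\<close>. Instead of a change of variables, the proof
uses Pascal's rule in \<open>(j, n)\<close>, which holds because \<open>e^w = 1 + z\<close>, together with the case \<open>j = 1\<close>,
where \<open>e^w z^(-n-1)\<close> is a derivative unless \<open>n = 0\<close>.
\<close>

lemma residue_exp:
  "fls_nth (exp_fls (of_int j) * fps_to_fls (fps_exp 1 - 1) powi (- n - 1)) (-1)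
     = (if n < 0 then 0 else (of_int j - 1) gchoose nat n)"
proof -
  define z :: "complex fls" where "z = fps_to_fls (fps_exp 1 - 1)"
  define R where "R j n = fls_nth (exp_fls (of_int j) * z powi (- n - 1)) (-1)" for j n :: int
  have z: "z = exp_fls 1 - 1" by (simp add: z_def)
  have z0: "z \<noteq> 0" unfolding z_def by simp
  have dz: "fls_deriv z = exp_fls 1" unfolding z by (simp add: fls_deriv_exp_fls)
  have neg: "R j n = 0" if "n < 0" for j n
  proof -
    have "z powi (- n - 1) = fps_to_fls ((fps_exp 1 - 1) ^ nat (- n - 1))"
      using that by (simp add: z_def power_int_def fps_to_fls_power)
    then show ?thesis
      unfolding R_def by (simp flip: fls_times_fps_to_fls)
  qed
  have pascal: "R (j + 1) n = R j n + R j (n - 1)" for j n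
  proof -
    have "z powi (- n) = z * z powi (- n - 1)"
      using power_int_add[of z 1 "- n - 1"] z0 by simp
    then have "exp_fls (of_int (j + 1)) * z powi (- n - 1)
        = exp_fls (of_int j) * z powi (- n - 1) + exp_fls (of_int j) * z powi (- (n - 1) - 1)"
      using z by (simp add: exp_fls_add ring_distribs mult_ac)
    then show ?thesis unfolding R_def by simp
  qed
  \<comment> \<open>For \<open>n > 0\<close> the series is a multiple of the derivative of \<open>z^(-n)\<close>; for \<open>n = 0\<close> it is \<open>z'/z\<close>.\<close>
  have one: "R 1 n = (if n = 0 then 1 else 0)" for n
  proof (cases "n \<le> 0")
    case True
    show ?thesis
    proof (cases "n = 0")
      case True
      define u :: "complex fps" where "u = fps_shift 1 (fps_exp 1 - 1)"
      have u0: "u $ 0 = 1" by (simp add: u_def)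
      have "fps_exp 1 - 1 = fps_X * u"
        by (rule fps_ext) (simp add: u_def)
      then have "z = fls_X * fps_to_fls u"
        by (simp add: z_def fls_times_fps_to_fls)
      then have "inverse z = fls_X_inv * fps_to_fls (inverse u)"
        using u0 by (simp add: fls_inverse_X fls_inverse_fps_to_fls)
      then have "exp_fls 1 * inverse z = fls_shift 1 (fps_to_fls (fps_exp 1 * inverse u))"
        by (metis fls_times_fps_to_fls fls_X_inv_times_conv_shift(1) mult.left_commute)
      then show ?thesis using True u0 by (simp add: R_def power_int_minus)
    next
      case False
      then show ?thesis using \<open>n \<le> 0\<close> neg by simp
    qed
  next
    case False
    define w where "w = inverse z ^ nat n"
    have "fls_deriv (z * inverse z) = 0" using z0 by simp
    then have "z * fls_deriv (inverse z) = - (inverse z * exp_fls 1)"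
      by (simp add: dz add_eq_0_iff2 mult_ac)
    then have "inverse z * (z * fls_deriv (inverse z)) = - (inverse z * inverse z * exp_fls 1)"
      by (simp add: mult_ac)
    then have dinv: "fls_deriv (inverse z) = - (inverse z * inverse z * exp_fls 1)"
      using z0 by (simp flip: mult.assoc)
    have "z powi (- n - 1) = inverse z ^ (nat n - 1) * inverse z * inverse z"
    proof -
      have "nat (n + 1) = Suc (Suc (nat n - 1))" using False by simp
      moreover have "z powi (- n - 1) = inverse z ^ nat (n + 1)"
        using False by (simp add: power_int_def add.commute)
      ultimately show ?thesis by (simp only: power_Suc2)
    qed
    then have "fls_deriv w = fls_const (- of_int n) * (exp_fls 1 * z powi (- n - 1))"
      unfolding w_def fls_deriv_power dinv using False by (simp add: mult_ac fls_of_nat)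
    then have "of_int (-n) * R 1 n = fls_nth (fls_deriv w) (-1)"
      unfolding R_def by simp
    then show ?thesis using False by (simp del: fls_deriv_nth add: fls_deriv_residue)
  qed
  have "R j (int n) = (of_int j - 1) gchoose n" for j n
  proof (induction n arbitrary: j)
    case 0
    have step: "R (j + 1) 0 = R j 0" for j using pascal[of j 0] neg by simp
    have "R j 0 = 1"
      by (induction j rule: int_induct[where k = 1]) (use one step[of "_ - 1"] step in auto)
    then show ?case by simp
  next
    case (Suc n)
    have step: "R (j + 1) (int (Suc n)) = R j (int (Suc n)) + (of_int j - 1 gchoose n)" for j
      using pascal[of j "int (Suc n)"] Suc[of j] by simp
    have gb: "(of_int (j + 1) - 1 :: complex) gchoose Suc n
        = (of_int j - 1 gchoose n) + (of_int j - 1 gchoose Suc n)" for j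
      using gbinomial_Suc_Suc[of "of_int j - 1 :: complex" n] by simp
    show ?case
    proof (induction j rule: int_induct[where k = 1])
      case base
      then show ?case using one[of "int (Suc n)"] by simp
    next
      case (step1 i)
      then show ?case using step[of i] gb[of i] by simp
    next
      case (step2 i)
      then show ?case using step[of "i - 1"] gb[of "i - 1"] by simp
    qed
  qed
  from this[of j "nat n"] neg[of n j] show ?thesis
    unfolding R_def z_def by (cases "n < 0") auto
qed

text \<open>
The contraction \<open>\<Sum>l>0. l e^(-lt) = 1/(4 sinh\<^sup>2(t/2))\<close> of two Heisenberg fields. The modified normal
ordering adds this series to the normally ordered product.
\<close>

definition pair_fls :: "complex fls" where
  "pair_fls = - fls_deriv (1 / (1 - exp_fls (-1)))"

lemma exp_fls_mult_neg: "exp_fls c * exp_fls (- c) = 1"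
  using exp_fls_add[of c "- c"] by simp

lemma one_minus_exp_fls_nonzero: "1 - exp_fls (-1) \<noteq> 0"
proof
  assume "1 - exp_fls (-1) = 0"
  then have "fps_to_fls (fps_exp (-1 :: complex)) = fps_to_fls 1" by simp
  then show False unfolding fps_to_fls_eq_iff by simp
qed

text \<open>
Differentiating \<open>f (1 - e^(-t)) = 1\<close> gives \<open>-f' (1 - e^(-t))\<^sup>2 = e^(-t)\<close>; this symmetric form makes the
evenness of \<open>-f'\<close> visible.
\<close>

lemma pair_fls_mult: "pair_fls * (exp_fls 1 - 2 + exp_fls (-1)) = 1"
proof -
  define f where "f = 1 / (1 - exp_fls (-1))"
  have f: "f * (1 - exp_fls (-1)) = 1"
    using one_minus_exp_fls_nonzero by (simp add: f_def)
  have q: "exp_fls 1 * exp_fls (-1) = 1" using exp_fls_mult_neg[of 1] by simp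
  have "fls_deriv (f * (1 - exp_fls (-1))) = 0" unfolding f by simp
  then have d: "fls_deriv f * (1 - exp_fls (-1)) + f * exp_fls (-1) = 0"
    by (simp add: fls_deriv_exp_fls add.commute)
  have "pair_fls * (exp_fls 1 - 2 + exp_fls (-1)) = pair_fls * (exp_fls 1 * (1 - exp_fls (-1)) * (1 - exp_fls (-1)))"
    using q by (simp add: algebra_simps)
  also have "\<dots> = (1 - exp_fls (-1)) * (exp_fls 1 * (pair_fls * (1 - exp_fls (-1))))"
    by (simp add: mult_ac)
  also have "pair_fls * (1 - exp_fls (-1)) = f * exp_fls (-1)"
  proof -
    from d have "fls_deriv f * (1 - exp_fls (-1)) = - (f * exp_fls (-1))"
      by (rule eq_neg_iff_add_eq_0[THEN iffD2])
    then show ?thesis unfolding pair_fls_def f_def[symmetric] by simp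
  qed
  also have "(1 - exp_fls (-1)) * (exp_fls 1 * (f * exp_fls (-1))) = f * (1 - exp_fls (-1)) * (exp_fls 1 * exp_fls (-1))"
    by (simp add: mult_ac)
  finally show ?thesis using f q by simp
qed

lemma pair_fls_eq: "pair_fls = exp_fls 1 * fps_to_fls (fps_exp 1 - 1) powi (-2)"
proof -
  have q: "exp_fls 1 * exp_fls (-1) = 1" using exp_fls_mult_neg[of 1] by simp
  have "(exp_fls 1 - 1) ^ 2 = exp_fls 1 * (exp_fls 1 - 2 + exp_fls (-1))"
    using q by (simp add: power2_eq_square algebra_simps)
  moreover have "exp_fls 1 - 1 \<noteq> 0"
  proof
    assume "exp_fls 1 - 1 = 0"
    then have "fps_to_fls (fps_exp (1 :: complex)) = fps_to_fls 1" by simp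
    then show False unfolding fps_to_fls_eq_iff by simp
  qed
  ultimately show ?thesis
    using inverse_unique[of "exp_fls 1 - 2 + exp_fls (-1)" pair_fls] pair_fls_mult
    by (simp add: power_int_minus mult.commute flip: divide_inverse)
qed

text \<open>
The reciprocal \<open>e^t - 2 + e^(-t)\<close> is \<open>t\<^sup>2\<close> times an even power series with constant term 1, and the
inverse of an even power series is even.
\<close>

lemma pair_fls_odd: assumes "odd n" shows "fls_nth pair_fls n = 0"
proof -
  define c :: "complex fps" where "c = fps_exp 1 - 2 + fps_exp (-1)"
  define u where "u = fps_shift 2 c"
  have c0: "c $ 0 = 0" "c $ 1 = 0" by (simp_all add: c_def fps_numeral_nth)
  have cu: "c = fps_X ^ 2 * u"
  proof (rule fps_ext)
    fix n show "c $ n = (fps_X ^ 2 * u) $ n"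
    proof (cases "n < 2")
      case True
      then show ?thesis using c0 by (auto simp: fps_X_power_mult_nth less_2_cases_iff)
    next
      case False
      then have "n - 2 + 2 = n" by simp
      then show ?thesis using False by (simp only: fps_X_power_mult_nth u_def fps_shift_nth if_False)
    qed
  qed
  have u0: "u $ 0 = 1" by (simp add: u_def c_def fps_numeral_nth numeral_2_eq_2)
  have "u oo (- fps_X) = u"
  proof (rule fps_ext)
    fix n show "(u oo (- fps_X)) $ n = u $ n"
      unfolding fps_compose_uminus' by (cases "even n") (simp_all add: u_def c_def fps_numeral_nth)
  qed
  then have inv: "inverse u oo (- fps_X) = inverse u"
    using fps_inverse_compose[of "- fps_X" u] u0 by simp
  have odd0: "inverse u $ k = 0" if "odd k" for k
  proof -
    have "(inverse u oo (- fps_X)) $ k = - (inverse u $ k)"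
      using that unfolding fps_compose_uminus' by simp
    then show ?thesis unfolding inv by simp
  qed
  have "fps_to_fls c = exp_fls 1 - 2 + exp_fls (-1)" by (simp add: c_def)
  then have "pair_fls = inverse (fps_to_fls c)"
    using pair_fls_mult inverse_unique[of "fps_to_fls c" pair_fls] by (simp add: mult.commute)
  also have "\<dots> = inverse (fls_X ^ 2) * inverse (fps_to_fls u)"
    unfolding cu by (simp add: fls_times_fps_to_fls fps_to_fls_power)
  also have "\<dots> = fls_shift 2 (fps_to_fls (inverse u))"
  proof -
    have "inverse (fls_X ^ 2) * h = fls_shift 2 h" for h :: "complex fls"
    proof -
      have "fls_X ^ 2 * fls_shift 2 h = h" by (simp add: fls_X_power_times_conv_shift)
      then have "inverse (fls_X ^ 2) * h = inverse (fls_X ^ 2) * (fls_X ^ 2 * fls_shift 2 h)" by simp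
      then show ?thesis by (simp flip: mult.assoc)
    qed
    then show ?thesis using u0 by (simp add: fls_inverse_fps_to_fls)
  qed
  finally have Ku: "pair_fls = fls_shift 2 (fps_to_fls (inverse u))" .
  show ?thesis
  proof (cases "n + 2 < 0")
    case False
    then have "odd (nat (n + 2))" using assms by (simp add: even_nat_iff)
    then show ?thesis using odd0[of "nat (n + 2)"] unfolding Ku by simp
  qed (unfold Ku, simp)
qed

text \<open>
With \<open>f = 1/(1 - e^(-t))\<close>, so that \<open>G = f'\<close>, put \<open>g = f (1 - e^(-Pt))\<close>. Then the left-hand side is
\<open>g'' + P g'\<close>, and \<open>g\<close> is, up to sign, a finite geometric sum of exponentials \<open>e^(lt)\<close>, on each of which
the operator \<open>D\<^sup>2 + P D\<close> acts as multiplication by \<open>l (P + l) = -k l\<close>. On the right, the bracket of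
truth values selects precisely the exponents that occur in \<open>g\<close>, with the correct sign.
\<close>

lemma pair_fls_commutator_identity:
  defines "G \<equiv> - pair_fls"
  shows "fls_deriv G + fls_const (of_int P) * G
       - fls_deriv G * exp_fls (- of_int P) + fls_const (of_int P) * G * exp_fls (- of_int P)
     = (\<Sum>l\<in>{-\<bar>P\<bar>..\<bar>P\<bar>}. let k = - P - l in
         fls_const (of_int (k * l) * ((if l > 0 then 1 else 0) - (if k < 0 then 1 else 0))) * exp_fls (of_int l))"
proof -
  define f where "f = 1 / (1 - exp_fls (-1))"
  have f: "f * (1 - exp_fls (-1)) = 1"
    using one_minus_exp_fls_nonzero by (simp add: f_def)
  define g where "g = f * (1 - exp_fls (- of_int P))"
  have G: "G = fls_deriv f" by (simp add: G_def pair_fls_def f_def)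
  have c: "fls_deriv (fls_const a * h) = fls_const a * fls_deriv h" for a and h :: "complex fls"
    by (simp add: fls_deriv_mult_const_left)
  have cm: "fls_const (- of_int P :: complex) = - fls_const (of_int P)" by simp
  have dE: "fls_deriv (exp_fls (- of_int P)) = - (fls_const (of_int P) * exp_fls (- of_int P))"
    by (simp add: fls_deriv_exp_fls cm del: fls_const_uminus)
  have shift: "f * exp_fls (l - 1) = f * exp_fls l - exp_fls l" for l
  proof -
    have "exp_fls (l - 1) = exp_fls (-1) * exp_fls l"
      using exp_fls_add[of "-1" l] by simp
    then have "f * exp_fls l - f * exp_fls (l - 1) = f * (1 - exp_fls (-1)) * exp_fls l"
      by (simp only: ring_distribs mult.assoc) simp
    then have "f * exp_fls l - f * exp_fls (l - 1) = exp_fls l"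
      unfolding f by simp
    moreover have "b = a - c" if "a - b = c" for a b c :: "complex fls"
      using that by auto
    ultimately show ?thesis by blast
  qed
  have op: "fls_deriv (fls_deriv (\<Sum>l\<in>A. exp_fls (of_int l))) + fls_const (of_int P) * fls_deriv (\<Sum>l\<in>A. exp_fls (of_int l))
      = (\<Sum>l\<in>A. fls_const (of_int ((P + l) * l)) * exp_fls (of_int l))" for A
  proof -
    have "fls_deriv (fls_deriv (exp_fls (of_int l))) + fls_const (of_int P) * fls_deriv (exp_fls (of_int l))
      = fls_const (of_int ((P + l) * l)) * exp_fls (of_int l)" for l
    proof -
      have "fls_const (of_int ((P + l) * l) :: complex)
          = fls_const (of_int l) * fls_const (of_int l) + fls_const (of_int P) * fls_const (of_int l)"
        by (simp add: algebra_simps fls_plus_const)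
      then show ?thesis by (simp only: fls_deriv_exp_fls c distrib_right mult.assoc)
    qed
    then show ?thesis
      by (simp add: fls_deriv_sum sum_distrib_left flip: sum.distrib)
  qed
  have g': "fls_deriv g = G * (1 - exp_fls (- of_int P)) + fls_const (of_int P) * f * exp_fls (- of_int P)"
    unfolding g_def G by (simp add: dE algebra_simps)
  have g'': "fls_deriv (fls_deriv g) = fls_deriv G * (1 - exp_fls (- of_int P))
      + 2 * fls_const (of_int P) * G * exp_fls (- of_int P)
      - fls_const (of_int P) * fls_const (of_int P) * f * exp_fls (- of_int P)"
    unfolding g' by (simp add: dE c G[symmetric] algebra_simps)
  have "fls_deriv G + fls_const (of_int P) * G
       - fls_deriv G * exp_fls (- of_int P) + fls_const (of_int P) * G * exp_fls (- of_int P)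
     = fls_deriv (fls_deriv g) + fls_const (of_int P) * fls_deriv g"
    unfolding g'' unfolding g' by (simp add: algebra_simps)
  also have "\<dots> = (\<Sum>l\<in>{-\<bar>P\<bar>..\<bar>P\<bar>}. let k = - P - l in
         fls_const (of_int (k * l) * ((if l > 0 then 1 else 0) - (if k < 0 then 1 else 0))) * exp_fls (of_int l))"
  proof (cases "P \<ge> 0")
    case True
    have "f * (1 - exp_fls (- of_nat N)) = (\<Sum>l\<in>{1 - int N..0}. exp_fls (of_int l))" for N
    proof (induction N)
      case (Suc N)
      have "{1 - int (Suc N)..0} = insert (- int N) {1 - int N..0}" by auto
      moreover have "f * (1 - exp_fls (- of_nat (Suc N))) = f * (1 - exp_fls (- of_nat N)) + exp_fls (- of_nat N)"
      proof -
        have "- of_nat (Suc N) = (- of_nat N - 1 :: complex)" by simp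
        then show ?thesis using shift[of "- of_nat N"] by (simp only: right_diff_distrib) simp
      qed
      ultimately show ?case using Suc by simp
    qed simp
    from this[of "nat P"] have "g = (\<Sum>l\<in>{1 - P..0}. exp_fls (of_int l))"
      using True by (simp add: g_def)
    then have "fls_deriv (fls_deriv g) + fls_const (of_int P) * fls_deriv g
        = (\<Sum>l\<in>{1 - P..0}. fls_const (of_int ((P + l) * l)) * exp_fls (of_int l))"
      by (simp only: op)
    also have "\<dots> = (\<Sum>l\<in>{-\<bar>P\<bar>..\<bar>P\<bar>}. let k = - P - l in
         fls_const (of_int (k * l) * ((if l > 0 then 1 else 0) - (if k < 0 then 1 else 0))) * exp_fls (of_int l))"
    proof (intro sum.mono_neutral_cong_left ballI)
      show "(let k = - P - l in fls_const (of_int (k * l) * ((if l > 0 then 1 else 0)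
          - (if k < 0 then 1 else 0))) * exp_fls (of_int l)) = (0 :: complex fls)"
        if "l \<in> {-\<bar>P\<bar>..\<bar>P\<bar>} - {1 - P..0}" for l
        using that True by (cases "l = - P") (auto simp: Let_def)
      show "fls_const (of_int ((P + l) * l)) * exp_fls (of_int l) = (let k = - P - l in
          fls_const (of_int (k * l) * ((if l > 0 then 1 else 0) - (if k < 0 then 1 else 0))) * exp_fls (of_int l))"
        if "l \<in> {1 - P..0}" for l
      proof -
        have "of_int ((P + l) * l) = (of_int ((- P - l) * l) * (0 - 1) :: complex)"
          by (simp add: algebra_simps)
        then show ?thesis using that unfolding Let_def by simp
      qed
    qed (use True in auto)
    finally show ?thesis .
  next
    case False
    have "f * (1 - exp_fls (of_nat N)) = - (\<Sum>l\<in>{1..int N}. exp_fls (of_int l))" for N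
    proof (induction N)
      case (Suc N)
      have "{1..int (Suc N)} = insert (int N + 1) {1..int N}" by auto
      moreover have "f * (1 - exp_fls (of_nat (Suc N))) = f * (1 - exp_fls (of_nat N)) - exp_fls (of_nat (Suc N))"
      proof -
        have "of_nat (Suc N) - 1 = (of_nat N :: complex)" by simp
        then show ?thesis using shift[of "of_nat (Suc N)"] by (simp only: right_diff_distrib) simp
      qed
      ultimately show ?case using Suc by (simp add: add_ac)
    qed simp
    from this[of "nat (- P)"] have "g = - (\<Sum>l\<in>{1..- P}. exp_fls (of_int l))"
      using False by (simp add: g_def)
    then have "fls_deriv (fls_deriv g) + fls_const (of_int P) * fls_deriv g
        = - (\<Sum>l\<in>{1..- P}. fls_const (of_int ((P + l) * l)) * exp_fls (of_int l))"
      using op[of "{1..- P}", symmetric] by (simp only: fls_deriv_neg mult_minus_right minus_add_distrib)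
    also have "\<dots> = (\<Sum>l\<in>{1..- P}. - (fls_const (of_int ((P + l) * l)) * exp_fls (of_int l)))"
      by (simp add: sum_negf)
    also have "\<dots> = (\<Sum>l\<in>{-\<bar>P\<bar>..\<bar>P\<bar>}. let k = - P - l in
         fls_const (of_int (k * l) * ((if l > 0 then 1 else 0) - (if k < 0 then 1 else 0))) * exp_fls (of_int l))"
    proof (intro sum.mono_neutral_cong_left ballI)
      show "(let k = - P - l in fls_const (of_int (k * l) * ((if l > 0 then 1 else 0)
          - (if k < 0 then 1 else 0))) * exp_fls (of_int l)) = (0 :: complex fls)"
        if "l \<in> {-\<bar>P\<bar>..\<bar>P\<bar>} - {1..- P}" for l
        using that False by (auto simp: Let_def)
      show "- (fls_const (of_int ((P + l) * l)) * exp_fls (of_int l)) = (let k = - P - l in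
          fls_const (of_int (k * l) * ((if l > 0 then 1 else 0) - (if k < 0 then 1 else 0))) * exp_fls (of_int l))"
        if "l \<in> {1..- P}" for l
      proof -
        have "of_int ((- P - l) * l) * (1 - 0) = (- of_int ((P + l) * l) :: complex)"
          by (simp add: algebra_simps)
        then show ?thesis using that unfolding Let_def by simp
      qed
    qed (use False in auto)
    finally show ?thesis .
  qed
  finally show ?thesis .
qed

abbreviation expm1_fls :: "complex fls" where "expm1_fls \<equiv> fps_to_fls (fps_exp 1 - 1)"

text \<open>
The order of \<open>(e^y - 1)^N\<close> is \<open>N\<close>, for negative \<open>N\<close> as well.
\<close>

lemma exp_expm1_nth_eq_0:
  assumes "n < - p - 1"
  shows "fls_nth (exp_fls c * expm1_fls powi (- n - 1)) p = 0"
proof (cases "- n - 1 \<ge> 0")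
  case True
  have "exp_fls c * expm1_fls powi (- n - 1) = fps_to_fls (fps_exp c * (fps_exp 1 - 1) ^ nat (- n - 1))"
    using True by (simp only: power_int_def if_True fps_to_fls_power fls_times_fps_to_fls)
  then have "fls_nth (exp_fls c * expm1_fls powi (- n - 1)) p = (if p < 0 then 0 else (fps_exp c * (fps_exp 1 - 1) ^ nat (- n - 1)) $ nat p)"
    by (simp only: fps_to_fls_nth)
  moreover have "(fps_exp c * (fps_exp 1 - 1) ^ nat (- n - 1)) $ nat p = 0" if "p \<ge> 0"
  proof -
    have "(fps_exp 1 - 1 :: complex fps) = fps_X * fps_shift 1 (fps_exp 1 - 1)"
      by (rule fps_ext) simp
    then have "(fps_exp 1 - 1 :: complex fps) ^ N = fps_X ^ N * fps_shift 1 (fps_exp 1 - 1) ^ N" for N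
      by (metis power_mult_distrib)
    then have e: "fps_exp c * (fps_exp 1 - 1) ^ N = fps_X ^ N * (fps_exp c * fps_shift 1 (fps_exp 1 - 1) ^ N)" for N
      by (simp add: mult_ac)
    show ?thesis using that assms unfolding e fps_X_power_mult_nth by simp
  qed
  ultimately show ?thesis by simp
next
  case False
  then have np: "nat (n + 1) > 0" and pn: "p < - int (nat (n + 1))" using assms by auto
  define u :: "complex fps" where "u = fps_shift 1 (fps_exp 1 - 1)"
  have u0: "u $ 0 = 1" by (simp add: u_def)
  have "fps_exp 1 - 1 = fps_X * u"
    by (rule fps_ext) (simp add: u_def)
  then have "expm1_fls = fls_X * fps_to_fls u"
    by (simp add: fls_times_fps_to_fls)
  then have inv: "inverse expm1_fls = fls_X_inv * fps_to_fls (inverse u)"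
    using u0 by (simp add: fls_inverse_X fls_inverse_fps_to_fls)
  have "expm1_fls powi (- n - 1) = inverse expm1_fls ^ nat (n + 1)" using False by (simp add: power_int_def add.commute)
  also have "\<dots> = fls_X_inv ^ nat (n + 1) * fps_to_fls (inverse u ^ nat (n + 1))"
    unfolding inv by (simp add: power_mult_distrib fps_to_fls_power)
  finally have "exp_fls c * expm1_fls powi (- n - 1) = fls_X_inv ^ nat (n + 1) * fps_to_fls (fps_exp c * inverse u ^ nat (n + 1))"
    by (simp add: fls_times_fps_to_fls mult_ac)
  also have "\<dots> = fls_shift (int (nat (n + 1))) (fps_to_fls (fps_exp c * inverse u ^ nat (n + 1)))"
    by (rule fls_X_inv_power_times_conv_shift)
  finally show ?thesis using pn by simp
qed

text \<open>
With \<open>z = e^y - 1\<close> the truncated sum is the expansion of \<open>(1+z)^(-i-1)\<close> up to order \<open>M\<close>. The induction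
on \<open>i\<close> uses that \<open>1 + z\<close> times the expansion for \<open>i + 1\<close> is the expansion for \<open>i\<close>, up to a boundary
term of order \<open>M\<close>.
\<close>

lemma negative_binomial_exp:
  "\<exists>q. fps_exp 1 * (\<Sum>t<M. fps_const ((-1) ^ t * of_nat ((t + i) choose i)) * (fps_exp 1 - 1) ^ t)
     = fps_exp (- of_nat i) + (fps_exp 1 - 1 :: complex fps) ^ M * q"
proof -
  define z :: "complex fps" where "z = fps_exp 1 - 1"
  define S where "S i = (\<Sum>t<M. fps_const ((-1) ^ t * of_nat ((t + i) choose i)) * z ^ t)" for i
  have e: "fps_exp 1 = 1 + z" by (simp add: z_def)
  have "\<exists>q. (1 + z) * S i = fps_exp (- of_nat i) + z ^ M * q"
  proof (induction i)
    case 0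
    have "S 0 = (\<Sum>t<M. (- z) ^ t)"
    proof -
      have "fps_const ((-1) ^ t) = ((-1) ^ t :: complex fps)" for t
        by (cases "even t") (simp_all add: fps_const_1_eq_1[symmetric] del: fps_const_1_eq_1)
      then show ?thesis
        unfolding S_def by (intro sum.cong refl) (simp add: power_minus[of z _])
    qed
    then have "(1 + z) * S 0 = 1 - (- z) ^ M"
      using one_diff_power_eq[of "- z" M] by simp
    also have "\<dots> = fps_exp (- of_nat 0) + z ^ M * (- ((-1) ^ M))"
      by (simp add: power_minus[of z] mult.commute)
    finally show ?case by blast
  next
    case (Suc i)
    then obtain q where q: "(1 + z) * S i = fps_exp (- of_nat i) + z ^ M * q" by blast
    let ?c = "\<lambda>i t. fps_const ((-1) ^ t * of_nat ((t + i) choose i) :: complex)"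
    have "(1 + z) * (\<Sum>t<M. ?c (Suc i) t * z ^ t)
        = (\<Sum>t<M. ?c i t * z ^ t) + fps_const (- ((-1) ^ M * of_nat ((M + i) choose Suc i))) * z ^ M" for M
    proof (induction M)
      case (Suc M)
      let ?b = "\<lambda>M. fps_const (- ((-1) ^ M * of_nat ((M + i) choose Suc i)) :: complex)"
      have a: "?b M + ?c (Suc i) M = ?c i M"
        by (simp add: algebra_simps del: fps_const_neg)
      have b: "?b (Suc M) = ?c (Suc i) M" by simp
      have "(1 + z) * (\<Sum>t<Suc M. ?c (Suc i) t * z ^ t)
          = (1 + z) * (\<Sum>t<M. ?c (Suc i) t * z ^ t) + ?c (Suc i) M * z ^ M + ?c (Suc i) M * z ^ Suc M"
        by (simp add: algebra_simps)
      also have "\<dots> = (\<Sum>t<M. ?c i t * z ^ t) + (?b M + ?c (Suc i) M) * z ^ M + ?c (Suc i) M * z ^ Suc M"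
        unfolding Suc by (simp add: distrib_right del: fps_const_add)
      also have "\<dots> = (\<Sum>t<Suc M. ?c i t * z ^ t) + ?b (Suc M) * z ^ Suc M"
        unfolding a b by simp
      finally show ?case .
    qed simp
    then obtain d where d: "(1 + z) * S (Suc i) = S i + d * z ^ M" unfolding S_def by blast
    have x: "fps_exp (-1) * (1 + z) = 1"
      unfolding e[symmetric] by (simp flip: fps_exp_add_mult)
    have "(1 + z) * S (Suc i) = fps_exp (-1) * ((1 + z) * ((1 + z) * S (Suc i)))"
      using x by (simp flip: mult.assoc)
    also have "\<dots> = fps_exp (-1) * (fps_exp (- of_nat i) + z ^ M * q + (1 + z) * d * z ^ M)"
      unfolding d by (simp add: distrib_left q mult.assoc)
    also have "\<dots> = fps_exp (- of_nat (Suc i)) + z ^ M * (fps_exp (-1) * (q + (1 + z) * d))"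
      by (simp add: ring_distribs mult_ac flip: fps_exp_add_mult)
    finally show ?case by blast
  qed
  then show ?thesis unfolding S_def e[symmetric] unfolding z_def .
qed

lemma fps_to_fls_sum: "fps_to_fls (\<Sum>x\<in>A. f x) = (\<Sum>x\<in>A. fps_to_fls (f x))"
  by (induction A rule: infinite_finite_induct) simp_all

text \<open>
These are the coefficients of \<open>e^(-k(y\<^sub>1-y\<^sub>2)) = e^(-k y\<^sub>1) e^(k y\<^sub>2)\<close>, expanded in powers of \<open>y\<^sub>1 - y\<^sub>2\<close> first.
For \<open>mj < 0\<close> either \<open>n < 0\<close> or the binomial coefficient vanishes.
\<close>

lemma exp_difference_coeff:
  fixes k :: complex
  assumes n: "n = mj + int r"
  shows "(of_int n gchoose r) * (-1) ^ r * fls_nth (exp_fls (- k)) n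
    = (if 0 \<le> mj then (- k) ^ nat mj / fact (nat mj) * (k ^ r / fact r) else 0)"
proof (cases "0 \<le> mj")
  case True
  then have nn: "nat n = nat mj + r" using n by (simp add: nat_add_distrib)
  have "(of_int n gchoose r :: complex) = of_nat ((nat mj + r) choose r)"
    unfolding binomial_gbinomial using True n by simp
  also have "\<dots> = fact (nat mj + r) / (fact r * fact (nat mj))"
    by (simp add: binomial_fact)
  finally have g: "(of_int n gchoose r :: complex) = fact (nat mj + r) / (fact r * fact (nat mj))" .
  have p: "(- k) ^ (nat mj + r) * (-1) ^ r = (- k) ^ nat mj * k ^ r"
    by (simp add: power_add flip: power_mult_distrib)
  have "fls_nth (exp_fls (- k)) n = (- k) ^ (nat mj + r) / fact (nat mj + r)"
    using True n nn by simp
  then show ?thesis using True p unfolding g by (simp add: field_simps)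
next
  case False
  show ?thesis
  proof (cases "n < 0")
    case neg: False
    then have "(of_int n gchoose r :: complex) = of_nat (nat n choose r)"
      unfolding binomial_gbinomial by simp
    moreover have "nat n < r" using neg False n by simp
    ultimately show ?thesis using False by simp
  qed (use False in simp)
qed

lemma exp_convolution_nat:
  "(\<Sum>k\<le>n. a ^ k / fact k * (b ^ (n - k) / fact (n - k))) = (a + b :: complex) ^ n / fact n"
proof -
  have "a ^ k / fact k * (b ^ (n - k) / fact (n - k)) = of_nat (n choose k) * a ^ k * b ^ (n - k) / fact n"
    if "k \<le> n" for k
    using that by (simp add: binomial_fact)
  then show ?thesis by (simp add: binomial_ring sum_divide_distrib)
qed

section \<open>Iterated derivatives of Laurent series\<close>

text \<open>
The binomial coefficients in the expansion of \<open>(t + r)^n\<close> are those of an iterated derivative; this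
is what turns linear substitutions into Taylor expansions.
\<close>

lemma funpow_fls_deriv_nth:
  "fls_nth ((fls_deriv ^^ k) f) n
     = fact k * (of_int (n + int k) gchoose k) * fls_nth f (n + int k)" for f :: "complex fls"
proof (induction k arbitrary: n)
  case (Suc k)
  have "fact (Suc k) * (of_int (n + int (Suc k)) gchoose Suc k :: complex)
      = fact k * (of_nat (Suc k) * (of_int (n + int (Suc k)) gchoose Suc k))"
    by simp
  also have "of_nat (Suc k) * (of_int (n + int (Suc k)) gchoose Suc k :: complex)
      = of_int (n + 1) * (of_int (n + int (Suc k)) gchoose k)"
    using gbinomial_mult_1[of "of_int (n + int (Suc k)) :: complex" k] by (simp add: algebra_simps)
  finally show ?case
    using Suc[of "n + 1"] by (simp add: add_ac)
qed simp

text \<open>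
The derivative conjugated by \<open>e^(ct)\<close>, that is, \<open>e^(-ct) D e^(ct)\<close>.
\<close>

definition shifted_deriv :: "complex \<Rightarrow> complex fls \<Rightarrow> complex fls" where
  "shifted_deriv c f = fls_deriv f + fls_const c * f"

lemma funpow_shifted_deriv:
  "(shifted_deriv c ^^ n) f = (\<Sum>b\<le>n. fls_const (of_nat (n choose b) * c ^ b) * (fls_deriv ^^ (n - b)) f)"
proof (induction n)
  case (Suc n)
  let ?D = "\<lambda>n. (fls_deriv ^^ n) f"
  have d: "fls_deriv (fls_const a * g) = fls_const a * fls_deriv g" for a and g :: "complex fls"
    by (simp add: fls_deriv_mult_const_left)
  have "(shifted_deriv c ^^ Suc n) f
      = (\<Sum>b\<le>n. fls_const (of_nat (n choose b) * c ^ b) * ?D (Suc n - b))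
        + (\<Sum>b\<le>n. fls_const (of_nat (n choose b) * c ^ Suc b) * ?D (n - b))"
  proof -
    have "fls_deriv (fls_const a * ?D (n - b)) = fls_const a * ?D (Suc n - b)" if "b \<le> n" for a b
      using that by (simp add: d Suc_diff_le del: fls_deriv_mult)
    moreover have "fls_const c * (fls_const a * g) = fls_const (a * c) * g" for a and g :: "complex fls"
      by (simp add: mult.assoc[symmetric] mult.commute[of c])
    ultimately have "shifted_deriv c (\<Sum>b\<le>n. fls_const (a b) * ?D (n - b))
      = (\<Sum>b\<le>n. fls_const (a b) * ?D (Suc n - b)) + (\<Sum>b\<le>n. fls_const (a b * c) * ?D (n - b))" for a
      unfolding shifted_deriv_def fls_deriv_sum sum_distrib_left
      by (intro arg_cong2[of _ _ _ _ "(+)"] sum.cong refl) auto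
    from this[of "\<lambda>b. of_nat (n choose b) * c ^ b"] show ?thesis by (simp add: Suc mult.assoc mult.commute[of c])
  qed
  also have "(\<Sum>b\<le>n. fls_const (of_nat (n choose b) * c ^ b) * ?D (Suc n - b))
      = (\<Sum>b\<le>Suc n. fls_const (of_nat (n choose b) * c ^ b) * ?D (Suc n - b))"
    by simp
  also have "\<dots> = ?D (Suc n) + (\<Sum>b\<le>n. fls_const (of_nat (n choose Suc b) * c ^ Suc b) * ?D (n - b))"
    by (subst sum.atMost_Suc_shift) simp
  also have "\<dots> + (\<Sum>b\<le>n. fls_const (of_nat (n choose b) * c ^ Suc b) * ?D (n - b))
      = ?D (Suc n) + (\<Sum>b\<le>n. fls_const (of_nat (Suc n choose Suc b) * c ^ Suc b) * ?D (n - b))"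
    by (simp add: sum.distrib[symmetric] ring_distribs fls_plus_const[symmetric] add_ac)
  also have "\<dots> = (\<Sum>b\<le>Suc n. fls_const (of_nat (Suc n choose b) * c ^ b) * ?D (Suc n - b))"
    by (simp only: sum.atMost_Suc_shift[of _ n] binomial_n_0 power_0 of_nat_1 mult_1 diff_zero
        fls_const_1 diff_Suc_Suc)
  finally show ?case .
qed simp

lemma funpow_deriv_exp_mult: "(fls_deriv ^^ n) (exp_fls c * f) = exp_fls c * (shifted_deriv c ^^ n) f"
  by (induction n) (simp_all add: fls_deriv_exp_fls shifted_deriv_def algebra_simps)

lemma fls_deriv_shifted_deriv_commute:
  "(fls_deriv ^^ m) ((shifted_deriv c ^^ n) f) = (shifted_deriv c ^^ n) ((fls_deriv ^^ m) f)"
proof -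
  have "fls_deriv (shifted_deriv c g) = shifted_deriv c (fls_deriv g)" for g
    by (simp add: shifted_deriv_def)
  then have "fls_deriv ((shifted_deriv c ^^ n) g) = (shifted_deriv c ^^ n) (fls_deriv g)" for g
    by (induction n) simp_all
  then show ?thesis by (induction m) simp_all
qed

section \<open>Exponentials and linear substitutions in several variables\<close>

lemma UNIV_fvar: "UNIV = {X1, X2, Y1, Y2, Y3, Y4, W}"
  using fvar.exhaust by blast

lemma all_fvar: "(\<forall>i. P i) \<longleftrightarrow> P X1 \<and> P X2 \<and> P Y1 \<and> P Y2 \<and> P Y3 \<and> P Y4 \<and> P W"
  by (metis fvar.exhaust)

lemma prod_fvar: "prod f UNIV = f X1 * f X2 * f Y1 * f Y2 * f Y3 * f Y4 * (f W :: complex)"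
  unfolding UNIV_fvar by (simp add: mult_ac)

lemma fexp_eq_0: "m i < 0 \<or> (c i = 0 \<and> m i \<noteq> 0) \<Longrightarrow> fexp c m = 0"
proof (erule disjE)
  assume "m i < 0"
  then have "\<not> (\<forall>i. 0 \<le> m i)" by (auto simp: not_le)
  then show ?thesis unfolding fexp_def by (rule if_not_P)
next
  assume i: "c i = 0 \<and> m i \<noteq> 0"
  have "(\<Prod>i\<in>UNIV. c i ^ nat (m i) / fact (nat (m i))) = 0" if "\<forall>i. 0 \<le> m i"
    using i that[rule_format, of i] by (intro prod_zero bexI[of _ i]) auto
  then show ?thesis unfolding fexp_def by simp
qed

lemma fexp_convolution_finite: "finite {k. fexp c k * fexp d (m - k) \<noteq> 0}"
proof (rule finite_subset)
  show "{k. fexp c k * fexp d (m - k) \<noteq> 0} \<subseteq> PiE UNIV (\<lambda>i. {0..m i})"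
  proof (intro subsetI PiE_I)
    fix k i assume "k \<in> {k. fexp c k * fexp d (m - k) \<noteq> 0}"
    then show "k i \<in> {0..m i}"
      using fexp_eq_0[of k i c] fexp_eq_0[of "m - k" i d] by (auto simp: not_less[symmetric])
  qed auto
qed (auto intro: finite_PiE)

text \<open>
The law \<open>e^c e^d = e^(c+d)\<close>. The coefficient of a monomial factors over the variables, so a product of
sums over the single exponents replaces the sum over exponent vectors.
\<close>

lemma fexp_convolution: "Sum_any (\<lambda>k. fexp c k * fexp d (m - k)) = fexp (c + d) m"
proof (cases "\<forall>i. 0 \<le> m i")
  case False
  then obtain i where i: "m i < 0" by (auto simp: not_le)
  then have "fexp c k * fexp d (m - k) = 0" for k
    using fexp_eq_0[of k i c] fexp_eq_0[of "m - k" i d] by force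
  then have "(\<lambda>k. fexp c k * fexp d (m - k)) = (\<lambda>k. 0)" by (rule ext)
  then show ?thesis using fexp_eq_0[of m i "c + d"] i by (simp only:) simp
next
  case True
  let ?B = "PiE UNIV (\<lambda>i. {0..m i})"
  let ?g = "\<lambda>i k. c i ^ nat k / fact (nat k) * (d i ^ nat (m i - k) / fact (nat (m i - k)))"
  have "Sum_any (\<lambda>k. fexp c k * fexp d (m - k)) = (\<Sum>k\<in>?B. fexp c k * fexp d (m - k))"
  proof (rule Sum_any_eq_sum)
    fix k assume "k \<notin> ?B"
    then have "\<exists>i. \<not> (0 \<le> k i \<and> k i \<le> m i)" by (simp add: PiE_UNIV_domain Pi_iff)
    then obtain i where "k i < 0 \<or> (m - k) i < 0" by (auto simp: not_le)
    then show "fexp c k * fexp d (m - k) = 0"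
      using fexp_eq_0[of k i c] fexp_eq_0[of "m - k" i d] by auto
  qed (auto intro: finite_PiE)
  also have "\<dots> = (\<Sum>k\<in>?B. \<Prod>i\<in>UNIV. ?g i (k i))"
    by (rule sum.cong) (auto simp: fexp_def prod.distrib[symmetric])
  also have "\<dots> = (\<Prod>i\<in>UNIV. \<Sum>k\<in>{0..m i}. ?g i k)"
    by (rule prod_sum_PiE[symmetric]) auto
  also have "\<dots> = (\<Prod>i\<in>UNIV. (c i + d i) ^ nat (m i) / fact (nat (m i)))"
  proof (rule prod.cong)
    fix i
    have "(\<Sum>k\<in>{0..m i}. ?g i k) = (\<Sum>k\<le>nat (m i). c i ^ k / fact k * (d i ^ (nat (m i) - k) / fact (nat (m i) - k)))"
      by (rule sum.reindex_bij_witness[of _ int nat]) (use True[rule_format, of i] in \<open>auto simp: nat_diff_distrib\<close>)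
    then show "(\<Sum>k\<in>{0..m i}. ?g i k) = (c i + d i) ^ nat (m i) / fact (nat (m i))"
      by (simp only: exp_convolution_nat)
  qed simp
  also have "\<dots> = fexp (c + d) m"
    using True by (simp add: fexp_def)
  finally show ?thesis .
qed

lemma fexp_deriv: "of_int (m i + 1) * fexp c (m(i := m i + 1)) = c i * fexp c m"
proof (cases "\<forall>j. 0 \<le> m j")
  case True
  let ?p = "\<Prod>j\<in>UNIV - {i}. c j ^ nat (m j) / fact (nat (m j))"
  have "fexp c (m(i := m i + 1)) = c i ^ nat (m i + 1) / fact (nat (m i + 1)) * ?p"
    using True unfolding fexp_def by (subst prod.remove[of _ i]) (auto intro!: prod.cong)
  moreover have "fexp c m = c i ^ nat (m i) / fact (nat (m i)) * ?p"
    using True unfolding fexp_def by (subst prod.remove[of _ i]) auto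
  moreover have "nat (m i + 1) = Suc (nat (m i))" "of_int (m i + 1) = (of_nat (Suc (nat (m i))) :: complex)"
    using True[rule_format, of i] by (simp_all add: nat_add_distrib)
  ultimately show ?thesis by (simp del: of_nat_Suc)
next
  case False
  then obtain j where j: "m j < 0" by (auto simp: not_le)
  then have "fexp c m = 0" by (intro fexp_eq_0[of _ j]) simp
  moreover have "of_int (m i + 1) * fexp c (m(i := m i + 1)) = 0"
  proof (cases "m i = -1")
    case False
    then have "fexp c (m(i := m i + 1)) = 0" using j by (intro fexp_eq_0[of _ j]) auto
    then show ?thesis by simp
  qed simp
  ultimately show ?thesis by simp
qed

text \<open>
Taylor's formula \<open>f(y\<^sub>j + r) = \<Sum>k. f^(k)(y\<^sub>j) r^k / k!\<close>, which is the expansion in nonnegative powers of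
the variables in \<open>r\<close>.
\<close>

lemma lin_subst_taylor:
  assumes "c j = 1"
  shows "lin_subst j c f m =
    (if \<forall>i. i \<noteq> j \<longrightarrow> 0 \<le> m i
     then fls_nth ((fls_deriv ^^ (\<Sum>i\<in>-{j}. nat (m i))) f) (m j)
       * (\<Prod>i\<in>-{j}. c i ^ nat (m i) / fact (nat (m i))) else 0)"
proof -
  define k where "k = (\<Sum>i\<in>-{j}. nat (m i))"
  have "lin_subst j c f m = lin_powi j c (m j + int k) m * fls_nth f (m j + int k)"
    unfolding lin_subst_def
    by (rule Sum_any_eq_single) (auto simp: lin_powi_def k_def Let_def)
  then show ?thesis
    unfolding lin_powi_def Let_def k_def[symmetric] assms funpow_fls_deriv_nth
    by (cases "\<forall>i. i \<noteq> j \<longrightarrow> 0 \<le> m i") (simp_all del: not_all)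
qed

text \<open>
The expansions of \<open>(-c)^n\<close> and \<open>c^n\<close> differ by the sign \<open>(-1)^n\<close>, and only even \<open>n\<close> occur in \<open>f\<close>.
\<close>

lemma lin_subst_uminus:
  assumes "\<And>n. odd n \<Longrightarrow> fls_nth f n = 0"
  shows "lin_subst j (- c) f = lin_subst j c f"
proof
  fix m
  have "lin_powi j (- c) n m * fls_nth f n = lin_powi j c n m * fls_nth f n" for n
  proof (cases "even n \<and> (\<forall>i. i \<noteq> j \<longrightarrow> 0 \<le> m i)")
    case True
    have p: "(\<Prod>i\<in>-{j}. (- c i) ^ nat (m i) / fact (nat (m i)))
        = (-1) ^ (\<Sum>i\<in>-{j}. nat (m i)) * (\<Prod>i\<in>-{j}. c i ^ nat (m i) / fact (nat (m i)))"
      by (simp add: power_minus[of "c _"] power_sum prod.distrib[symmetric] mult_ac)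
    have "(- c j) powi (n - int k) * (-1) ^ k = c j powi (n - int k)" for k
    proof -
      have "even (n - int k) \<longleftrightarrow> even k" using True by simp
      then show ?thesis by (cases "even k") (simp_all add: power_int_minus_left)
    qed
    then have q: "(- c j) powi (n - int k) * (fact k * ((-1) ^ k * z)) = c j powi (n - int k) * (fact k * z)"
      for k and z :: complex
      by (simp flip: mult.assoc)
    show ?thesis
      unfolding lin_powi_def Let_def fun_Compl_def p using q by (simp only: mult.assoc)
  qed (use assms in \<open>auto simp: lin_powi_def Let_def\<close>)
  then show "lin_subst j (- c) f m = lin_subst j c f m"
    unfolding lin_subst_def by (simp only:)
qed

lemma fexp_pair_convolution:
  assumes "a \<noteq> b"
  shows "Sum_any (\<lambda>k. fexp (\<lambda>i. c * (var a - var b) i) k * F (m - k))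
    = Sum_any (\<lambda>(p::nat, q::nat). c ^ p / fact p * ((- c) ^ q / fact q)
        * F (m(a := m a - int p, b := m b - int q)))"
proof (subst Sum_any_reindex[of "\<lambda>(p::nat, q::nat). (\<lambda>i. 0)(a := int p, b := int q)"], goal_cases)
  case 1
  have "p = p' \<and> q = q'" if "(\<lambda>i. 0)(a := int p, b := int q) = (\<lambda>i. 0)(a := int p', b := int q')" for p q p' q'
    using fun_cong[OF that, of a] fun_cong[OF that, of b] assms by simp
  then show ?case by (auto simp: inj_on_def)
next
  case (2 k)
  have "fexp (\<lambda>i. c * (var a - var b) i) k = 0"
  proof (rule ccontr)
    assume nz: "fexp (\<lambda>i. c * (var a - var b) i) k \<noteq> 0"
    then have "k a \<ge> 0" "k b \<ge> 0"
      using fexp_eq_0[of k _ "\<lambda>i. c * (var a - var b) i"] not_less by blast+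
    moreover have "k i = 0" if "i \<noteq> a" "i \<noteq> b" for i
      using nz that fexp_eq_0[of k i "\<lambda>i. c * (var a - var b) i"] by (auto simp: var_def)
    ultimately have "k = (\<lambda>i. 0)(a := int (nat (k a)), b := int (nat (k b)))"
      using assms by (intro ext) simp
    then have "k = (\<lambda>(p::nat, q::nat). (\<lambda>i. 0)(a := int p, b := int q)) (nat (k a), nat (k b))"
      by (simp only: prod.case)
    then have "k \<in> range (\<lambda>(p::nat, q::nat). (\<lambda>i. 0)(a := int p, b := int q))"
      by (rule range_eqI)
    then show False using 2 by simp
  qed
  then show ?case by simp
next
  case 3
  have *: "fexp (\<lambda>i. c * (var a - var b) i) ((\<lambda>i. 0)(a := int p, b := int q))
      = c ^ p / fact p * ((- c) ^ q / fact q)" for p q :: nat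
  proof -
    have "(\<Prod>i\<in>UNIV. (c * (var a - var b) i) ^ nat (((\<lambda>i. 0)(a := int p, b := int q)) i)
             / fact (nat (((\<lambda>i. 0)(a := int p, b := int q)) i)))
        = (\<Prod>i\<in>{a, b}. (c * (var a - var b) i) ^ nat (((\<lambda>i. 0)(a := int p, b := int q)) i)
             / fact (nat (((\<lambda>i. 0)(a := int p, b := int q)) i)))"
      by (rule prod.mono_neutral_right) auto
    then show ?thesis using assms by (simp add: fexp_def var_def)
  qed
  have **: "m - (\<lambda>i. 0)(a := int p, b := int q) = m(a := m a - int p, b := m b - int q)" for p q
    using assms by auto
  show ?case
    by (rule Sum_any.cong, rename_tac x, case_tac x) (simp only: prod.case * **)
qed

lemma fexp_one:
  assumes "\<And>i. i \<noteq> b \<Longrightarrow> c i = 0"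
  shows "fexp c m = (if 0 \<le> m b \<and> (\<forall>i. i \<noteq> b \<longrightarrow> m i = 0) then c b ^ nat (m b) / fact (nat (m b)) else 0)"
proof (cases "0 \<le> m b \<and> (\<forall>i. i \<noteq> b \<longrightarrow> m i = 0)")
  case True
  then have "\<forall>i. 0 \<le> m i" by (metis order.refl)
  moreover have "(\<Prod>i\<in>UNIV. c i ^ nat (m i) / fact (nat (m i))) = (\<Prod>i\<in>{b}. c i ^ nat (m i) / fact (nat (m i)))"
    by (rule prod.mono_neutral_right) (use True in auto)
  ultimately show ?thesis using True by (simp add: fexp_def)
next
  case False
  then show ?thesis
    using fexp_eq_0[of m b c] fexp_eq_0[of m _ c] assms by (auto simp: not_le)
qed

lemma fexp_two:
  assumes "a \<noteq> b" and "\<And>i. i \<noteq> a \<Longrightarrow> i \<noteq> b \<Longrightarrow> c i = 0"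
  shows "fexp c m = (if 0 \<le> m a \<and> 0 \<le> m b \<and> (\<forall>i. i \<noteq> a \<longrightarrow> i \<noteq> b \<longrightarrow> m i = 0)
    then c a ^ nat (m a) / fact (nat (m a)) * (c b ^ nat (m b) / fact (nat (m b))) else 0)"
proof (cases "0 \<le> m a \<and> 0 \<le> m b \<and> (\<forall>i. i \<noteq> a \<longrightarrow> i \<noteq> b \<longrightarrow> m i = 0)")
  case True
  then have "\<forall>i. 0 \<le> m i" by (metis order.refl)
  moreover have "(\<Prod>i\<in>UNIV. c i ^ nat (m i) / fact (nat (m i))) = (\<Prod>i\<in>{a, b}. c i ^ nat (m i) / fact (nat (m i)))"
    by (rule prod.mono_neutral_right) (use True in auto)
  ultimately show ?thesis using assms(1) True by (simp add: fexp_def)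
next
  case False
  then show ?thesis
    using fexp_eq_0[of m a c] fexp_eq_0[of m b c] fexp_eq_0[of m _ c] assms(2) by (auto simp: not_le)
qed

lemma fexp_three:
  assumes "a \<noteq> b" "a \<noteq> d" "b \<noteq> d"
  shows "fexp c ((\<lambda>i. 0)(a := int p, b := int q, d := int r))
    = c a ^ p / fact p * (c b ^ q / fact q) * (c d ^ r / fact r)"
proof -
  let ?m = "(\<lambda>i. 0)(a := int p, b := int q, d := int r)"
  have "(\<Prod>i\<in>UNIV. c i ^ nat (?m i) / fact (nat (?m i))) = (\<Prod>i\<in>{a, b, d}. c i ^ nat (?m i) / fact (nat (?m i)))"
    by (rule prod.mono_neutral_right) auto
  then show ?thesis using assms by (simp add: fexp_def mult.assoc)
qed

lemma fexp_four:
  assumes "c X1 = 0" "c X2 = 0" "c W = 0"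
  shows "fexp c m = (if m X1 = 0 \<and> m X2 = 0 \<and> m W = 0 \<and> 0 \<le> m Y1 \<and> 0 \<le> m Y2 \<and> 0 \<le> m Y3 \<and> 0 \<le> m Y4
    then c Y1 ^ nat (m Y1) / fact (nat (m Y1)) * (c Y2 ^ nat (m Y2) / fact (nat (m Y2)))
       * (c Y3 ^ nat (m Y3) / fact (nat (m Y3))) * (c Y4 ^ nat (m Y4) / fact (nat (m Y4))) else 0)"
proof (cases "m X1 = 0 \<and> m X2 = 0 \<and> m W = 0 \<and> 0 \<le> m Y1 \<and> 0 \<le> m Y2 \<and> 0 \<le> m Y3 \<and> 0 \<le> m Y4")
  case True
  then have "\<forall>i. 0 \<le> m i" by (subst all_fvar) auto
  then show ?thesis using True unfolding fexp_def prod_fvar by simp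
next
  case False
  have "fexp c m = 0"
  proof -
    consider "m X1 \<noteq> 0" | "m X2 \<noteq> 0" | "m W \<noteq> 0" | "m Y1 < 0" | "m Y2 < 0" | "m Y3 < 0" | "m Y4 < 0"
      using False by linarith
    then show ?thesis by cases (use assms fexp_eq_0 in blast)+
  qed
  then show ?thesis unfolding if_not_P[OF False] .
qed

lemma lin_powi_difference:
  assumes "j \<noteq> b"
  shows "lin_powi j (var j - var b) n m =
    (if n = m j + m b \<and> 0 \<le> m b \<and> (\<forall>i. i \<noteq> j \<longrightarrow> i \<noteq> b \<longrightarrow> m i = 0)
     then (of_int n gchoose nat (m b)) * (-1) ^ nat (m b) else 0)"
proof -
  let ?c = "var j - var b"
  let ?k = "\<Sum>i\<in>-{j}. nat (m i)"
  show ?thesis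
  proof (cases "0 \<le> m b \<and> (\<forall>i. i \<noteq> j \<longrightarrow> i \<noteq> b \<longrightarrow> m i = 0)")
    case True
    have "?k = (\<Sum>i\<in>{b}. nat (m i))"
      by (rule sum.mono_neutral_right) (use True assms in auto)
    moreover have "(\<Prod>i\<in>-{j}. ?c i ^ nat (m i) / fact (nat (m i))) = (\<Prod>i\<in>{b}. ?c i ^ nat (m i) / fact (nat (m i)))"
      by (rule prod.mono_neutral_right) (use True assms in auto)
    moreover have "?c j = 1" "?c b = -1" using assms by (auto simp: var_def)
    moreover have "\<forall>i. i \<noteq> j \<longrightarrow> 0 \<le> m i" using True by (metis order.refl)
    ultimately show ?thesis
      unfolding lin_powi_def Let_def using True by auto
  next
    case False
    have "(\<Prod>i\<in>-{j}. ?c i ^ nat (m i) / fact (nat (m i))) = 0" if nn: "\<forall>i. i \<noteq> j \<longrightarrow> 0 \<le> m i"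
    proof -
      obtain i where i: "i \<noteq> j" "i \<noteq> b" "m i \<noteq> 0" using False nn assms by metis
      then have "m i > 0" using nn by force
      then show ?thesis using i by (intro prod_zero bexI[of _ i]) (auto simp: var_def)
    qed
    then show ?thesis unfolding lin_powi_def Let_def using False by auto
  qed
qed

lemma lin_subst_difference:
  assumes "j \<noteq> b"
  shows "lin_subst j (var j - var b) f m =
    (if 0 \<le> m b \<and> (\<forall>i. i \<noteq> j \<longrightarrow> i \<noteq> b \<longrightarrow> m i = 0)
     then (of_int (m j + m b) gchoose nat (m b)) * (-1) ^ nat (m b) * fls_nth f (m j + m b) else 0)"
  unfolding lin_subst_def lin_powi_difference[OF assms]
  by (subst Sum_any_eq_single[of "m j + m b"]) auto

section \<open>The scalar part of the commutator\<close>

lemma prod_Compl_Y1: "prod f (- {Y1}) = f X1 * f X2 * f Y2 * f Y3 * f Y4 * (f W :: complex)"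
proof -
  have "- {Y1} = {X1, X2, Y2, Y3, Y4, W}"
    using UNIV_fvar by auto
  then show ?thesis by (simp add: mult_ac)
qed

lemma sum_Compl_Y1: "sum f (- {Y1}) = f X1 + f X2 + f Y2 + f Y3 + f Y4 + (f W :: nat)"
proof -
  have "- {Y1} = {X1, X2, Y2, Y3, Y4, W}"
    using UNIV_fvar by auto
  then show ?thesis by simp
qed

text \<open>
The singular scalars of the explicit formula have the arguments \<open>\<plusminus>(y\<^sub>1 - y\<^sub>2 - u + v)\<close>, where \<open>u\<close> and
\<open>v\<close> are \<open>y\<^sub>3\<close> and \<open>y\<^sub>4\<close> in one of the two orders.
\<close>

lemma lin_subst_four:
  assumes "(u, v) = (Y3, Y4) \<or> (u, v) = (Y4, Y3)"
  shows "lin_subst Y1 (var Y1 - var Y2 - var u + var v) f m =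
    (if m X1 = 0 \<and> m X2 = 0 \<and> m W = 0 \<and> 0 \<le> m Y2 \<and> 0 \<le> m u \<and> 0 \<le> m v then
      fls_nth ((fls_deriv ^^ (nat (m u) + (nat (m Y2) + nat (m v)))) f) (m Y1)
        * ((-1) ^ nat (m Y2) / fact (nat (m Y2)) * ((-1) ^ nat (m u) / fact (nat (m u))) / fact (nat (m v)))
     else 0)"
proof -
  let ?c = "var Y1 - var Y2 - var u + var v"
  have c1: "?c Y1 = 1" using assms by (auto simp: var_def)
  show ?thesis
  proof (cases "m X1 = 0 \<and> m X2 = 0 \<and> m W = 0 \<and> 0 \<le> m Y2 \<and> 0 \<le> m u \<and> 0 \<le> m v")
    case True
    then have nonneg: "\<forall>i. i \<noteq> Y1 \<longrightarrow> 0 \<le> m i"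
      using assms by (subst all_fvar) auto
    have "(\<Sum>i\<in>-{Y1}. nat (m i)) = nat (m u) + (nat (m Y2) + nat (m v))"
      using True assms by (auto simp: sum_Compl_Y1)
    moreover have "(\<Prod>i\<in>-{Y1}. ?c i ^ nat (m i) / fact (nat (m i)))
        = (-1) ^ nat (m Y2) / fact (nat (m Y2)) * ((-1) ^ nat (m u) / fact (nat (m u))) / fact (nat (m v))"
      unfolding prod_Compl_Y1 using True assms by (auto simp: var_def)
    ultimately show ?thesis
      unfolding lin_subst_taylor[where c = ?c, OF c1] if_P[OF nonneg] if_P[OF True] by (simp only:)
  next
    case False
    show ?thesis
    proof (cases "\<forall>i. i \<noteq> Y1 \<longrightarrow> 0 \<le> m i")
      case nonneg: True
      have "(\<Prod>i\<in>-{Y1}. ?c i ^ nat (m i) / fact (nat (m i))) = 0"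
        unfolding prod_Compl_Y1 using False nonneg assms by (auto simp: var_def)
      then show ?thesis
        unfolding lin_subst_taylor[where c = ?c, OF c1] by (simp only: False if_False mult_zero_right if_cancel)
    next
      case False': False
      show ?thesis
        unfolding lin_subst_taylor[where c = ?c, OF c1] by (simp only: False False' if_False)
    qed
  qed
qed

lemma fls_vanishes_below: "\<exists>N. \<forall>n. n < N \<longrightarrow> fls_nth (f :: complex fls) n = 0"
  by (rule exI[of _ "fls_subdegree f"]) auto

lemma binomial_term:
  assumes "b \<le> n"
  shows "(- c) ^ b / fact b * ((-1) ^ (n - b) / fact (n - b))
    = (-1) ^ n / fact n * (of_nat (n choose b) * c ^ b :: complex)"
proof -
  have "(- c) ^ b * (-1) ^ (n - b) = (-1) ^ n * c ^ b"
    using assms by (simp add: power_minus[of c] mult_ac flip: power_add)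
  then show ?thesis using assms by (simp add: binomial_fact field_simps)
qed

lemma funpow_shifted_deriv_nth:
  "fls_nth ((shifted_deriv c ^^ n) f) i
     = (\<Sum>b\<le>n. of_nat (n choose b) * c ^ b * fls_nth ((fls_deriv ^^ (n - b)) f) i)"
  unfolding funpow_shifted_deriv by (simp add: fls_nth_sum)

context
  fixes u v :: fvar and P :: complex and f :: "complex fls"
  assumes uv: "(u, v) = (Y3, Y4) \<or> (u, v) = (Y4, Y3)"
begin

text \<open>
Multiplication of \<open>f(y\<^sub>1 - y\<^sub>2 - u + v)\<close> by \<open>e^(P(y\<^sub>1-u))\<close>. In the coefficient of a monomial in \<open>y\<^sub>2, u, v\<close>,
the factor \<open>e^(-Pu)\<close> replaces each derivative \<open>-D\<close> belonging to \<open>u\<close> by \<open>-(D + P)\<close>, and the factor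
\<open>e^(P y\<^sub>1)\<close> conjugates \<open>D + P\<close> back to \<open>D\<close>. Everything is thereby expressed by one Laurent series in
\<open>y\<^sub>1\<close>.
\<close>

lemma fexp_lin_subst_first:
  "Sum_any (\<lambda>k. fexp (\<lambda>i. P * (var Y1 - var u) i) k *
     lin_subst Y1 (var Y1 - var Y2 - var u + var v) f (m - k)) =
   (if m X1 = 0 \<and> m X2 = 0 \<and> m W = 0 \<and> 0 \<le> m Y2 \<and> 0 \<le> m u \<and> 0 \<le> m v then
      fls_nth ((fls_deriv ^^ nat (m u)) (exp_fls P * (fls_deriv ^^ (nat (m Y2) + nat (m v))) f)) (m Y1)
        * ((-1) ^ nat (m Y2) / fact (nat (m Y2)) * ((-1) ^ nat (m u) / fact (nat (m u))) / fact (nat (m v)))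
    else 0)"
proof -
  let ?L = "lin_subst Y1 (var Y1 - var Y2 - var u + var v) f"
  have ne: "Y1 \<noteq> u" "u \<noteq> v" "u \<noteq> X1" "u \<noteq> X2" "u \<noteq> Y2" "u \<noteq> W" "v \<noteq> X1" "v \<noteq> X2" "v \<noteq> Y2" "v \<noteq> W" "v \<noteq> Y1" using uv by auto
  show ?thesis
  proof (cases "m X1 = 0 \<and> m X2 = 0 \<and> m W = 0 \<and> 0 \<le> m Y2 \<and> 0 \<le> m u \<and> 0 \<le> m v")
    case False
    have "?L (m(Y1 := m Y1 - int p, u := m u - int q)) = 0" for p q
      unfolding lin_subst_four[OF uv] using False ne by auto
    then show ?thesis
      unfolding fexp_pair_convolution[OF ne(1)] if_not_P[OF False] by simp
  next
    case True
    define n2 nu nv where "n2 = nat (m Y2)" and "nu = nat (m u)" and "nv = nat (m v)"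
    define g where "g = (fls_deriv ^^ (n2 + nv)) f"
    define pre where "pre = (-1) ^ n2 / fact n2 / (fact nv :: complex)"
    have L: "?L (m(Y1 := m Y1 - int p, u := m u - int q))
       = (if q \<le> nu then fls_nth ((fls_deriv ^^ (nu - q)) g) (m Y1 - int p) * ((-1) ^ (nu - q) / fact (nu - q)) * pre else 0)" for p q
    proof -
      have "nat (m u - int q) = nu - q" unfolding nu_def by (simp add: nat_diff_distrib')
      moreover have "q \<le> nu \<longleftrightarrow> 0 \<le> m u - int q" unfolding nu_def using True by auto
      moreover have "fls_nth ((fls_deriv ^^ (nu - q + (n2 + nv))) f) (m Y1 - int p)
          = fls_nth ((fls_deriv ^^ (nu - q)) g) (m Y1 - int p)"
        by (simp add: g_def funpow_add)
      ultimately show ?thesis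
        unfolding lin_subst_four[OF uv] using True ne
        by (simp add: pre_def n2_def[symmetric] nv_def[symmetric] mult_ac del: add_diff_assoc2)
    qed
    have "\<exists>N. \<forall>q\<le>nu. \<forall>n<N. fls_nth ((fls_deriv ^^ (nu - q)) g) n = 0"
    proof -
      obtain N where N: "\<forall>n<N. fls_nth g n = 0" using fls_vanishes_below by blast
      show ?thesis
        by (rule exI[of _ "N - int nu"]) (auto simp: funpow_fls_deriv_nth N)
    qed
    then obtain N where N: "\<And>q n. q \<le> nu \<Longrightarrow> n < N \<Longrightarrow> fls_nth ((fls_deriv ^^ (nu - q)) g) n = 0"
      by blast
    define A where "A = nat (m Y1 - N)"
    have "Sum_any (\<lambda>k. fexp (\<lambda>i. P * (var Y1 - var u) i) k * ?L (m - k))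
       = (\<Sum>(p, q)\<in>{..A} \<times> {..nu}. P ^ p / fact p * ((- P) ^ q / fact q) *
           (fls_nth ((fls_deriv ^^ (nu - q)) g) (m Y1 - int p) * ((-1) ^ (nu - q) / fact (nu - q)) * pre))"
      unfolding fexp_pair_convolution[OF ne(1)] L
    proof (subst Sum_any_eq_sum[of "{..A} \<times> {..nu}"], goal_cases)
      case (2 x)
      then show ?case using N by (cases x) (auto simp: A_def not_le)
    qed (auto intro!: sum.cong)
    also have "\<dots> = (\<Sum>p\<le>A. \<Sum>q\<le>nu. P ^ p / fact p * ((- P) ^ q / fact q) *
           (fls_nth ((fls_deriv ^^ (nu - q)) g) (m Y1 - int p) * ((-1) ^ (nu - q) / fact (nu - q)) * pre))"
      by (rule sum.cartesian_product[symmetric])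
    also have "\<dots> = (\<Sum>p\<le>A. P ^ p / fact p * fls_nth ((shifted_deriv P ^^ nu) g) (m Y1 - int p)) * ((-1) ^ nu / fact nu * pre)"
      unfolding sum_distrib_right
    proof (rule sum.cong[OF refl], goal_cases)
      case (1 p)
      have "(\<Sum>q\<le>nu. P ^ p / fact p * ((- P) ^ q / fact q) *
           (fls_nth ((fls_deriv ^^ (nu - q)) g) (m Y1 - int p) * ((-1) ^ (nu - q) / fact (nu - q)) * pre))
        = (\<Sum>q\<le>nu. P ^ p / fact p * pre * fls_nth ((fls_deriv ^^ (nu - q)) g) (m Y1 - int p) *
            ((- P) ^ q / fact q * ((-1) ^ (nu - q) / fact (nu - q))))"
        by (intro sum.cong refl) (simp add: mult_ac)
      also have "\<dots> = (\<Sum>q\<le>nu. P ^ p / fact p * pre * fls_nth ((fls_deriv ^^ (nu - q)) g) (m Y1 - int p) *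
            ((-1) ^ nu / fact nu * (of_nat (nu choose q) * P ^ q)))"
        by (intro sum.cong refl) (simp only: binomial_term atMost_iff)
      also have "\<dots> = P ^ p / fact p * fls_nth ((shifted_deriv P ^^ nu) g) (m Y1 - int p) * ((-1) ^ nu / fact nu * pre)"
        unfolding funpow_shifted_deriv_nth sum_distrib_left sum_distrib_right
        by (intro sum.cong refl) (simp add: mult_ac)
      finally show ?case .
    qed
    also have "(\<Sum>p\<le>A. P ^ p / fact p * fls_nth ((shifted_deriv P ^^ nu) g) (m Y1 - int p))
       = fls_nth (exp_fls P * (shifted_deriv P ^^ nu) g) (m Y1)"
      unfolding exp_fls_mult_nth
    proof (rule Sum_any_eq_sum[symmetric])
      fix p assume "p \<notin> {..A}"
      then have "fls_nth ((shifted_deriv P ^^ nu) g) (m Y1 - int p) = 0"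
        unfolding funpow_shifted_deriv_nth by (intro sum.neutral) (auto simp: A_def intro!: N)
      then show "P ^ p / fact p * fls_nth ((shifted_deriv P ^^ nu) g) (m Y1 - int p) = 0" by simp
    qed simp
    also have "exp_fls P * (shifted_deriv P ^^ nu) g = (fls_deriv ^^ nu) (exp_fls P * g)"
      by (simp add: funpow_deriv_exp_mult)
    finally show ?thesis
      unfolding if_P[OF True] by (simp only: g_def pre_def n2_def nu_def nv_def) (simp add: mult_ac)
  qed
qed

text \<open>
The same for the factor \<open>e^(P(y\<^sub>2-v))\<close>, which replaces the derivatives belonging to \<open>y\<^sub>2\<close> and \<open>v\<close> by
\<open>D - P\<close>. The result is that of \<open>fexp_lin_subst_first\<close> for the series \<open>e^(-Pt) f(t)\<close>, in accordance with
\<open>e^(P(y\<^sub>2-v)) = e^(P(y\<^sub>1-u)) e^(-P(y\<^sub>1-y\<^sub>2-u+v))\<close>.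
\<close>

lemma fexp_lin_subst_second:
  "Sum_any (\<lambda>k. fexp (\<lambda>i. P * (var Y2 - var v) i) k *
     lin_subst Y1 (var Y1 - var Y2 - var u + var v) f (m - k)) =
   (if m X1 = 0 \<and> m X2 = 0 \<and> m W = 0 \<and> 0 \<le> m Y2 \<and> 0 \<le> m u \<and> 0 \<le> m v then
      fls_nth ((fls_deriv ^^ nat (m u)) (exp_fls P * (fls_deriv ^^ (nat (m Y2) + nat (m v))) (exp_fls (- P) * f))) (m Y1)
        * ((-1) ^ nat (m Y2) / fact (nat (m Y2)) * ((-1) ^ nat (m u) / fact (nat (m u))) / fact (nat (m v)))
    else 0)"
proof -
  let ?L = "lin_subst Y1 (var Y1 - var Y2 - var u + var v) f"
  have ne: "Y2 \<noteq> v" "u \<noteq> v" "u \<noteq> X1" "u \<noteq> X2" "u \<noteq> Y2" "u \<noteq> W" "v \<noteq> X1" "v \<noteq> X2" "v \<noteq> Y2" "v \<noteq> W" "v \<noteq> Y1" "u \<noteq> Y1" using uv by auto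
  show ?thesis
  proof (cases "m X1 = 0 \<and> m X2 = 0 \<and> m W = 0 \<and> 0 \<le> m Y2 \<and> 0 \<le> m u \<and> 0 \<le> m v")
    case False
    have "?L (m(Y2 := m Y2 - int p, v := m v - int q)) = 0" for p q
      unfolding lin_subst_four[OF uv] using False ne by auto
    then show ?thesis
      unfolding fexp_pair_convolution[OF ne(1)] if_not_P[OF False] by simp
  next
    case True
    define n2 nu nv where "n2 = nat (m Y2)" and "nu = nat (m u)" and "nv = nat (m v)"
    let ?D = "\<lambda>n. fls_nth ((fls_deriv ^^ n) f) (m Y1)"
    define pre where "pre = (-1) ^ nu / (fact nu :: complex)"
    have L: "?L (m(Y2 := m Y2 - int p, v := m v - int q))
       = (if p \<le> n2 \<and> q \<le> nv then ?D (nu + ((n2 - p) + (nv - q))) * ((-1) ^ (n2 - p) / fact (n2 - p) * (pre / fact (nv - q))) else 0)" for p q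
    proof -
      have "nat (m v - int q) = nv - q" "nat (m Y2 - int p) = n2 - p"
        unfolding nv_def n2_def by (simp_all add: nat_diff_distrib')
      then show ?thesis
        unfolding lin_subst_four[OF uv] using True ne
        by (auto simp: pre_def n2_def nv_def nu_def)
    qed
    have "Sum_any (\<lambda>k. fexp (\<lambda>i. P * (var Y2 - var v) i) k * ?L (m - k))
       = (\<Sum>(p, q)\<in>{..n2} \<times> {..nv}. P ^ p / fact p * ((- P) ^ q / fact q) *
           (?D (nu + ((n2 - p) + (nv - q))) * ((-1) ^ (n2 - p) / fact (n2 - p) * (pre / fact (nv - q)))))"
      unfolding fexp_pair_convolution[OF ne(1)] L
    proof (subst Sum_any_eq_sum[of "{..n2} \<times> {..nv}"], goal_cases)
      case (2 x)
      then show ?case by (cases x) auto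
    next
      case 3
      show ?case by (intro sum.cong refl) (auto simp del: add_diff_assoc add_diff_assoc2)
    qed auto
    also have "\<dots> = (\<Sum>p\<le>n2. \<Sum>q\<le>nv. P ^ p / fact p * ((- P) ^ q / fact q) *
           (?D (nu + ((n2 - p) + (nv - q))) * ((-1) ^ (n2 - p) / fact (n2 - p) * (pre / fact (nv - q)))))"
      by (rule sum.cartesian_product[symmetric])
    also have "\<dots> = (\<Sum>p\<le>n2. \<Sum>q\<le>nv. (of_nat (n2 choose p) * (- P) ^ p) * (of_nat (nv choose q) * (- P) ^ q) *
        ?D ((n2 - p) + ((nv - q) + nu)) * ((-1) ^ n2 / fact n2 * pre / fact nv))"
    proof (intro sum.cong refl, goal_cases)
      case (1 p q)
      have "P ^ p / fact p * ((-1) ^ (n2 - p) / fact (n2 - p)) = (-1) ^ n2 / fact n2 * (of_nat (n2 choose p) * (- P) ^ p)"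
        using binomial_term[of p n2 "- P"] 1 by simp
      moreover have "(- P) ^ q / fact q / fact (nv - q) = of_nat (nv choose q) * (- P) ^ q / fact nv"
        using 1 by (simp add: binomial_fact)
      ultimately have "P ^ p / fact p * ((-1) ^ (n2 - p) / fact (n2 - p)) * ((- P) ^ q / fact q / fact (nv - q))
        = (-1) ^ n2 / fact n2 * (of_nat (n2 choose p) * (- P) ^ p) * (of_nat (nv choose q) * (- P) ^ q / fact nv)"
        by simp
      then have "P ^ p / fact p * ((-1) ^ (n2 - p) / fact (n2 - p)) * ((- P) ^ q / fact q / fact (nv - q)) * (d * pre)
        = (-1) ^ n2 / fact n2 * (of_nat (n2 choose p) * (- P) ^ p) * (of_nat (nv choose q) * (- P) ^ q / fact nv) * (d * pre)" for d
        by (simp only:)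
      from this[of "?D ((n2 - p) + ((nv - q) + nu))"]
      have "P ^ p / fact p * ((- P) ^ q / fact q) * (?D ((n2 - p) + ((nv - q) + nu)) *
          ((-1) ^ (n2 - p) / fact (n2 - p) * (pre / fact (nv - q))))
        = (of_nat (n2 choose p) * (- P) ^ p) * (of_nat (nv choose q) * (- P) ^ q) *
          ?D ((n2 - p) + ((nv - q) + nu)) * ((-1) ^ n2 / fact n2 * pre / fact nv)"
        by (simp only: times_divide_eq_left times_divide_eq_right divide_divide_eq_left mult_ac)
      moreover have "nu + ((n2 - p) + (nv - q)) = (n2 - p) + ((nv - q) + nu)" by simp
      ultimately show ?case by (simp only:)
    qed
    also have "\<dots> = fls_nth ((shifted_deriv (- P) ^^ n2) ((shifted_deriv (- P) ^^ nv) ((fls_deriv ^^ nu) f))) (m Y1)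
        * ((-1) ^ n2 / fact n2 * pre / fact nv)"
    proof -
      have "(fls_deriv ^^ (n2 - p)) ((shifted_deriv (- P) ^^ nv) ((fls_deriv ^^ nu) f))
        = (shifted_deriv (- P) ^^ nv) ((fls_deriv ^^ ((n2 - p) + nu)) f)" for p
        by (simp add: fls_deriv_shifted_deriv_commute funpow_add)
      moreover have "(fls_deriv ^^ (nv - q)) ((fls_deriv ^^ ((n2 - p) + nu)) f) = (fls_deriv ^^ ((n2 - p) + ((nv - q) + nu))) f" for p q
        by (simp add: funpow_add[symmetric, THEN fun_cong, unfolded o_def] add_ac)
      ultimately show ?thesis
        unfolding funpow_shifted_deriv_nth[of _ n2]
        by (simp only: funpow_shifted_deriv_nth sum_distrib_left sum_distrib_right mult.assoc)
    qed
    also have "(shifted_deriv (- P) ^^ n2) ((shifted_deriv (- P) ^^ nv) ((fls_deriv ^^ nu) f))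
       = (fls_deriv ^^ nu) ((shifted_deriv (- P) ^^ (n2 + nv)) f)"
      by (simp add: fls_deriv_shifted_deriv_commute funpow_add)
    also have "(shifted_deriv (- P) ^^ (n2 + nv)) f = exp_fls P * (fls_deriv ^^ (n2 + nv)) (exp_fls (- P) * f)"
      by (simp add: funpow_deriv_exp_mult exp_fls_mult_neg flip: mult.assoc)
    finally show ?thesis
      unfolding if_P[OF True] by (simp only: pre_def n2_def nu_def nv_def)
  qed
qed

end

lemma lin_subst_bounded_below:
  assumes "(u, v) = (Y3, Y4) \<or> (u, v) = (Y4, Y3)"
  shows "\<exists>N. \<forall>m. lin_subst Y1 (var Y1 - var Y2 - var u + var v) f m \<noteq> 0 \<longrightarrow>
    0 \<le> m Y2 \<and> 0 \<le> m u \<and> 0 \<le> m v \<and> N \<le> m Y1 + m Y2 + m u + m v"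
proof -
  obtain N where N: "\<forall>n<N. fls_nth f n = 0" using fls_vanishes_below by blast
  show ?thesis
  proof (rule exI[of _ N], intro allI impI)
    fix m assume "lin_subst Y1 (var Y1 - var Y2 - var u + var v) f m \<noteq> 0"
    then have *: "0 \<le> m Y2 \<and> 0 \<le> m u \<and> 0 \<le> m v"
        "fls_nth f (m Y1 + int (nat (m u) + (nat (m Y2) + nat (m v)))) \<noteq> 0"
      unfolding lin_subst_four[OF assms] funpow_fls_deriv_nth by (auto split: if_splits)
    then have "N \<le> m Y1 + int (nat (m u) + (nat (m Y2) + nat (m v)))" using N not_less by blast
    then show "0 \<le> m Y2 \<and> 0 \<le> m u \<and> 0 \<le> m v \<and> N \<le> m Y1 + m Y2 + m u + m v"
      using * by simp
  qed
qed

lemma fexp_lin_subst_finite: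
  assumes "(u, v) = (Y3, Y4) \<or> (u, v) = (Y4, Y3)"
  shows "finite {k. fexp c k * lin_subst Y1 (var Y1 - var Y2 - var u + var v) f (m - k) \<noteq> 0}"
proof -
  let ?L = "lin_subst Y1 (var Y1 - var Y2 - var u + var v) f"
  obtain N where N: "\<And>m. ?L m \<noteq> 0 \<Longrightarrow>
      0 \<le> m Y2 \<and> 0 \<le> m u \<and> 0 \<le> m v \<and> N \<le> m Y1 + m Y2 + m u + m v"
    using lin_subst_bounded_below[OF assms] by blast
  have zero: "m X1 = 0 \<and> m X2 = 0 \<and> m W = 0" if "?L m \<noteq> 0" for m
    using that unfolding lin_subst_four[OF assms] by (auto split: if_splits)
  define B where "B = \<bar>m X1\<bar> + \<bar>m X2\<bar> + \<bar>m Y1\<bar> + \<bar>m Y2\<bar> + \<bar>m Y3\<bar> + \<bar>m Y4\<bar> + \<bar>m W\<bar> + \<bar>N\<bar>"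
  have "{k. fexp c k * ?L (m - k) \<noteq> 0} \<subseteq> PiE UNIV (\<lambda>i. {0..B})"
  proof
    fix k assume "k \<in> {k. fexp c k * ?L (m - k) \<noteq> 0}"
    then have nz: "fexp c k \<noteq> 0" "?L (m - k) \<noteq> 0" by auto
    have pos: "0 \<le> k i" for i using nz(1) fexp_eq_0[of k i] by (auto simp: not_less[symmetric])
    have "\<forall>i. k i \<le> B"
      using N[OF nz(2)] zero[OF nz(2)] pos[of X1] pos[of X2] pos[of Y1] pos[of Y2] pos[of Y3] pos[of Y4] pos[of W] assms
      by (subst all_fvar) (auto simp: B_def)
    then show "k \<in> PiE UNIV (\<lambda>i. {0..B})" using pos by auto
  qed
  then show ?thesis by (rule finite_subset) (auto intro: finite_PiE)
qed

text \<open>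
The two singular terms share the functional \<open>\<Psi>\<close>, which extracts a coefficient of
\<open>e^(P(y\<^sub>1-u)) f(y\<^sub>1-y\<^sub>2-u+v)\<close> and is linear in \<open>f\<close>. Their sum is \<open>\<Psi>\<close> of the left-hand side of
\<open>pair_fls_commutator_identity\<close>, and \<open>\<Psi>\<close> sends \<open>e^(lt)\<close> to a coefficient of
\<open>e^(-k(y\<^sub>1-u) - l(y\<^sub>2-v))\<close>, where \<open>k + l = -P\<close>.
\<close>

lemma scalar_part:
  fixes P :: int
  assumes uv: "(u, v) = (Y3, Y4) \<or> (u, v) = (Y4, Y3)"
    and m: "m X1 = 0" "m X2 = 0"
  defines "S a b \<equiv> (\<lambda>m. Sum_any (\<lambda>k. fexp (\<lambda>i. of_int P * (var a - var b) i) k *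
     lin_subst Y1 (var Y1 - var Y2 - var u + var v) (- pair_fls) (m - k)))"
  shows "of_int (m Y1 + 1) * S Y1 u (m(Y1 := m Y1 + 1)) + of_int (m Y2 + 1) * S Y2 v (m(Y2 := m Y2 + 1))
    = (\<Sum>l\<in>{-\<bar>P\<bar>..\<bar>P\<bar>}. let k = - P - l in
         of_int (k * l) * ((if l > 0 then 1 else 0) - (if k < 0 then 1 else 0)) *
           fexp (\<lambda>i. - of_int k * (var Y1 - var u) i - of_int l * (var Y2 - var v) i) m)"
proof (cases "m W = 0 \<and> 0 \<le> m Y2 \<and> 0 \<le> m u \<and> 0 \<le> m v")
  case False
  have ne: "u \<noteq> v" "u \<noteq> X1" "u \<noteq> X2" "u \<noteq> Y2" "u \<noteq> W" "v \<noteq> X1" "v \<noteq> X2" "v \<noteq> Y2" "v \<noteq> W" "v \<noteq> Y1" "u \<noteq> Y1" using uv by auto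
  have "S Y1 u (m(Y1 := m Y1 + 1)) = 0"
    unfolding S_def fexp_lin_subst_first[OF uv] using False ne by auto
  moreover have "of_int (m Y2 + 1) * S Y2 v (m(Y2 := m Y2 + 1)) = 0"
  proof (cases "m Y2 = -1")
    case False
    then have "S Y2 v (m(Y2 := m Y2 + 1)) = 0"
      unfolding S_def fexp_lin_subst_second[OF uv] using \<open>\<not> (_ \<and> _)\<close> ne by auto
    then show ?thesis by simp
  qed simp
  moreover have "fexp (\<lambda>i. - of_int k * (var Y1 - var u) i - of_int l * (var Y2 - var v) i) m = 0" for k l
  proof -
    consider "m W \<noteq> 0" | "m Y2 < 0" | "m u < 0" | "m v < 0" using False by linarith
    then show ?thesis
    proof cases
      case 1
      then show ?thesis by (intro fexp_eq_0[of _ W]) (use uv in \<open>auto simp: var_def\<close>)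
    qed (auto intro: fexp_eq_0)
  qed
  ultimately show ?thesis by simp
next
  case True
  have ne: "u \<noteq> v" "u \<noteq> X1" "u \<noteq> X2" "u \<noteq> Y2" "u \<noteq> W" "v \<noteq> X1" "v \<noteq> X2" "v \<noteq> Y2" "v \<noteq> W" "v \<noteq> Y1" "u \<noteq> Y1" using uv by auto
  define n2 nu nv where "n2 = nat (m Y2)" and "nu = nat (m u)" and "nv = nat (m v)"
  define G where "G = - pair_fls"
  define p where "p = (of_int P :: complex)"
  define \<Psi> where "\<Psi> f = fls_nth ((fls_deriv ^^ nu) (exp_fls p * (fls_deriv ^^ (n2 + nv)) f)) (m Y1)
      * ((-1) ^ n2 / fact n2 * ((-1) ^ nu / fact nu) / fact nv)" for f
  have funpow_add': "(fls_deriv ^^ n) (f + g) = (fls_deriv ^^ n) f + (fls_deriv ^^ n) g" for n and f g :: "complex fls"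
    by (induction n) simp_all
  have funpow_c: "(fls_deriv ^^ n) (fls_const c * g) = fls_const c * (fls_deriv ^^ n) g" for n c and g :: "complex fls"
    by (induction n) (simp_all add: fls_deriv_mult_const_left)
  have funpow_sum: "(fls_deriv ^^ n) (sum f A) = (\<Sum>x\<in>A. (fls_deriv ^^ n) (f x))" for n A and f :: "int \<Rightarrow> complex fls"
    by (induction n) (simp_all add: fls_deriv_sum)
  have \<Psi>_add: "\<Psi> (f + g) = \<Psi> f + \<Psi> g" for f g
    unfolding \<Psi>_def funpow_add' distrib_left fls_plus_nth by (rule distrib_right)
  have \<Psi>_sum: "\<Psi> (sum f A) = (\<Sum>x\<in>A. \<Psi> (f x))" for f and A :: "int set"
    unfolding \<Psi>_def funpow_sum sum_distrib_left by (simp only: fls_nth_sum sum_distrib_right)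
  have D_E: "(fls_deriv ^^ n) (exp_fls c) = fls_const (c ^ n) * exp_fls c" for n c
  proof (induction n)
    case (Suc n)
    have "fls_deriv (fls_const (c ^ n) * exp_fls c) = fls_const (c ^ n) * fls_const c * exp_fls c"
      by (simp add: fls_deriv_mult_const_left fls_deriv_exp_fls del: fls_deriv_mult fls_const_mult_const flip: mult.assoc)
    also have "fls_const (c ^ n) * fls_const c = fls_const (c ^ Suc n)" by (simp add: mult.commute)
    finally show ?case using Suc by simp
  qed simp
  have \<Psi>_E: "\<Psi> (fls_const a * exp_fls (of_int l)) = a * fexp (\<lambda>i. - of_int k * (var Y1 - var u) i - of_int l * (var Y2 - var v) i) m"
    if "k = - P - l" for a k l
  proof -
    have nth: "fls_nth (exp_fls c) n = (if n < 0 then 0 else c ^ nat n / fact (nat n))" for c n by simp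
    have "exp_fls p * (fls_deriv ^^ (n2 + nv)) (fls_const a * exp_fls (of_int l)) = fls_const (a * of_int l ^ (n2 + nv)) * exp_fls (p + of_int l)"
      unfolding funpow_c D_E exp_fls_add by (simp add: mult_ac flip: fls_const_mult_const)
    moreover have "p + of_int l = (- of_int k :: complex)" by (simp add: p_def that)
    ultimately have "\<Psi> (fls_const a * exp_fls (of_int l)) = a * of_int l ^ (n2 + nv) * (- of_int k) ^ nu * fls_nth (exp_fls (- of_int k)) (m Y1)
        * ((-1) ^ n2 / fact n2 * ((-1) ^ nu / fact nu) / fact nv)"
      unfolding \<Psi>_def by (simp only: funpow_c D_E) (simp add: mult_ac del: fps_to_fls_nth)
    also have "\<dots> = a * fexp (\<lambda>i. - of_int k * (var Y1 - var u) i - of_int l * (var Y2 - var v) i) m"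
    proof (cases "m Y1 < 0")
      case neg: True
      then show ?thesis using fexp_eq_0[of m Y1] unfolding nth by simp
    next
      case False
      then have "\<forall>i. 0 \<le> m i" using True m uv by (subst all_fvar) auto
      moreover have "((- of_int l) ^ n2 :: complex) = (-1) ^ n2 * of_int l ^ n2"
        "(of_int k ^ nu :: complex) = (-1) ^ nu * (- of_int k) ^ nu"
        by (simp_all flip: power_mult_distrib)
      ultimately show ?thesis
        unfolding fexp_def prod_fvar nth using False m True uv
        by (auto simp: var_def power_add n2_def nu_def nv_def mult_ac)
    qed
    finally show ?thesis .
  qed
  have S1: "of_int (m Y1 + 1) * S Y1 u (m(Y1 := m Y1 + 1)) = \<Psi> (fls_deriv G + fls_const p * G)"
  proof -
    define g where "g = (fls_deriv ^^ (n2 + nv)) G"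
    have "(fls_deriv ^^ (n2 + nv)) (fls_deriv G + fls_const p * G) = fls_deriv g + fls_const p * g"
      unfolding funpow_add' funpow_c g_def by (simp add: funpow_swap1)
    moreover have "fls_deriv (exp_fls p * g) = exp_fls p * (fls_deriv g + fls_const p * g)"
      by (simp add: fls_deriv_exp_fls algebra_simps)
    ultimately have "fls_deriv ((fls_deriv ^^ nu) (exp_fls p * g))
       = (fls_deriv ^^ nu) (exp_fls p * (fls_deriv ^^ (n2 + nv)) (fls_deriv G + fls_const p * G))"
      by (simp add: funpow_swap1)
    from arg_cong[OF this, of "\<lambda>f. fls_nth f (m Y1)"]
    have "fls_nth ((fls_deriv ^^ nu) (exp_fls p * (fls_deriv ^^ (n2 + nv)) (fls_deriv G + fls_const p * G))) (m Y1)
       = of_int (m Y1 + 1) * fls_nth ((fls_deriv ^^ nu) (exp_fls p * g)) (m Y1 + 1)"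
      unfolding fls_deriv_nth by (rule sym)
    then have "\<Psi> (fls_deriv G + fls_const p * G) = of_int (m Y1 + 1) *
       (fls_nth ((fls_deriv ^^ nu) (exp_fls p * g)) (m Y1 + 1) * ((-1) ^ n2 / fact n2 * ((-1) ^ nu / fact nu) / fact nv))"
      unfolding \<Psi>_def by (simp only: mult.assoc)
    moreover have "S Y1 u (m(Y1 := m Y1 + 1)) = fls_nth ((fls_deriv ^^ nu) (exp_fls p * g)) (m Y1 + 1)
       * ((-1) ^ n2 / fact n2 * ((-1) ^ nu / fact nu) / fact nv)"
      unfolding S_def fexp_lin_subst_first[OF uv] using True ne m
      by (simp add: p_def g_def G_def n2_def nu_def nv_def)
    ultimately show ?thesis by simp
  qed
  have S2: "of_int (m Y2 + 1) * S Y2 v (m(Y2 := m Y2 + 1)) = \<Psi> (- fls_deriv G * exp_fls (- p) + fls_const p * G * exp_fls (- p))"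
  proof -
    have "fls_const (- p) = - fls_const p" by simp
    then have d: "- fls_deriv G * exp_fls (- p) + fls_const p * G * exp_fls (- p) = - fls_deriv (exp_fls (- p) * G)"
      by (simp add: fls_deriv_exp_fls algebra_simps del: fls_const_uminus)
    have "(fls_deriv ^^ n) (- f) = - (fls_deriv ^^ n) f" for n and f :: "complex fls"
      by (induction n) simp_all
    then have neg: "\<Psi> (- f) = - \<Psi> f" for f
      unfolding \<Psi>_def by simp
    have n2': "nat (m Y2 + 1) = Suc n2" and of_n2: "of_int (m Y2 + 1) = (of_nat (Suc n2) :: complex)"
      using True by (simp_all add: n2_def nat_add_distrib)
    have fact_n2: "of_nat (Suc n2) * ((-1) ^ Suc n2 / fact (Suc n2)) = - ((-1) ^ n2 / fact n2 :: complex)"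
      by (simp del: of_nat_Suc)
    have S: "S Y2 v (m(Y2 := m Y2 + 1)) = fls_nth ((fls_deriv ^^ nu) (exp_fls p * (fls_deriv ^^ (n2 + nv)) (fls_deriv (exp_fls (- p) * G)))) (m Y1)
       * ((-1) ^ Suc n2 / fact (Suc n2) * ((-1) ^ nu / fact nu) / fact nv)"
      unfolding S_def fexp_lin_subst_second[OF uv] using True ne m n2'
      by (simp add: p_def G_def nu_def nv_def funpow_swap1 del: fls_deriv_mult fact_Suc power_Suc)
    have pull: "a * (x * (b * y / z)) = x * ((a * b) * y / z)" for a b x y z :: complex by simp
    show ?thesis
      unfolding d neg S of_n2 pull fact_n2 unfolding \<Psi>_def
      by (simp only: mult_minus_left mult_minus_right divide_minus_left minus_mult_minus)
  qed
  have "of_int (m Y1 + 1) * S Y1 u (m(Y1 := m Y1 + 1)) + of_int (m Y2 + 1) * S Y2 v (m(Y2 := m Y2 + 1))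
     = \<Psi> (fls_deriv G + fls_const p * G - fls_deriv G * exp_fls (- p) + fls_const p * G * exp_fls (- p))"
    unfolding S1 S2 \<Psi>_add[symmetric] by (simp add: algebra_simps)
  also have "\<dots> = (\<Sum>l\<in>{-\<bar>P\<bar>..\<bar>P\<bar>}. let k = - P - l in
         of_int (k * l) * ((if l > 0 then 1 else 0) - (if k < 0 then 1 else 0)) *
           fexp (\<lambda>i. - of_int k * (var Y1 - var u) i - of_int l * (var Y2 - var v) i) m)"
    unfolding G_def p_def pair_fls_commutator_identity \<Psi>_sum Let_def
    by (intro sum.cong refl) (simp only: \<Psi>_E)
  finally show ?thesis .
qed

section \<open>Modes and normal ordering in the Heisenberg vertex operator algebra\<close>

interpretation scal: vector_space scal by (rule vector_space_scal)

lemma Sum_any_scal: "Sum_any (\<lambda>x. scal c (f x)) = scal c (Sum_any f)"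
proof (cases "c = 0")
  case False
  then have "{x. scal c (f x) \<noteq> 0} = {x. f x \<noteq> 0}" by simp
  then show ?thesis unfolding Sum_any.expand_set by (simp add: scal.scale_sum_right)
qed simp

lemma lookup_scal [simp]: "Poly_Mapping.lookup (scal c s) \<mu> = c * Poly_Mapping.lookup s \<mu>"
  unfolding scal_def by (simp add: Poly_Mapping.map.rep_eq when_def flip: mult_map_scale_conv_mult)

lemma lookup_wt_part: "Poly_Mapping.lookup (wt_part n s) \<mu> = (if monom_wt \<mu> = n then Poly_Mapping.lookup s \<mu> else 0)"
proof -
  have "Poly_Mapping.lookup (wt_part n s) \<mu> = (\<Sum>\<nu> | \<nu> \<in> Poly_Mapping.keys s \<and> monom_wt \<nu> = n. Poly_Mapping.lookup s \<nu> when \<nu> = \<mu>)"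
    unfolding wt_part_def by (simp add: lookup_sum lookup_single)
  also have "\<dots> = (if \<mu> \<in> Poly_Mapping.keys s \<and> monom_wt \<mu> = n then Poly_Mapping.lookup s \<mu> else 0)"
    by (simp add: when_def sum.delta' in_keys_iff)
  finally show ?thesis by (auto simp: in_keys_iff)
qed

lemma wt_part_add: "wt_part n (s + t) = wt_part n s + wt_part n t"
  by (rule poly_mapping_eqI) (simp add: lookup_wt_part lookup_add)

lemma wt_part_scal: "wt_part n (scal c s) = scal c (wt_part n s)"
  by (rule poly_mapping_eqI) (simp add: lookup_wt_part)

lemma wt_part_0: "wt_part n 0 = 0"
  by (rule poly_mapping_eqI) (simp add: lookup_wt_part)

lemma wt_part_in_grading: "wt_part n s \<in> heis_grading n"
  unfolding heis_grading_def by (auto simp: in_keys_iff lookup_wt_part split: if_splits)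

lemma wt_part_homogeneous:
  assumes "s \<in> heis_grading k"
  shows "wt_part n s = (if n = k then s else 0)"
  using assms unfolding heis_grading_def
  by (intro poly_mapping_eqI) (auto simp: lookup_wt_part in_keys_iff)

lemma finite_wt_part: "finite {k. wt_part k s \<noteq> 0}"
proof (rule finite_subset)
  show "{k. wt_part k s \<noteq> 0} \<subseteq> monom_wt ` Poly_Mapping.keys s"
  proof
    fix k assume "k \<in> {k. wt_part k s \<noteq> 0}"
    then obtain \<mu> where "Poly_Mapping.lookup (wt_part k s) \<mu> \<noteq> 0" by (auto simp: poly_mapping_eq_iff fun_eq_iff)
    then show "k \<in> monom_wt ` Poly_Mapping.keys s" by (auto simp: lookup_wt_part in_keys_iff split: if_splits)
  qed
qed simp

lemma sum_wt_part:
  assumes "finite A" "{k. wt_part k s \<noteq> 0} \<subseteq> A"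
  shows "(\<Sum>k\<in>A. wt_part k s) = s"
proof (rule poly_mapping_eqI)
  fix \<mu>
  have "monom_wt \<mu> \<in> A" if "Poly_Mapping.lookup s \<mu> \<noteq> 0"
  proof -
    have "Poly_Mapping.lookup (wt_part (monom_wt \<mu>) s) \<mu> \<noteq> 0" using that by (simp add: lookup_wt_part)
    then have "wt_part (monom_wt \<mu>) s \<noteq> 0" by auto
    then show ?thesis using assms(2) by blast
  qed
  then show "Poly_Mapping.lookup (\<Sum>k\<in>A. wt_part k s) \<mu> = Poly_Mapping.lookup s \<mu>"
    using assms(1) by (auto simp: lookup_sum lookup_wt_part)
qed

lemma pdiff_indet: "pdiff i (indet 0) = (if i = 0 then 1 else 0)"
  unfolding pdiff_def indet_def by (simp add: lookup_single when_def)

lemma v0_in_grading: "v\<^sub>0 \<in> heis_grading 1"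
  unfolding heis_grading_def v\<^sub>0_def indet_def monom_wt_def by simp

lemma one_in_grading: "1 \<in> heis_grading 0"
  unfolding heis_grading_def monom_wt_def by (simp add: keys_one)

lemma h_v0: "0 \<le> i \<Longrightarrow> h i v\<^sub>0 = (if i = 1 then 1 else 0)"
  unfolding h_def v\<^sub>0_def using pdiff_indet[of "nat i - 1"] by auto

locale heisenberg = vertex_operator_algebra scal heis_grading Y 1 "scal (1/2) (v\<^sub>0 ^ 2)" 1 for Y +
  assumes Y_v0: "Y v\<^sub>0 n = h n"
begin

abbreviation "\<omega> \<equiv> scal (1/2) (v\<^sub>0 ^ 2)"

lemmas Y_hom_left = Y_linear_left[unfolded Vector_Spaces.linear_def, THEN conjunct2, THEN conjunct2]
lemmas Y_hom_right = Y_linear_right[unfolded Vector_Spaces.linear_def, THEN conjunct2, THEN conjunct2]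

lemma Y_add_left: "Y (u + u') n v = Y u n v + Y u' n v"
  using module_hom.add[OF Y_hom_left] .

lemma Y_scal_left: "Y (scal c u) n v = scal c (Y u n v)"
  using module_hom.scale[OF Y_hom_left] .

lemma Y_0_left [simp]: "Y 0 n v = 0"
  using module_hom.zero[OF Y_hom_left] .

lemma Y_add: "Y u n (v + v') = Y u n v + Y u n v'"
  using module_hom.add[OF Y_hom_right] .

lemma Y_diff: "Y u n (v - v') = Y u n v - Y u n v'"
  using module_hom.diff[OF Y_hom_right] .

lemma Y_scal: "Y u n (scal c v) = scal c (Y u n v)"
  using module_hom.scale[OF Y_hom_right] .

lemma Y_0 [simp]: "Y u n 0 = 0"
  using module_hom.zero[OF Y_hom_right] .

lemma Y_sum: "Y u n (\<Sum>i\<in>A. f i) = (\<Sum>i\<in>A. Y u n (f i))"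
  using module_hom.sum[OF Y_hom_right] .

text \<open>
The case \<open>l = 0\<close> of the Jacobi identity, where a single term of the sum on the left survives.
\<close>

lemma Y_commutator:
  "Y u m (Y v n w) - Y v n (Y u m w)
    = Sum_any (\<lambda>i::nat. scal (of_int m gchoose i) (Y (Y u (int i) v) (m + n - int i) w))"
proof -
  have "Y u m (Y v n w) - Y v n (Y u m w) = Sum_any (\<lambda>i::nat. scal ((-1) ^ i * (of_int 0 gchoose i))
          (Y u (0 + m - int i) (Y v (n + int i) w)
            - scal ((-1) powi 0) (Y v (0 + n - int i) (Y u (m + int i) w))))"
    by (subst Sum_any_eq_single[of 0]) (auto simp: gbinomial_0_left)
  also have "\<dots> = Sum_any (\<lambda>i::nat. scal (of_int m gchoose i) (Y (Y u (int i) v) (m + n - int i) w))"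
    unfolding jacobi by simp
  finally show ?thesis .
qed

text \<open>
The case \<open>m = 0\<close>, \<open>l = -r\<close> of the Jacobi identity, where the sum on the right collapses.
\<close>

lemma Y_iterate:
  "Y (Y u (- int r) v) n w = Sum_any (\<lambda>i::nat. scal ((-1) ^ i * (- of_nat r gchoose i))
      (Y u (- int r - int i) (Y v (n + int i) w) - scal ((-1) ^ r) (Y v (- int r + n - int i) (Y u (int i) w))))"
proof -
  have "Sum_any (\<lambda>i::nat. scal (of_int 0 gchoose i) (Y (Y u (- int r + int i) v) (0 + n - int i) w))
      = Y (Y u (- int r) v) n w"
    by (subst Sum_any_eq_single[of 0]) (auto simp: gbinomial_0_left)
  moreover have "inverse ((-1) ^ r) = ((-1) ^ r :: complex)" by (cases "even r") simp_all
  ultimately show ?thesis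
    using jacobi[of "- int r" u 0 v n w] by (simp add: power_int_minus)
qed

lemma h_add: "h n (s + t) = h n s + h n t" unfolding Y_v0[symmetric] by (rule Y_add)
lemma h_diff: "h n (s - t) = h n s - h n t" unfolding Y_v0[symmetric] by (rule Y_diff)
lemma h_scal: "h n (scal c s) = scal c (h n s)" unfolding Y_v0[symmetric] by (rule Y_scal)
lemma h_0 [simp]: "h n 0 = 0" unfolding Y_v0[symmetric] by simp
lemma h_sum: "h n (\<Sum>i\<in>A. f i) = (\<Sum>i\<in>A. h n (f i))" unfolding Y_v0[symmetric] by (rule Y_sum)

lemma h_vanishes: "\<exists>N. \<forall>n\<ge>N. h n s = 0"
  using truncation[of v\<^sub>0] unfolding Y_v0 .

text \<open>
The Heisenberg relations come from the commutator formula: among the products \<open>h(i)v\<^sub>0\<close> with \<open>i \<ge> 0\<close>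
only \<open>h(1)v\<^sub>0 = 1\<close> is nonzero.
\<close>

lemma h_commutator: "h m (h n s) = h n (h m s) + (if m + n = 0 then scal (of_int m) s else 0)"
proof -
  have "h m (h n s) - h n (h m s) = Sum_any (\<lambda>i::nat. scal (of_int m gchoose i) (Y (h (int i) v\<^sub>0) (m + n - int i) s))"
    using Y_commutator[of v\<^sub>0 m v\<^sub>0 n s] unfolding Y_v0 .
  also have "\<dots> = scal (of_int m gchoose 1) (Y (h (int 1) v\<^sub>0) (m + n - int 1) s)"
    by (rule Sum_any_eq_single) (auto simp: h_v0)
  also have "\<dots> = (if m + n = 0 then scal (of_int m) s else 0)"
    by (auto simp: h_v0 vacuum)
  finally show ?thesis by (simp add: algebra_simps)
qed

lemma normal_ord_eq:
  "normal_ord k l s = h k (h l s) - (if k + l = 0 \<and> k > 0 then scal (of_int k) s else 0)"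
  unfolding normal_ord_def using h_commutator[of k l s] by auto

lemma normal_ord_commute: "normal_ord k l s = normal_ord l k s"
proof -
  consider "k + l \<noteq> 0" | "k > 0" "l = - k" | "k = 0" "l = 0" | "k < 0" "l = - k" by linarith
  then show ?thesis
    using h_commutator[of k l s] by cases (simp_all add: normal_ord_eq)
qed

lemma normal_ord_0 [simp]: "normal_ord k l 0 = 0"
  unfolding normal_ord_eq by simp

lemma normal_ord_sum: "normal_ord k l (\<Sum>i\<in>A. f i) = (\<Sum>i\<in>A. normal_ord k l (f i))"
  unfolding normal_ord_def by (simp add: h_sum)

lemma normal_ord_scal: "normal_ord k l (scal c s) = scal c (normal_ord k l s)"
  unfolding normal_ord_def by (simp add: h_scal)

text \<open>
For large \<open>k\<close> the annihilator \<open>h(k)\<close> acts first and kills \<open>s\<close>; for large \<open>-k\<close> the other factor does.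
\<close>

lemma normal_ord_finite: "finite {k. normal_ord k (p - k) s \<noteq> 0}"
proof -
  obtain N where N: "\<And>n. n \<ge> N \<Longrightarrow> h n s = 0" using h_vanishes by blast
  have z: "normal_ord k l s = 0" if "k \<ge> max N 1" for k l
    using that N[of k] h_commutator[of k l s] by (cases "l < 0") (auto simp: normal_ord_def)
  have "{k. normal_ord k (p - k) s \<noteq> 0} \<subseteq> {p - max N 1..max N 1}"
  proof
    fix k assume k: "k \<in> {k. normal_ord k (p - k) s \<noteq> 0}"
    have "\<not> k \<ge> max N 1" using z k by blast
    moreover have "\<not> p - k \<ge> max N 1" using z[of "p - k" k] k normal_ord_commute by auto
    ultimately show "k \<in> {p - max N 1..max N 1}" by auto
  qed
  then show ?thesis by (rule finite_subset) simp
qed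

text \<open>
A normally ordered product differs from a product by a scalar, so the bracket is that of the plain
products, which the Leibniz rule resolves into four single contractions. Normal ordering of these
four terms produces the scalars of the two double contractions. The two one-sided
conditions on the signs combine into \<open>[l > 0] - [k < 0]\<close>, because the factor \<open>k l\<close> removes the cases
\<open>k = 0\<close> and \<open>l = 0\<close>.
\<close>

lemma normal_ord_commutator:
  "normal_ord k l (normal_ord p q s) - normal_ord p q (normal_ord k l s) =
     (if k + p = 0 then scal (of_int k) (normal_ord l q s) else 0)
   + (if l + p = 0 then scal (of_int l) (normal_ord k q s) else 0)
   + (if k + q = 0 then scal (of_int k) (normal_ord l p s) else 0)
   + (if l + q = 0 then scal (of_int l) (normal_ord k p s) else 0)
   + (if k + p = 0 \<and> l + q = 0 then scal (of_int (k * l) * ((if l > 0 then 1 else 0) - (if k < 0 then 1 else 0))) s else 0)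
   + (if l + p = 0 \<and> k + q = 0 then scal (of_int (k * l) * ((if l > 0 then 1 else 0) - (if k < 0 then 1 else 0))) s else 0)"
  (is "_ = ?rhs")
proof -
  define d where "d m n x = (if m + n = 0 then scal (of_int m) x else 0)" for m n x
  have d_h: "h j (d m n x) = d m n (h j x)" for j m n x unfolding d_def by (simp add: h_scal)
  have hc: "h m (h n x) = h n (h m x) + d m n x" for m n x
    using h_commutator[of m n x] unfolding d_def .
  have A: "h k (h l (h p (h q s))) = h p (h q (h k (h l s)))
      + d k p (h l (h q s)) + d l p (h k (h q s)) + d k q (h p (h l s)) + d l q (h p (h k s))"
  proof -
    have "h k (h l (h p (h q s))) = h k (h p (h l (h q s))) + d l p (h k (h q s))"
      by (subst hc[of l p]) (simp add: h_add d_h)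
    also have "h k (h p (h l (h q s))) = h p (h k (h l (h q s))) + d k p (h l (h q s))"
      by (rule hc)
    also have "h p (h k (h l (h q s))) = h p (h k (h q (h l s))) + d l q (h p (h k s))"
      by (subst hc[of l q]) (simp add: h_add d_h)
    also have "h k (h q (h l s)) = h q (h k (h l s)) + d k q (h l s)"
      by (rule hc)
    finally show ?thesis by (simp add: h_add d_h algebra_simps)
  qed
  define c where "c m n x = (if m + n = 0 \<and> m > 0 then scal (of_int m) x else 0)" for m n x
  have no: "normal_ord m n x = h m (h n x) - c m n x" for m n x
    unfolding normal_ord_eq c_def ..
  have c_h: "h j (c m n x) = c m n (h j x)" for j m n x unfolding c_def by (simp add: h_scal)
  have c_d: "c m n (x - y) = c m n x - c m n y" for m n x y unfolding c_def by (simp add: scal.scale_right_diff_distrib)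
  have c_c: "c m n (c m' n' x) = c m' n' (c m n x)" for m n m' n' x unfolding c_def by (simp add: mult.commute)
  have "normal_ord k l (normal_ord p q s) - normal_ord p q (normal_ord k l s)
      = h k (h l (h p (h q s))) - h p (h q (h k (h l s)))"
    unfolding no by (simp add: h_diff c_h c_d c_c[of k l p q])
  also have "\<dots> = d k p (h l (h q s)) + d l p (h k (h q s)) + d k q (h p (h l s)) + d l q (h p (h k s))"
    unfolding A by simp
  also have "\<dots> = d k p (normal_ord l q s) + d l p (normal_ord k q s) + d k q (normal_ord l p s) + d l q (normal_ord k p s)
     + ((d k p (c l q s) + d l q (c p k s)) + (d l p (c k q s) + d k q (c p l s)))"
  proof -
    have dd: "d m n (x + y) = d m n x + d m n y" for m n x y unfolding d_def by (simp add: scal.scale_right_distrib)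
    have "h m (h n s) = normal_ord m n s + c m n s" for m n unfolding no by simp
    then show ?thesis
      by (simp add: dd normal_ord_commute[of p] algebra_simps)
  qed
  also have "d k p (c l q s) + d l q (c p k s) = (if k + p = 0 \<and> l + q = 0 then scal (of_int (k * l) * ((if l > 0 then 1 else 0) - (if k < 0 then 1 else 0))) s else 0)"
  proof (cases "k + p = 0 \<and> l + q = 0")
    case True
    then have "p = - k" "q = - l" by auto
    then show ?thesis
      by (auto simp: d_def c_def scal.scale_left_distrib[symmetric] mult_ac)
  qed (auto simp: d_def c_def)
  also have "d l p (c k q s) + d k q (c p l s) = (if l + p = 0 \<and> k + q = 0 then scal (of_int (k * l) * ((if l > 0 then 1 else 0) - (if k < 0 then 1 else 0))) s else 0)"
  proof (cases "l + p = 0 \<and> k + q = 0")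
    case True
    then have "p = - l" "q = - k" by auto
    then show ?thesis
      by (cases "k = 0"; cases "l = 0") (auto simp: d_def c_def scal.scale_left_distrib[symmetric] mult_ac)
  qed (auto simp: d_def c_def)
  finally show ?thesis unfolding d_def by (simp add: add_ac)
qed

section \<open>Commutators of vertex operators\<close>

text \<open>
The operator \<open>L(0)\<close> multiplies each monomial by its weight, so its eigenvectors are homogeneous.
\<close>

lemma Y_omega_1_homogeneous:
  assumes "Y \<omega> 1 s = scal (of_int j) s"
  shows "s \<in> heis_grading j"
proof -
  have "Poly_Mapping.lookup (Y \<omega> 1 s) \<mu> = of_int (monom_wt \<mu>) * Poly_Mapping.lookup s \<mu>" for \<mu>
  proof -
    have mono: "Y \<omega> 1 (Poly_Mapping.single \<nu> a) = scal (of_int (monom_wt \<nu>)) (Poly_Mapping.single \<nu> a)" for \<nu> a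
      by (rule L0_weight) (auto simp: heis_grading_def)
    have "s = (\<Sum>\<nu>\<in>Poly_Mapping.keys s. Poly_Mapping.single \<nu> (Poly_Mapping.lookup s \<nu>))"
      by (rule poly_mapping_eqI) (simp add: lookup_sum lookup_single when_def sum.delta in_keys_iff)
    then have "Y \<omega> 1 s = (\<Sum>\<nu>\<in>Poly_Mapping.keys s. scal (of_int (monom_wt \<nu>)) (Poly_Mapping.single \<nu> (Poly_Mapping.lookup s \<nu>)))"
      by (metis (no_types, lifting) Y_sum mono sum.cong)
    then show ?thesis
      by (auto simp: lookup_sum lookup_single when_def sum.delta' in_keys_iff if_distrib cong: if_cong)
  qed
  then have "of_int (monom_wt \<mu>) * Poly_Mapping.lookup s \<mu> = of_int j * Poly_Mapping.lookup s \<mu>" for \<mu>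
    using assms by (metis lookup_scal)
  then show ?thesis
    unfolding heis_grading_def
    by (auto simp only: in_keys_iff mult_cancel_right of_int_eq_iff mem_Collect_eq)
qed

text \<open>
By the commutator formula and the derivative property, \<open>[L(0), u\<^sub>n] = (wt u - n - 1) u\<^sub>n\<close>.
\<close>

lemma Y_homogeneous:
  assumes u: "u \<in> heis_grading k" and v: "v \<in> heis_grading l"
  shows "Y u n v \<in> heis_grading (k + l - n - 1)"
proof (rule Y_omega_1_homogeneous)
  have "Y \<omega> 1 (Y u n v) - Y u n (Y \<omega> 1 v)
      = Sum_any (\<lambda>i::nat. scal (of_int 1 gchoose i) (Y (Y \<omega> (int i) u) (1 + n - int i) v))"
    by (rule Y_commutator)
  also have "\<dots> = (\<Sum>i\<in>{0, 1}. scal (of_int 1 gchoose i) (Y (Y \<omega> (int i) u) (1 + n - int i) v))"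
  proof (rule Sum_any_eq_sum)
    fix i :: nat assume "i \<notin> {0, 1}"
    then have "(1 choose i :: nat) = 0" by (intro binomial_eq_0) auto
    then have "(1 gchoose i :: complex) = 0"
      using binomial_gbinomial[of 1 i, where 'a = complex] by (metis of_nat_0 of_nat_1)
    then show "scal (of_int 1 gchoose i) (Y (Y \<omega> (int i) u) (1 + n - int i) v) = 0" by simp
  qed simp
  also have "\<dots> = Y (Y \<omega> 0 u) (1 + n) v + Y (Y \<omega> 1 u) n v" by simp
  also have "\<dots> = scal (- of_int (1 + n)) (Y u n v) + scal (of_int k) (Y u n v)"
  proof (rule arg_cong2[of _ _ _ _ "(+)"])
    show "Y (Y \<omega> 0 u) (1 + n) v = scal (- of_int (1 + n)) (Y u n v)"
      using L_minus1_derivative[of u "1 + n" v] by simp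
    show "Y (Y \<omega> 1 u) n v = scal (of_int k) (Y u n v)"
      unfolding L0_weight[OF u] by (rule Y_scal_left)
  qed
  finally have "Y \<omega> 1 (Y u n v) = scal (- of_int (1 + n)) (Y u n v) + scal (of_int k) (Y u n v) + scal (of_int l) (Y u n v)"
    by (simp add: L0_weight[OF v] Y_scal algebra_simps)
  moreover have "of_int (k + l - n - 1) = - of_int (1 + n) + of_int k + (of_int l :: complex)" by simp
  ultimately show "Y \<omega> 1 (Y u n v) = scal (of_int (k + l - n - 1)) (Y u n v)"
    by (simp only: scal.scale_left_distrib)
qed

lemma X_coeff_eq_sum:
  assumes "finite A" "{k. wt_part k v \<noteq> 0} \<subseteq> A"
  shows "X_coeff Y v p s = (\<Sum>k\<in>A. Y (wt_part k v) (k - p - 1) s)"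
  unfolding X_coeff_def
proof (rule Sum_any_eq_sum)
  fix k assume "k \<notin> A"
  then have "wt_part k v = 0" using assms by auto
  then show "Y (wt_part k v) (k - p - 1) s = 0" by simp
qed (rule assms)

lemma X_coeff_homogeneous:
  assumes "v \<in> heis_grading l"
  shows "X_coeff Y v p s = Y v (l - p - 1) s"
  unfolding X_coeff_def wt_part_homogeneous[OF assms]
  by (subst Sum_any_eq_single[of l]) auto

lemma X_coeff_add_left: "X_coeff Y (u + v) p s = X_coeff Y u p s + X_coeff Y v p s"
proof -
  let ?A = "{k. wt_part k u \<noteq> 0} \<union> {k. wt_part k v \<noteq> 0}"
  have "{k. wt_part k (u + v) \<noteq> 0} \<subseteq> ?A" by (auto simp: wt_part_add)
  moreover have "finite ?A" by (simp add: finite_wt_part)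
  ultimately show ?thesis
    by (simp add: X_coeff_eq_sum[of ?A] wt_part_add Y_add_left sum.distrib)
qed

lemma X_coeff_scal_left: "X_coeff Y (scal c v) p s = scal c (X_coeff Y v p s)"
proof -
  let ?A = "{k. wt_part k v \<noteq> 0}"
  have "{k. wt_part k (scal c v) \<noteq> 0} \<subseteq> ?A" by (auto simp: wt_part_scal)
  moreover have "finite ?A" by (simp add: finite_wt_part)
  ultimately show ?thesis
    by (simp add: X_coeff_eq_sum[of ?A] wt_part_scal Y_scal_left scal.scale_sum_right)
qed

lemma X_coeff_0_left [simp]: "X_coeff Y 0 p s = 0"
  by (simp add: X_coeff_def wt_part_0)

lemma X_coeff_sum_left: "X_coeff Y (\<Sum>i\<in>A. f i) p s = (\<Sum>i\<in>A. X_coeff Y (f i) p s)"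
  by (induction A rule: infinite_finite_induct) (simp_all add: X_coeff_add_left)

lemma X_coeff_add: "X_coeff Y v p (s + t) = X_coeff Y v p s + X_coeff Y v p t"
  by (simp add: X_coeff_eq_sum[OF finite_wt_part order.refl] Y_add sum.distrib)

lemma X_coeff_scal: "X_coeff Y v p (scal c s) = scal c (X_coeff Y v p s)"
  by (simp add: X_coeff_eq_sum[OF finite_wt_part order.refl] Y_scal scal.scale_sum_right)

lemma X_coeff_0 [simp]: "X_coeff Y v p 0 = 0"
  by (simp add: X_coeff_eq_sum[OF finite_wt_part order.refl])

lemma X_coeff_sum: "X_coeff Y v p (\<Sum>i\<in>A. f i) = (\<Sum>i\<in>A. X_coeff Y v p (f i))"
  by (induction A rule: infinite_finite_induct) (simp_all add: X_coeff_add)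

lemma Y_br_eq_sum:
  assumes A: "finite A" "{k. wt_part k u \<noteq> 0} \<subseteq> A"
    and N: "\<And>k n. k \<in> A \<Longrightarrow> n \<ge> N \<Longrightarrow> Y (wt_part k u) n v = 0"
    and M: "M \<le> - p - 1"
  shows "Y_br Y u v p
    = (\<Sum>k\<in>A. \<Sum>n\<in>{M..<N}. scal (fls_nth (exp_fls (of_int k) * expm1_fls powi (- n - 1)) p) (Y (wt_part k u) n v))"
proof -
  have "Y_br Y u v p = (\<Sum>(k, n)\<in>A \<times> {M..<N}.
      scal (fls_nth (exp_fls (of_int k) * expm1_fls powi (- n - 1)) p) (Y (wt_part k u) n v))"
    unfolding Y_br_def
  proof (rule Sum_any_eq_sum)
    fix x :: "int \<times> int" assume x: "x \<notin> A \<times> {M..<N}"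
    obtain k n where kn: "x = (k, n)" by (cases x)
    have "k \<notin> A \<or> (k \<in> A \<and> n \<ge> N) \<or> n < M" using x kn by auto
    then consider "k \<notin> A" | "k \<in> A" "n \<ge> N" | "n < M" by blast
    then show "(case x of (k, n) \<Rightarrow> scal (fls_nth (exp_fls (of_int k) * expm1_fls powi (- n - 1)) p) (Y (wt_part k u) n v)) = 0"
    proof cases
      case 1
      then have "wt_part k u = 0" using A by auto
      then show ?thesis using kn by simp
    next
      case 2
      then show ?thesis using kn N by simp
    next
      case 3
      then show ?thesis using kn M exp_expm1_nth_eq_0[of n p "of_int k"] by simp
    qed
  qed (simp add: A)
  also have "\<dots> = (\<Sum>k\<in>A. \<Sum>n\<in>{M..<N}. scal (fls_nth (exp_fls (of_int k) * expm1_fls powi (- n - 1)) p) (Y (wt_part k u) n v))"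
    by (rule sum.cartesian_product[symmetric])
  finally show ?thesis .
qed

lemma Y_br_homogeneous:
  assumes u: "u \<in> heis_grading k" and N: "\<And>n. n \<ge> N \<Longrightarrow> Y u n v = 0" and M: "M \<le> - p - 1"
  shows "Y_br Y u v p = (\<Sum>n\<in>{M..<N}. scal (fls_nth (exp_fls (of_int k) * expm1_fls powi (- n - 1)) p) (Y u n v))"
  by (subst Y_br_eq_sum[of "{k}" u N v M]) (use M in \<open>auto simp: wt_part_homogeneous[OF u] N\<close>)

lemma Y_br_0_left [simp]: "Y_br Y 0 v p = 0"
  unfolding Y_br_def by (simp add: wt_part_0 case_prod_unfold)

lemma Y_br_0_right [simp]: "Y_br Y u 0 p = 0"
  unfolding Y_br_def by (simp add: case_prod_unfold)

lemma finite_truncation: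
  assumes "finite A" "finite B"
  shows "\<exists>N. \<forall>u\<in>A. \<forall>v\<in>B. \<forall>n\<ge>N. Y u n v = 0"
proof -
  have "\<exists>N. \<forall>u v. \<forall>n \<ge> N u v. Y u n v = 0" using truncation by metis
  then obtain N where N: "\<And>u v n. n \<ge> N u v \<Longrightarrow> Y u n v = 0" by blast
  have "finite ((\<lambda>(u, v). N u v) ` (A \<times> B))" using assms by simp
  then obtain M where "\<forall>x\<in>(\<lambda>(u, v). N u v) ` (A \<times> B). x \<le> M"
    by (meson Max_ge)
  then show ?thesis using N by (intro exI[of _ M]) force
qed

text \<open>
In the commutator formula for \<open>X\<^sub>p(u) = u\<^sub>k\<^sub>-\<^sub>p\<^sub>-\<^sub>1\<close> the \<open>i\<close>-th coefficient is \<open>(k-p-1 choose i)\<close>, the residue of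
\<open>e^(-pw) e^(kw) (e^w-1)^(-i-1)\<close>. The sum over \<open>c\<close> multiplies by the expansion of \<open>e^(-pw)\<close>, and the
remaining factors are those of \<open>Y[u,w]v\<close>.
\<close>

lemma X_commutator_homogeneous:
  assumes u: "u \<in> heis_grading k" and v: "v \<in> heis_grading l"
    and N: "\<And>n. n \<ge> int N \<Longrightarrow> Y u n v = 0"
  shows "X_coeff Y u p (X_coeff Y v q s) - X_coeff Y v q (X_coeff Y u p s)
    = (\<Sum>c<N. scal ((- of_int p) ^ c / fact c) (X_coeff Y (Y_br Y u v (- 1 - int c)) (p + q) s))"
proof -
  let ?a = "\<lambda>n c. fls_nth (exp_fls (of_int k) * expm1_fls powi (- n - 1)) (- 1 - int c)"
  let ?y = "\<lambda>n. Y (Y u n v) ((k + l - n - 1) - (p + q) - 1) s"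
  have "X_coeff Y u p (X_coeff Y v q s) - X_coeff Y v q (X_coeff Y u p s)
      = Sum_any (\<lambda>i::nat. scal (of_int (k - p - 1) gchoose i) (?y (int i)))"
    unfolding X_coeff_homogeneous[OF u] X_coeff_homogeneous[OF v] Y_commutator
    by (simp add: algebra_simps)
  also have "\<dots> = (\<Sum>i<N. scal (of_int (k - p - 1) gchoose i) (?y (int i)))"
    by (rule Sum_any_eq_sum) (auto simp: N)
  also have "\<dots> = (\<Sum>i<N. scal (\<Sum>c<N. (- of_int p) ^ c / fact c * ?a (int i) c) (?y (int i)))"
  proof (rule sum.cong[OF refl])
    fix i assume "i \<in> {..<N}"
    have "of_int (k - p - 1) gchoose i = fls_nth (exp_fls (of_int (k - p)) * expm1_fls powi (- int i - 1)) (-1)"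
      using residue_exp[of "k - p" "int i"] by simp
    also have "\<dots> = fls_nth (exp_fls (- of_int p) * (exp_fls (of_int k) * expm1_fls powi (- int i - 1))) (-1)"
      by (simp add: exp_fls_add[symmetric] flip: mult.assoc)
    also have "\<dots> = (\<Sum>c<N. (- of_int p) ^ c / fact c * ?a (int i) c)"
      unfolding exp_fls_mult_nth[of "- of_int p"]
      by (rule Sum_any_eq_sum) (use \<open>i \<in> {..<N}\<close> in \<open>auto simp del: fps_to_fls_minus intro!: exp_expm1_nth_eq_0\<close>)
    finally show "scal (of_int (k - p - 1) gchoose i) (?y (int i))
        = scal (\<Sum>c<N. (- of_int p) ^ c / fact c * ?a (int i) c) (?y (int i))"
      by simp
  qed
  also have "\<dots> = (\<Sum>c<N. \<Sum>i<N. scal ((- of_int p) ^ c / fact c) (scal (?a (int i) c) (?y (int i))))"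
    by (subst sum.swap) (simp add: scal.scale_sum_left)
  also have "\<dots> = (\<Sum>c<N. scal ((- of_int p) ^ c / fact c) (X_coeff Y (Y_br Y u v (- 1 - int c)) (p + q) s))"
  proof (rule sum.cong[OF refl])
    fix c
    have "Y_br Y u v (- 1 - int c) = (\<Sum>n\<in>{0..<int N}. scal (?a n c) (Y u n v))"
      by (rule Y_br_homogeneous[OF u N]) auto
    also have "\<dots> = (\<Sum>i<N. scal (?a (int i) c) (Y u (int i) v))"
      by (rule sum.reindex_bij_witness[of _ int nat]) auto
    finally show "(\<Sum>i<N. scal ((- of_int p) ^ c / fact c) (scal (?a (int i) c) (?y (int i))))
        = scal ((- of_int p) ^ c / fact c) (X_coeff Y (Y_br Y u v (- 1 - int c)) (p + q) s)"
      by (simp add: X_coeff_sum_left X_coeff_scal_left X_coeff_homogeneous[OF Y_homogeneous[OF u v]] scal.scale_sum_right)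
  qed
  finally show ?thesis .
qed

text \<open>
Both sides are bilinear, which reduces the claim to homogeneous vectors. The bound is left open
upwards so that finitely many instances can share one value of \<open>M\<close>.
\<close>

lemma X_commutator:
  "\<exists>N. \<forall>M\<ge>N. (\<forall>c\<ge>M. Y_br Y u v (- 1 - int c) = 0) \<and>
    X_coeff Y u p (X_coeff Y v q s) - X_coeff Y v q (X_coeff Y u p s)
    = (\<Sum>c<M. scal ((- of_int p) ^ c / fact c) (X_coeff Y (Y_br Y u v (- 1 - int c)) (p + q) s))"
proof -
  let ?A = "{k. wt_part k u \<noteq> 0}" and ?B = "{k. wt_part k v \<noteq> 0}"
  note fin = finite_wt_part[of u] finite_wt_part[of v]
  obtain N where N: "\<forall>u'\<in>(\<lambda>k. wt_part k u) ` ?A. \<forall>v'\<in>insert v ((\<lambda>l. wt_part l v) ` ?B). \<forall>n\<ge>N. Y u' n v' = 0"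
    using finite_truncation[of "(\<lambda>k. wt_part k u) ` ?A" "insert v ((\<lambda>l. wt_part l v) ` ?B)"] fin by auto
  have main: "(\<forall>c\<ge>M. Y_br Y u v (- 1 - int c) = 0) \<and>
    X_coeff Y u p (X_coeff Y v q s) - X_coeff Y v q (X_coeff Y u p s)
    = (\<Sum>c<M. scal ((- of_int p) ^ c / fact c) (X_coeff Y (Y_br Y u v (- 1 - int c)) (p + q) s))"
    if "M \<ge> nat N" for M
  proof
    have N': "Y (wt_part k u) n (wt_part l v) = 0" if "k \<in> ?A" "l \<in> ?B" "n \<ge> int M" for k l n
      using N that \<open>M \<ge> nat N\<close> by auto
    have br: "Y_br Y u v (- 1 - int c) = (\<Sum>k\<in>?A. \<Sum>n\<in>{int c..<max (int c) (int M)}.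
        scal (fls_nth (exp_fls (of_int k) * expm1_fls powi (- n - 1)) (- 1 - int c)) (Y (wt_part k u) n v))" for c
      by (rule Y_br_eq_sum) (use N that fin in auto)
    show "\<forall>c\<ge>M. Y_br Y u v (- 1 - int c) = 0"
      unfolding br by auto
    have br2: "Y_br Y u v (- 1 - int c) = (\<Sum>k\<in>?A. \<Sum>l\<in>?B. Y_br Y (wt_part k u) (wt_part l v) (- 1 - int c))" for c
    proof -
      have "(\<Sum>l\<in>?B. Y_br Y (wt_part k u) (wt_part l v) (- 1 - int c)) = (\<Sum>n\<in>{int c..<max (int c) (int M)}.
          scal (fls_nth (exp_fls (of_int k) * expm1_fls powi (- n - 1)) (- 1 - int c)) (Y (wt_part k u) n v))" if "k \<in> ?A" for k
      proof -
        have "(\<Sum>l\<in>?B. Y_br Y (wt_part k u) (wt_part l v) (- 1 - int c)) = (\<Sum>l\<in>?B. \<Sum>n\<in>{int c..<max (int c) (int M)}.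
          scal (fls_nth (exp_fls (of_int k) * expm1_fls powi (- n - 1)) (- 1 - int c)) (Y (wt_part k u) n (wt_part l v)))"
          by (intro sum.cong refl Y_br_homogeneous[OF wt_part_in_grading]) (use N'[OF that] in auto)
        also have "\<dots> = (\<Sum>n\<in>{int c..<max (int c) (int M)}.
          scal (fls_nth (exp_fls (of_int k) * expm1_fls powi (- n - 1)) (- 1 - int c)) (Y (wt_part k u) n (\<Sum>l\<in>?B. wt_part l v)))"
          by (subst sum.swap) (simp add: Y_sum scal.scale_sum_right)
        finally show ?thesis by (simp add: sum_wt_part[OF fin(2) order.refl])
      qed
      then show ?thesis unfolding br by (intro sum.cong[OF refl]) (rule sym)
    qed
    have dec: "X_coeff Y w p' t = (\<Sum>k | wt_part k w \<noteq> 0. X_coeff Y (wt_part k w) p' t)" for w p' t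
      using X_coeff_sum_left[of "\<lambda>k. wt_part k w" "{k. wt_part k w \<noteq> 0}" p' t]
      by (simp add: sum_wt_part[OF finite_wt_part order.refl])
    have "X_coeff Y u p (X_coeff Y v q s) - X_coeff Y v q (X_coeff Y u p s)
      = (\<Sum>k\<in>?A. \<Sum>l\<in>?B. X_coeff Y (wt_part k u) p (X_coeff Y (wt_part l v) q s))
        - (\<Sum>l\<in>?B. \<Sum>k\<in>?A. X_coeff Y (wt_part l v) q (X_coeff Y (wt_part k u) p s))"
      unfolding dec[of u] dec[of v] X_coeff_sum
      by (intro arg_cong2[of _ _ _ _ "(-)"] sum.swap)
    also have "\<dots> = (\<Sum>k\<in>?A. \<Sum>l\<in>?B. X_coeff Y (wt_part k u) p (X_coeff Y (wt_part l v) q s)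
        - X_coeff Y (wt_part l v) q (X_coeff Y (wt_part k u) p s))"
      by (subst (2) sum.swap) (simp add: sum_subtractf)
    also have "\<dots> = (\<Sum>k\<in>?A. \<Sum>l\<in>?B. \<Sum>c<M. scal ((- of_int p) ^ c / fact c)
         (X_coeff Y (Y_br Y (wt_part k u) (wt_part l v) (- 1 - int c)) (p + q) s))"
      by (intro sum.cong refl X_commutator_homogeneous[OF wt_part_in_grading wt_part_in_grading]) (use N' in auto)
    also have "\<dots> = (\<Sum>c<M. \<Sum>k\<in>?A. \<Sum>l\<in>?B. scal ((- of_int p) ^ c / fact c)
         (X_coeff Y (Y_br Y (wt_part k u) (wt_part l v) (- 1 - int c)) (p + q) s))"
      by (subst sum.swap[of _ "{..<M}"], subst sum.swap[of _ "{..<M}"]) simp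
    also have "\<dots> = (\<Sum>c<M. scal ((- of_int p) ^ c / fact c) (X_coeff Y (Y_br Y u v (- 1 - int c)) (p + q) s))"
      unfolding br2 by (simp add: X_coeff_sum_left scal.scale_sum_right)
    finally show "X_coeff Y u p (X_coeff Y v q s) - X_coeff Y v q (X_coeff Y u p s)
      = (\<Sum>c<M. scal ((- of_int p) ^ c / fact c) (X_coeff Y (Y_br Y u v (- 1 - int c)) (p + q) s))" .
  qed
  then show ?thesis by blast
qed

end

section \<open>Products of operator series\<close>

definition restrict_expo :: "fvar set \<Rightarrow> expo \<Rightarrow> expo" where
  "restrict_expo S m = (\<lambda>i. if i \<in> S then m i else 0)"

text \<open>
Since the two series have disjoint sets of variables, an exponent vector splits in only one way.
\<close>

lemma op_mult_separated:
  assumes disj: "S \<inter> T = {}"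
    and A: "\<And>k i s. i \<notin> S \<Longrightarrow> k i \<noteq> 0 \<Longrightarrow> A k s = 0"
    and B: "\<And>k i s. i \<notin> T \<Longrightarrow> k i \<noteq> 0 \<Longrightarrow> B k s = 0"
    and A0: "\<And>k. A k 0 = 0"
  shows "op_mult A B m s = (if \<forall>i. i \<notin> S \<union> T \<longrightarrow> m i = 0
    then A (restrict_expo S m) (B (restrict_expo T m) s) else 0)"
proof -
  have "op_mult A B m s = A (restrict_expo S m) (B (m - restrict_expo S m) s)"
    unfolding op_mult_def
  proof (rule Sum_any_eq_single)
    fix k assume "k \<noteq> restrict_expo S m"
    then obtain i where i: "k i \<noteq> restrict_expo S m i" by auto
    show "A k (B (m - k) s) = 0"
    proof (cases "i \<in> S")
      case True
      then have "B (m - k) s = 0" using disj i by (intro B[of i]) (auto simp: restrict_expo_def)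
      then show ?thesis by (simp add: A0)
    next
      case False
      then show ?thesis using i by (intro A[of i]) (auto simp: restrict_expo_def)
    qed
  qed
  also have "\<dots> = (if \<forall>i. i \<notin> S \<union> T \<longrightarrow> m i = 0
    then A (restrict_expo S m) (B (restrict_expo T m) s) else 0)"
  proof (cases "\<forall>i. i \<notin> S \<union> T \<longrightarrow> m i = 0")
    case True
    then have "m - restrict_expo S m = restrict_expo T m"
      using disj by (auto simp: restrict_expo_def fun_eq_iff)
    then show ?thesis using True by simp
  next
    case False
    then obtain i where i: "i \<notin> S \<union> T" "m i \<noteq> 0" by auto
    then have "B (m - restrict_expo S m) s = 0" by (intro B[of i]) (auto simp: restrict_expo_def)
    then show ?thesis using False by (auto simp: A0)
  qed
  finally show ?thesis .
qed

lemma op_comm_separated: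
  assumes disj: "S \<inter> T = {}"
    and A: "\<And>k i s. i \<notin> S \<Longrightarrow> k i \<noteq> 0 \<Longrightarrow> A k s = 0"
    and B: "\<And>k i s. i \<notin> T \<Longrightarrow> k i \<noteq> 0 \<Longrightarrow> B k s = 0"
    and 0: "\<And>k. A k 0 = 0" "\<And>k. B k 0 = 0"
  shows "op_comm A B m s = (if \<forall>i. i \<notin> S \<union> T \<longrightarrow> m i = 0
    then A (restrict_expo S m) (B (restrict_expo T m) s) - B (restrict_expo T m) (A (restrict_expo S m) s) else 0)"
proof -
  have "op_mult A B m s = (if \<forall>i. i \<notin> S \<union> T \<longrightarrow> m i = 0
      then A (restrict_expo S m) (B (restrict_expo T m) s) else 0)"
    by (rule op_mult_separated[OF disj]) (fact A B 0)+
  moreover have "op_mult B A m s = (if \<forall>i. i \<notin> T \<union> S \<longrightarrow> m i = 0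
      then B (restrict_expo T m) (A (restrict_expo S m) s) else 0)"
    by (rule op_mult_separated[OF disj[unfolded Int_commute[of S]]]) (fact A B 0)+
  moreover have "(if b then x else 0) - (if b then y else 0) = (if b then x - y else 0)" for b and x y :: heis
    by simp
  ultimately show ?thesis
    unfolding op_comm_def Un_commute[of T S] minus_apply by (simp only:)
qed

lemma op_mult_scale:
  assumes "\<And>k c s. A k (scal c s) = scal c (A k s)"
  shows "op_mult (op_scale a A) (op_scale b B) = op_scale (a * b) (op_mult A B)"
  unfolding op_mult_def op_scale_def by (simp add: assms flip: Sum_any_scal)

text \<open>
The delta function has a coefficient for every power of \<open>x\<^sub>1\<close>, but \<open>A\<close> does not involve \<open>x\<^sub>1\<close>. Hence
only \<open>x\<^sub>1^P x\<^sub>2^(-P)\<close> with the prescribed exponent \<open>P\<close> contributes, and the product is one with an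
ordinary exponential.
\<close>

lemma ser_mult_fdelta:
  assumes c: "c X1 = 0" "c X2 = 0" and A: "\<And>k s. k X1 \<noteq> 0 \<Longrightarrow> A k s = 0"
  shows "ser_mult (fdelta c X1 X2) A m s
    = Sum_any (\<lambda>k. scal (fexp (\<lambda>i. of_int (m X1) * c i) k) (A ((m - k)(X1 := 0, X2 := m X1 + m X2)) s))"
proof -
  \<comment> \<open>Shift by the exponent vector of \<open>x\<^sub>1^P x\<^sub>2^(-P)\<close>.\<close>
  define d :: expo where "d = (\<lambda>i. 0)(X1 := m X1, X2 := - m X1)"
  have "bij (\<lambda>k. k + d)" by (rule bijI') (auto simp: fun_eq_iff intro: exI[of _ "_ - d"])
  then have "ser_mult (fdelta c X1 X2) A m s = Sum_any (\<lambda>k. scal (fdelta c X1 X2 (k + d)) (A (m - (k + d)) s))"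
    unfolding ser_mult_def by (intro Sum_any.reindex_cong) (auto simp: o_def)
  also have "\<dots> = Sum_any (\<lambda>k. scal (fexp (\<lambda>i. of_int (m X1) * c i) k) (A ((m - k)(X1 := 0, X2 := m X1 + m X2)) s))"
  proof (rule Sum_any.cong)
    fix k
    show "scal (fdelta c X1 X2 (k + d)) (A (m - (k + d)) s)
       = scal (fexp (\<lambda>i. of_int (m X1) * c i) k) (A ((m - k)(X1 := 0, X2 := m X1 + m X2)) s)"
    proof (cases "k X1 = 0 \<and> k X2 = 0")
      case True
      then have "(k + d)(X1 := 0, X2 := 0) = k" "m - (k + d) = (m - k)(X1 := 0, X2 := m X1 + m X2)"
        by (auto simp: fun_eq_iff d_def)
      then show ?thesis using True by (simp add: fdelta_def d_def)
    next
      case False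
      have "fexp (\<lambda>i. of_int (m X1) * c i) k = 0"
        using False c fexp_eq_0[of k X1] fexp_eq_0[of k X2] by auto
      moreover have "scal (fdelta c X1 X2 (k + d)) (A (m - (k + d)) s) = 0"
      proof (cases "k X1 = 0")
        case True
        then show ?thesis using False by (simp add: fdelta_def d_def)
      next
        case False
        then have "A (m - (k + d)) s = 0" by (intro A) (simp add: d_def)
        then show ?thesis by simp
      qed
      ultimately show ?thesis by simp
    qed
  qed
  finally show ?thesis .
qed

lemma op_comm_scale:
  assumes "\<And>k c s. A k (scal c s) = scal c (A k s)" "\<And>k c s. B k (scal c s) = scal c (B k s)"
  shows "op_comm (op_scale a A) (op_scale b B) = op_scale (a * b) (op_comm A B)"
  unfolding op_comm_def op_mult_scale[of A a b B, OF assms(1)] op_mult_scale[of B b a A, OF assms(2)]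
  by (simp add: op_scale_def fun_eq_iff scal.scale_right_diff_distrib mult.commute)

lemma Y_br_series_separated:
  assumes f: "\<And>k i. i \<notin> S \<Longrightarrow> k i \<noteq> 0 \<Longrightarrow> f k = 0"
    and g: "\<And>k i. i \<notin> T \<Longrightarrow> k i \<noteq> 0 \<Longrightarrow> g k = 0"
    and disj: "S \<inter> T = {}" "w \<notin> S" "w \<notin> T"
    and zero: "\<And>v p. Y_br Y 0 v p = 0" "\<And>u p. Y_br Y u 0 p = 0"
  shows "Y_br_series Y f w g m = (if \<forall>i. i \<noteq> w \<longrightarrow> i \<notin> S \<union> T \<longrightarrow> m i = 0
    then Y_br Y (f (restrict_expo S m)) (g (restrict_expo T m)) (m w) else 0)"
proof -
  let ?F = "\<lambda>(k, l). if \<forall>i. i \<noteq> w \<longrightarrow> (m - k - l) i = 0 then Y_br Y (f k) (g l) ((m - k - l) w) else 0"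
  have "Y_br_series Y f w g m = ?F (restrict_expo S m, restrict_expo T m)"
    unfolding Y_br_series_def
  proof (rule Sum_any_eq_single)
    fix x :: "expo \<times> expo" assume x: "x \<noteq> (restrict_expo S m, restrict_expo T m)"
    obtain k l where kl: "x = (k, l)" by (cases x)
    show "?F x = 0"
    proof (rule ccontr)
      assume nz: "?F x \<noteq> 0"
      then have mk: "\<And>i. i \<noteq> w \<Longrightarrow> m i = k i + l i" and "f k \<noteq> 0" "g l \<noteq> 0"
        using kl zero by (auto split: if_splits)
      then have k: "\<And>i. i \<notin> S \<Longrightarrow> k i = 0" and l: "\<And>i. i \<notin> T \<Longrightarrow> l i = 0"
        using f g by blast+
      have "k = restrict_expo S m" "l = restrict_expo T m"
        using mk k l disj by (force simp: restrict_expo_def fun_eq_iff)+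
      then show False using x kl by simp
    qed
  qed
  also have "\<dots> = (if \<forall>i. i \<noteq> w \<longrightarrow> i \<notin> S \<union> T \<longrightarrow> m i = 0
    then Y_br Y (f (restrict_expo S m)) (g (restrict_expo T m)) (m w) else 0)"
  proof -
    have "(\<forall>i. i \<noteq> w \<longrightarrow> (m - restrict_expo S m - restrict_expo T m) i = 0)
        \<longleftrightarrow> (\<forall>i. i \<noteq> w \<longrightarrow> i \<notin> S \<union> T \<longrightarrow> m i = 0)"
      using disj by (auto simp: restrict_expo_def)
    moreover have "(m - restrict_expo S m - restrict_expo T m) w = m w"
      using disj by (simp add: restrict_expo_def)
    ultimately show ?thesis by (simp only: prod.case)
  qed
  finally show ?thesis .
qed

context heisenberg
begin

lemma X_series_eq:
  assumes bx: "b \<noteq> x" and f: "\<And>k. k x \<noteq> 0 \<Longrightarrow> f k = 0" and fb: "\<And>k. k b < 0 \<Longrightarrow> f k = 0"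
  shows "X_series Y f (var b) x m s
    = (\<Sum>t\<le>nat (m b). scal (of_int (m x) ^ t / fact t) (X_coeff Y (f (m(x := 0, b := m b - int t))) (m x) s))"
proof -
  let ?T = "\<lambda>k. let p = (m - k) x in
      scal (fexp (\<lambda>i. of_int p * var b i) ((m - k)(x := 0))) (X_coeff Y (f k) p s)"
  let ?g = "\<lambda>t::nat. m(x := 0, b := m b - int t)"
  have T: "?T (?g t) = scal (of_int (m x) ^ t / fact t) (X_coeff Y (f (?g t)) (m x) s)" for t
  proof -
    have "(m - ?g t) x = m x" using bx by simp
    moreover have "fexp (\<lambda>i. of_int (m x) * var b i) ((m - ?g t)(x := 0)) = of_int (m x) ^ t / fact t"
      using bx by (subst fexp_one[of b]) (auto simp: var_def)
    ultimately show ?thesis by (simp only: Let_def)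
  qed
  have "X_series Y f (var b) x m s = Sum_any (\<lambda>t. ?T (?g t))"
    unfolding X_series_def
  proof (rule Sum_any_reindex)
    show "inj ?g"
      by (rule injI) (metis diff_left_imp_eq fun_upd_same of_nat_eq_iff)
    fix k assume k: "k \<notin> range ?g"
    show "?T k = 0"
    proof (rule ccontr)
      assume nz: "?T k \<noteq> 0"
      then have kx: "k x = 0" using f[of k] by (cases "k x = 0") (auto simp: Let_def)
      have "fexp (\<lambda>i. of_int ((m - k) x) * var b i) ((m - k)(x := 0)) \<noteq> 0" using nz by (auto simp: Let_def)
      then have "0 \<le> ((m - k)(x := 0)) b" "\<And>i. i \<noteq> b \<Longrightarrow> ((m - k)(x := 0)) i = 0"
        by (subst (asm) fexp_one[of b], simp add: var_def, metis)+
      then have kb: "k b \<le> m b" and ki: "\<And>i. i \<noteq> b \<Longrightarrow> i \<noteq> x \<Longrightarrow> k i = m i"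
        using bx by (simp, metis eq_iff_diff_eq_0 fun_upd_other minus_apply)
      have "k = ?g (nat (m b - k b))"
      proof
        fix i show "k i = ?g (nat (m b - k b)) i"
          using kb ki[of i] kx bx by (cases "i = b"; cases "i = x") simp_all
      qed
      then show False using k by blast
    qed
  qed
  also have "\<dots> = Sum_any (\<lambda>t. scal (of_int (m x) ^ t / fact t) (X_coeff Y (f (?g t)) (m x) s))"
    by (rule Sum_any.cong) (rule T)
  also have "\<dots> = (\<Sum>t\<le>nat (m b). scal (of_int (m x) ^ t / fact t) (X_coeff Y (f (?g t)) (m x) s))"
  proof (rule Sum_any_eq_sum)
    fix t assume "t \<notin> {..nat (m b)}"
    then have "f (?g t) = 0" by (intro fb) auto
    then show "scal (of_int (m x) ^ t / fact t) (X_coeff Y (f (?g t)) (m x) s) = 0" by simp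
  qed simp
  finally show ?thesis .
qed

lemma X_series_linear:
  assumes bx: "b \<noteq> x" and f: "\<And>k. k x \<noteq> 0 \<Longrightarrow> f k = 0" and fb: "\<And>k. k b < 0 \<Longrightarrow> f k = 0"
  shows "X_series Y f (var b) x m (s + t) = X_series Y f (var b) x m s + X_series Y f (var b) x m t"
    and "X_series Y f (var b) x m (scal c s) = scal c (X_series Y f (var b) x m s)"
    and "X_series Y f (var b) x m 0 = 0"
proof -
  note eq = X_series_eq[where f = f, OF bx]
  show "X_series Y f (var b) x m (s + t) = X_series Y f (var b) x m s + X_series Y f (var b) x m t"
    by (simp add: eq f fb X_coeff_add scal.scale_right_distrib sum.distrib)
  show "X_series Y f (var b) x m (scal c s) = scal c (X_series Y f (var b) x m s)"
    by (simp add: eq f fb X_coeff_scal scal.scale_sum_right mult.commute)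
  show "X_series Y f (var b) x m 0 = 0"
    by (simp add: eq f fb)
qed

lemma X_series_support:
  assumes bx: "b \<noteq> x" and f: "\<And>k i. i \<notin> S \<Longrightarrow> k i \<noteq> 0 \<Longrightarrow> f k = 0" and fb: "\<And>k. k b < 0 \<Longrightarrow> f k = 0"
    and S: "x \<notin> S" "b \<in> S" and i: "i \<notin> insert x S" "m i \<noteq> 0"
  shows "X_series Y f (var b) x m s = 0"
proof -
  have "f (m(x := 0, b := m b - int t)) = 0" for t
    using i S by (intro f[of i]) auto
  moreover have "f k = 0" if "k x \<noteq> 0" for k using S(1) that by (rule f)
  ultimately show ?thesis
    by (subst X_series_eq[OF bx]) (use fb in auto)
qed

section \<open>Modified normal ordering as a vertex operator\<close>

lemma lin_subst_heis_difference:
  assumes "j \<noteq> b"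
  shows "lin_subst_heis j (var j - var b) f m =
    (if 0 \<le> m b \<and> (\<forall>i. i \<noteq> j \<longrightarrow> i \<noteq> b \<longrightarrow> m i = 0)
     then scal ((of_int (m j + m b) gchoose nat (m b)) * (-1) ^ nat (m b)) (f (m j + m b)) else 0)"
  unfolding lin_subst_heis_def lin_powi_difference[OF assms]
  by (subst Sum_any_eq_single[of "m j + m b"]) auto

lemma hh_normal_eq:
  "hh_normal a b x m s = Sum_any (\<lambda>k. scal (fexp (\<lambda>i. - of_int k * a i - of_int (- m x - k) * b i) (m(x := 0)))
      (normal_ord k (- m x - k) s))"
  unfolding hh_normal_def
  by (subst Sum_any_reindex[of "\<lambda>k. (k, - m x - k)"]) (auto simp: inj_on_def)

text \<open>
The coefficient of \<open>y^n\<close> in \<open>X(Y[v\<^sub>0,y]v\<^sub>0,x)\<close>. The Jacobi identity expresses the vertex operator of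
\<open>h(-r)v\<^sub>0\<close> by the products \<open>F (r + i)\<close>, which begin with a creation operator, and \<open>G i\<close>, which end with
an annihilation operator. Collecting the coefficient of \<open>F j\<close> gives \<open>e^y (1 + (e^y-1))^(j-1) = e^(jy)\<close>,
and that of \<open>G i\<close> gives \<open>e^y (1 + (e^y-1))^(-i-1) = e^(-iy)\<close>.
\<close>

lemma X_coeff_Y_br_v0:
  "X_coeff Y (Y_br Y v\<^sub>0 v\<^sub>0 n) p s = (if p = 0 then scal (fls_nth pair_fls n) s else 0)
     + Sum_any (\<lambda>k. scal (fls_nth (exp_fls (- of_int k)) n) (normal_ord k (- p - k) s))"
proof -
  define d where "d r = fls_nth (exp_fls 1 * expm1_fls ^ (r - 1)) n" for r :: nat
  obtain N where N: "\<And>n. n \<ge> N \<Longrightarrow> h n s = 0" using h_vanishes by blast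
  \<comment> \<open>A common cutoff: beyond it the coefficients \<open>d r\<close> and the vectors \<open>F j\<close>, \<open>G j\<close> vanish.\<close>
  define M where "M = nat \<bar>n\<bar> + nat \<bar>N\<bar> + nat \<bar>p\<bar> + 2"
  have dc: "fls_nth (exp_fls 1 * (fls_const c * expm1_fls ^ t)) n = c * d (Suc t)" for c t
    unfolding mult.left_commute[of "exp_fls 1"] fls_mult_const_nth by (simp add: d_def)
  have M: "int M \<ge> n + 2" "int M \<ge> N + \<bar>p\<bar>" "int M \<ge> 2"
    unfolding M_def by simp_all
  have d0: "d r = 0" if "r > M" for r
  proof -
    have "d r = fls_nth (exp_fls (of_int 1) * expm1_fls powi (- (- int r) - 1)) n"
      using that by (simp add: d_def power_int_def nat_diff_distrib flip: fps_to_fls_power)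
    also have "\<dots> = 0" by (rule exp_expm1_nth_eq_0) (use that M in auto)
    finally show ?thesis .
  qed
  define F where "F j = h (- int j) (h (int j - p) s)" for j :: nat
  define G where "G j = h (- p - int j) (h (int j) s)" for j :: nat
  have F0: "F j = 0" if "j \<ge> M" for j
    unfolding F_def using that by (subst N) (use M in auto)
  have G0: "G j = 0" if "j \<ge> M" for j
    unfolding G_def using that by (subst N) (use M in auto)
  have "Y_br Y v\<^sub>0 v\<^sub>0 n = (\<Sum>j\<in>{- int M..<2}. scal (fls_nth (exp_fls (of_int 1) * expm1_fls powi (- j - 1)) n) (h j v\<^sub>0))"
    unfolding Y_v0[symmetric]
    by (rule Y_br_homogeneous[OF v0_in_grading]) (use M in \<open>auto simp: Y_v0 h_v0\<close>)
  also have "\<dots> = (\<Sum>j\<in>insert 1 ((\<lambda>r. - int r) ` {1..M}). scal (fls_nth (exp_fls (of_int 1) * expm1_fls powi (- j - 1)) n) (h j v\<^sub>0))"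
  proof (rule sum.mono_neutral_right)
    show "\<forall>j\<in>{- int M..<2} - insert 1 ((\<lambda>r. - int r) ` {1..M}). scal (fls_nth (exp_fls (of_int 1) * expm1_fls powi (- j - 1)) n) (h j v\<^sub>0) = 0"
    proof
      fix j assume j: "j \<in> {- int M..<2} - insert 1 ((\<lambda>r. - int r) ` {1..M})"
      have "j = 0"
      proof (rule ccontr)
        assume "j \<noteq> 0"
        then have "j = - int (nat (- j))" "nat (- j) \<in> {1..M}" using j by auto
        then show False using j by blast
      qed
      then show "scal (fls_nth (exp_fls (of_int 1) * expm1_fls powi (- j - 1)) n) (h j v\<^sub>0) = 0" by (simp add: h_v0)
    qed
  qed (use M in auto)
  also have "\<dots> = scal (fls_nth pair_fls n) 1 + (\<Sum>r=1..M. scal (d r) (h (- int r) v\<^sub>0))"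
  proof -
    have "expm1_fls powi (- (- int r) - 1) = expm1_fls ^ (r - 1)" if "r \<in> {1..M}" for r
      using that by (simp add: power_int_def nat_diff_distrib)
    then have "(\<Sum>r=1..M. scal (fls_nth (exp_fls (of_int 1) * expm1_fls powi (- (- int r) - 1)) n) (h (- int r) v\<^sub>0))
       = (\<Sum>r=1..M. scal (d r) (h (- int r) v\<^sub>0))"
      by (intro sum.cong refl) (simp add: d_def)
    moreover have "fls_nth (exp_fls (of_int 1) * expm1_fls powi (- 1 - 1)) n = fls_nth pair_fls n"
      unfolding pair_fls_eq by simp
    moreover have "1 \<notin> (\<lambda>r. - int r) ` {1..M}" by auto
    ultimately show ?thesis
      by (simp add: sum.reindex inj_on_def h_v0 del: fps_to_fls_minus)
  qed
  finally have br: "Y_br Y v\<^sub>0 v\<^sub>0 n = scal (fls_nth pair_fls n) 1 + (\<Sum>r=1..M. scal (d r) (h (- int r) v\<^sub>0))" .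
  have X1: "X_coeff Y 1 p s = (if p = 0 then s else 0)"
    unfolding X_coeff_homogeneous[OF one_in_grading] by (auto simp: vacuum)
  have Xh: "X_coeff Y (h (- int r) v\<^sub>0) p s
     = (\<Sum>i<M. scal (of_nat ((r + i - 1) choose i)) (F (r + i)))
       - scal ((-1) ^ r) (\<Sum>i<M. scal (of_nat ((r + i - 1) choose i)) (G i))" if r: "r \<in> {1..M}" for r
  proof -
    have hom: "h (- int r) v\<^sub>0 \<in> heis_grading (int r + 1)"
      using Y_homogeneous[OF v0_in_grading v0_in_grading, of "- int r"] by (simp add: Y_v0 add.commute)
    have gb: "(-1) ^ i * (- of_nat r gchoose i :: complex) = of_nat ((r + i - 1) choose i)" for i
    proof -
      have "(-1) ^ i * (- of_nat r gchoose i :: complex) = (of_nat r + of_nat i - 1) gchoose i"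
        unfolding gbinomial_minus by (simp flip: mult.assoc power_mult_distrib)
      also have "(of_nat r + of_nat i - 1 :: complex) = of_nat (r + i - 1)"
        using r by (simp add: of_nat_diff)
      finally show ?thesis by (simp add: binomial_gbinomial)
    qed
    have "X_coeff Y (h (- int r) v\<^sub>0) p s = Y (Y v\<^sub>0 (- int r) v\<^sub>0) (int r - p) s"
      unfolding X_coeff_homogeneous[OF hom] Y_v0 by simp
    also have "\<dots> = Sum_any (\<lambda>i. scal (of_nat ((r + i - 1) choose i)) (F (r + i) - scal ((-1) ^ r) (G i)))"
    proof -
      have "- int r - int i = - int (r + i)" "int r - p + int i = int (r + i) - p"
        "- int r + (int r - p) - int i = - p - int i" for i by simp_all
      then show ?thesis unfolding Y_iterate gb unfolding Y_v0 F_def G_def by (simp only:)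
    qed
    also have "\<dots> = (\<Sum>i<M. scal (of_nat ((r + i - 1) choose i)) (F (r + i) - scal ((-1) ^ r) (G i)))"
      by (rule Sum_any_eq_sum) (auto simp: F0 G0)
    also have "\<dots> = (\<Sum>i<M. scal (of_nat ((r + i - 1) choose i)) (F (r + i)))
       - scal ((-1) ^ r) (\<Sum>i<M. scal (of_nat ((r + i - 1) choose i)) (G i))"
      by (simp add: scal.scale_right_diff_distrib sum_subtractf scal.scale_sum_right mult.commute)
    finally show ?thesis .
  qed
  have X: "X_coeff Y (Y_br Y v\<^sub>0 v\<^sub>0 n) p s = (if p = 0 then scal (fls_nth pair_fls n) s else 0)
     + (\<Sum>r=1..M. scal (d r) (\<Sum>i<M. scal (of_nat ((r + i - 1) choose i)) (F (r + i))))
     - (\<Sum>r=1..M. scal (d r) (scal ((-1) ^ r) (\<Sum>i<M. scal (of_nat ((r + i - 1) choose i)) (G i))))"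
    unfolding br X_coeff_add_left X_coeff_sum_left X_coeff_scal_left X1
    by (simp add: Xh scal.scale_right_diff_distrib sum_subtractf)
  have part1: "(\<Sum>r=1..M. scal (d r) (\<Sum>i<M. scal (of_nat ((r + i - 1) choose i)) (F (r + i))))
     = (\<Sum>j=1..M. scal (fls_nth (exp_fls (of_nat j)) n) (F j))"
  proof -
    have inner: "(\<Sum>i<M. scal (of_nat ((r + i - 1) choose i)) (F (r + i)))
       = (\<Sum>j=1..M. scal (if r \<le> j then of_nat ((j - 1) choose (r - 1)) else 0) (F j))" if r: "r \<in> {1..M}" for r
    proof -
      have "(\<Sum>i<M. scal (of_nat ((r + i - 1) choose i)) (F (r + i)))
         = (\<Sum>i\<in>{i. r + i \<le> M}. scal (of_nat ((r + i - 1) choose i)) (F (r + i)))"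
        by (rule sum.mono_neutral_right) (use r in \<open>auto simp: F0\<close>)
      also have "\<dots> = (\<Sum>j\<in>{r..M}. scal (of_nat ((j - 1) choose (j - r))) (F j))"
        by (rule sum.reindex_bij_witness[of _ "\<lambda>j. j - r" "\<lambda>i. r + i"]) auto
      also have "\<dots> = (\<Sum>j\<in>{r..M}. scal (if r \<le> j then of_nat ((j - 1) choose (r - 1)) else 0) (F j))"
      proof (rule sum.cong[OF refl])
        fix j assume "j \<in> {r..M}"
        then have "(j - 1) choose (j - r) = (j - 1) choose (r - 1)"
          using r binomial_symmetric[OF diff_le_mono[of r j 1]] by simp
        then show "scal (of_nat ((j - 1) choose (j - r))) (F j) = scal (if r \<le> j then of_nat ((j - 1) choose (r - 1)) else 0) (F j)"
          using \<open>j \<in> {r..M}\<close> by simp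
      qed
      also have "\<dots> = (\<Sum>j=1..M. scal (if r \<le> j then of_nat ((j - 1) choose (r - 1)) else 0) (F j))"
        by (rule sum.mono_neutral_left) (use r in auto)
      finally show ?thesis .
    qed
    have coef: "(\<Sum>r=1..M. d r * (if r \<le> j then of_nat ((j - 1) choose (r - 1)) else 0)) = fls_nth (exp_fls (of_nat j)) n" if j: "j \<in> {1..M}" for j
    proof -
      have "(\<Sum>r=1..M. d r * (if r \<le> j then of_nat ((j - 1) choose (r - 1)) else 0))
         = (\<Sum>r=1..j. d r * of_nat ((j - 1) choose (r - 1)))"
        by (rule sum.mono_neutral_cong_right) (use j in auto)
      also have "\<dots> = (\<Sum>t\<le>j - 1. fls_nth (exp_fls 1 * (of_nat ((j - 1) choose t) * expm1_fls ^ t)) n)"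
      proof -
        have "(\<Sum>r=1..j. d r * of_nat ((j - 1) choose (r - 1))) = (\<Sum>t\<le>j - 1. d (Suc t) * of_nat ((j - 1) choose t))"
          by (rule sum.reindex_bij_witness[of _ Suc "\<lambda>r. r - 1"]) (use j in auto)
        then show ?thesis
          unfolding fls_of_nat dc by (simp add: mult.commute)
      qed
      also have "\<dots> = fls_nth (exp_fls 1 * (expm1_fls + 1) ^ (j - 1)) n"
        by (simp only: binomial_ring[of expm1_fls 1] power_one mult_1_right sum_distrib_left fls_nth_sum)
      also have "exp_fls 1 * (expm1_fls + 1) ^ (j - 1) = exp_fls (of_nat j)"
      proof -
        have "expm1_fls + 1 = exp_fls 1" by simp
        moreover have "exp_fls 1 * exp_fls 1 ^ (j - 1) = exp_fls 1 ^ j" using j by (cases j) auto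
        moreover have "exp_fls 1 ^ j = exp_fls (of_nat j)" by (simp add: fps_exp_power_mult flip: fps_to_fls_power)
        ultimately show ?thesis by simp
      qed
      finally show ?thesis .
    qed
    have "(\<Sum>r=1..M. scal (d r) (\<Sum>i<M. scal (of_nat ((r + i - 1) choose i)) (F (r + i))))
       = (\<Sum>r=1..M. \<Sum>j=1..M. scal (d r * (if r \<le> j then of_nat ((j - 1) choose (r - 1)) else 0)) (F j))"
      by (intro sum.cong refl) (simp only: inner scal.scale_sum_right scal.scale_scale)
    also have "\<dots> = (\<Sum>j=1..M. scal (\<Sum>r=1..M. d r * (if r \<le> j then of_nat ((j - 1) choose (r - 1)) else 0)) (F j))"
      unfolding scal.scale_sum_left by (rule sum.swap)
    finally show ?thesis using coef by simp
  qed
  have part2: "(\<Sum>r=1..M. scal (d r) (scal ((-1) ^ r) (\<Sum>i<M. scal (of_nat ((r + i - 1) choose i)) (G i))))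
     = - (\<Sum>i<M. scal (fls_nth (exp_fls (- of_nat i)) n) (G i))"
  proof -
    have coef: "(\<Sum>r=1..M. d r * (-1) ^ r * of_nat ((r + i - 1) choose i)) = - fls_nth (exp_fls (- of_nat i)) n" for i
    proof -
      have "(\<Sum>r=1..M. d r * (-1) ^ r * of_nat ((r + i - 1) choose i))
         = - (\<Sum>t<M. fls_nth (exp_fls 1 * (fls_const ((-1) ^ t * of_nat ((t + i) choose i)) * expm1_fls ^ t)) n)"
      proof -
        have "(\<Sum>r=1..M. d r * (-1) ^ r * of_nat ((r + i - 1) choose i))
           = (\<Sum>t<M. d (Suc t) * (-1) ^ Suc t * of_nat ((t + i) choose i))"
          by (rule sum.reindex_bij_witness[of _ Suc "\<lambda>r. r - 1"]) auto
        then show ?thesis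
          unfolding dc sum_negf[symmetric] by (simp add: mult_ac)
      qed
      also have "(\<Sum>t<M. fls_nth (exp_fls 1 * (fls_const ((-1) ^ t * of_nat ((t + i) choose i)) * expm1_fls ^ t)) n)
         = fls_nth (fps_to_fls (fps_exp 1 * (\<Sum>t<M. fps_const ((-1) ^ t * of_nat ((t + i) choose i)) * (fps_exp 1 - 1) ^ t))) n"
        by (simp only: fls_times_fps_to_fls fps_to_fls_power fps_to_fls_sum fps_const_to_fls sum_distrib_left fls_nth_sum)
      also have "\<dots> = fls_nth (exp_fls (- of_nat i)) n"
      proof -
        obtain q where q: "fps_exp 1 * (\<Sum>t<M. fps_const ((-1) ^ t * of_nat ((t + i) choose i)) * (fps_exp 1 - 1) ^ t)
           = fps_exp (- of_nat i) + (fps_exp 1 - 1 :: complex fps) ^ M * q"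
          using negative_binomial_exp by blast
        have "fls_nth (fps_to_fls ((fps_exp 1 - 1 :: complex fps) ^ M * q)) n = 0"
        proof -
          have "(fps_exp 1 - 1 :: complex fps) = fps_X * fps_shift 1 (fps_exp 1 - 1)"
            by (rule fps_ext) simp
          then have "(fps_exp 1 - 1 :: complex fps) ^ M * q = fps_X ^ M * (fps_shift 1 (fps_exp 1 - 1) ^ M * q)"
            by (metis power_mult_distrib mult.assoc)
          then have "((fps_exp 1 - 1 :: complex fps) ^ M * q) $ nat n = 0"
            using M by (simp only: fps_X_power_mult_nth) simp
          then show ?thesis by (simp only: fps_to_fls_nth if_cancel)
        qed
        then show ?thesis unfolding q fps_to_fls_plus fls_plus_nth by simp
      qed
      finally show ?thesis .
    qed
    have "(\<Sum>r=1..M. scal (d r) (scal ((-1) ^ r) (\<Sum>i<M. scal (of_nat ((r + i - 1) choose i)) (G i))))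
       = (\<Sum>r=1..M. \<Sum>i<M. scal (d r * (-1) ^ r * of_nat ((r + i - 1) choose i)) (G i))"
      by (intro sum.cong refl) (simp only: scal.scale_sum_right scal.scale_scale mult.assoc)
    also have "\<dots> = (\<Sum>i<M. scal (\<Sum>r=1..M. d r * (-1) ^ r * of_nat ((r + i - 1) choose i)) (G i))"
      unfolding scal.scale_sum_left by (rule sum.swap)
    finally show ?thesis by (simp only: coef scal.scale_minus_left sum_negf)
  qed
  have NF: "normal_ord (- int j) (int j - p) s = F j" if "j \<in> {1..M}" for j
    using that by (simp add: normal_ord_def F_def)
  have NG: "normal_ord (int i) (- p - int i) s = G i" for i
    unfolding G_def using normal_ord_commute[of "int i" "- p - int i" s] by (simp add: normal_ord_def)
  have "Sum_any (\<lambda>k. scal (fls_nth (exp_fls (- of_int k)) n) (normal_ord k (- p - k) s))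
     = (\<Sum>k\<in>{- int M..int M - 1}. scal (fls_nth (exp_fls (- of_int k)) n) (normal_ord k (- p - k) s))"
  proof (rule Sum_any_eq_sum)
    fix k assume k: "k \<notin> {- int M..int M - 1}"
    show "scal (fls_nth (exp_fls (- of_int k)) n) (normal_ord k (- p - k) s) = 0"
    proof (cases "k \<ge> int M")
      case True
      then show ?thesis using NG[of "nat k"] G0[of "nat k"] by simp
    next
      case False
      then have "k < 0" "F (nat (- k)) = 0" "k = - int (nat (- k))" using k by (auto intro: F0)
      then show ?thesis by (simp add: normal_ord_def F_def minus_diff_commute)
    qed
  qed simp
  also have "{- int M..int M - 1} = (\<lambda>j. - int j) ` {1..M} \<union> int ` {..<M}"
  proof -
    have "k \<in> (\<lambda>j. - int j) ` {1..M} \<union> int ` {..<M}" if "k \<in> {- int M..int M - 1}" for k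
    proof (cases "k < 0")
      case True
      then show ?thesis using that by (intro UnI1 image_eqI[of _ _ "nat (- k)"]) auto
    next
      case False
      then show ?thesis using that by (intro UnI2 image_eqI[of _ _ "nat k"]) auto
    qed
    then have "{- int M..int M - 1} \<subseteq> (\<lambda>j. - int j) ` {1..M} \<union> int ` {..<M}" by blast
    then show ?thesis by (rule equalityI) auto
  qed
  also have "(\<Sum>k\<in>\<dots>. scal (fls_nth (exp_fls (- of_int k)) n) (normal_ord k (- p - k) s))
     = (\<Sum>j=1..M. scal (fls_nth (exp_fls (of_nat j)) n) (F j)) + (\<Sum>i<M. scal (fls_nth (exp_fls (- of_nat i)) n) (G i))"
  proof (subst sum.union_disjoint)
    show "(\<lambda>j. - int j) ` {1..M} \<inter> int ` {..<M} = {}" by auto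
  qed (simp_all add: sum.reindex inj_on_def NF NG del: fps_to_fls_nth)
  finally show ?thesis unfolding X part1 part2 by simp
qed

text \<open>
Write \<open>P\<close> for the exponent of \<open>x\<close>. The coefficients of \<open>X(Y[v\<^sub>0,y]v\<^sub>0,x)\<close> carry \<open>e^(-ky)\<close>, to be
substituted at \<open>y = y\<^sub>j - y\<^sub>b\<close> and multiplied by \<open>e^(P y\<^sub>b)\<close>; since the two modes add up to \<open>-P\<close>, the product
is \<open>e^(-k y\<^sub>j + (P+k) y\<^sub>b)\<close>, the weight in the normally ordered product of fields.
\<close>

lemma hh_plus_eq_X_series:
  assumes ne: "j \<noteq> b" "x \<noteq> j" "x \<noteq> b"
  shows "hh_plus j (var j) (var b) x
    = X_series Y (lin_subst_heis j (var j - var b) (Y_br Y v\<^sub>0 v\<^sub>0)) (var b) x"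
proof (intro ext)
  fix m :: expo and s :: heis
  let ?u = "lin_subst_heis j (var j - var b) (Y_br Y v\<^sub>0 v\<^sub>0)"
  let ?P = "m x"
  let ?N = "\<lambda>k. normal_ord k (- ?P - k) s"
  have dK: "fls_deriv (1 / (1 - fps_to_fls (fps_exp (-1)))) = - pair_fls" by (simp add: pair_fls_def)
  have X: "X_series Y ?u (var b) x m s
    = (\<Sum>t\<le>nat (m b). scal (of_int ?P ^ t / fact t) (X_coeff Y (?u (m(x := 0, b := m b - int t))) ?P s))"
    by (rule X_series_eq) (use ne in \<open>auto simp: lin_subst_heis_difference\<close>)
  have hh: "hh_plus j (var j) (var b) x m s = Sum_any (\<lambda>k. scal (fexp (\<lambda>i. - of_int k * var j i - of_int (- ?P - k) * var b i) (m(x := 0))) (?N k))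
       - scal (lin_subst j (var j - var b) (- pair_fls) m) s"
    unfolding hh_plus_def dK by (simp add: hh_normal_eq)
  have fe: "fexp (\<lambda>i. - of_int k * var j i - of_int (- ?P - k) * var b i) (m(x := 0))
     = (if 0 \<le> m j \<and> 0 \<le> m b \<and> (\<forall>i. i \<noteq> j \<longrightarrow> i \<noteq> b \<longrightarrow> i \<noteq> x \<longrightarrow> m i = 0)
        then (- of_int k) ^ nat (m j) / fact (nat (m j)) * (of_int (?P + k) ^ nat (m b) / fact (nat (m b))) else 0)" for k
  proof -
    let ?c = "\<lambda>i. - of_int k * var j i - of_int (- ?P - k) * var b i"
    have c: "?c j = - of_int k" "?c b = of_int (?P + k)" using ne by (simp_all add: var_def)
    have c0: "?c i = 0" if "i \<noteq> j" "i \<noteq> b" for i using that by (simp add: var_def)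
    have e: "(\<forall>i. i \<noteq> j \<longrightarrow> i \<noteq> b \<longrightarrow> (m(x := 0)) i = 0) \<longleftrightarrow> (\<forall>i. i \<noteq> j \<longrightarrow> i \<noteq> b \<longrightarrow> i \<noteq> x \<longrightarrow> m i = 0)"
      by (metis fun_upd_apply)
    have mx: "(m(x := 0)) j = m j" "(m(x := 0)) b = m b" using ne by simp_all
    show ?thesis
      using fexp_two[OF ne(1), of ?c "m(x := 0)"] c0 unfolding e mx c by blast
  qed
  show "hh_plus j (var j) (var b) x m s = X_series Y ?u (var b) x m s"
  proof (cases "0 \<le> m b \<and> (\<forall>i. i \<noteq> j \<longrightarrow> i \<noteq> b \<longrightarrow> i \<noteq> x \<longrightarrow> m i = 0)")
    case False
    have "?u (m(x := 0, b := m b - int t)) = 0" for t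
      unfolding lin_subst_heis_difference[OF ne(1)] using False ne by auto
    moreover have "lin_subst j (var j - var b) (- pair_fls) m = 0"
      unfolding lin_subst_difference[OF ne(1)] using False by auto
    moreover have "fexp (\<lambda>i. - of_int k * var j i - of_int (- ?P - k) * var b i) (m(x := 0)) = 0" for k
      unfolding fe using False by auto
    ultimately show ?thesis unfolding X hh by simp
  next
    case True
    define B where "B = nat (m b)"
    \<comment> \<open>\<open>n t\<close> is the power of \<open>y\<^sub>j - y\<^sub>b\<close> that contributes when \<open>e^(P y\<^sub>b)\<close> uses up \<open>t\<close> powers of \<open>y\<^sub>b\<close>.\<close>
    define n where "n t = m j + int (B - t)" for t
    define cf where "cf t = (of_int (n t) gchoose (B - t)) * (-1 :: complex) ^ (B - t)" for t
    define I where "I = {k. ?N k \<noteq> 0}"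
    have finI: "finite I" unfolding I_def by (rule normal_ord_finite)
    have sumI: "Sum_any (\<lambda>k. scal (a k) (?N k)) = (\<Sum>k\<in>I. scal (a k) (?N k))" for a
      by (rule Sum_any_eq_sum[OF finI]) (simp add: I_def)
    have u: "?u (m(x := 0, b := m b - int t)) = scal (cf t) (Y_br Y v\<^sub>0 v\<^sub>0 (n t))" if "t \<le> B" for t
    proof -
      have "m b - int t = int (B - t)" using that True by (simp add: B_def of_nat_diff)
      then show ?thesis
        unfolding lin_subst_heis_difference[OF ne(1)] cf_def n_def using True ne by auto
    qed
    have cfs: "(\<Sum>t\<le>B. of_int ?P ^ t / fact t * (cf t * fls_nth (exp_fls (- of_int k)) (n t)))
       = fexp (\<lambda>i. - of_int k * var j i - of_int (- ?P - k) * var b i) (m(x := 0))" for k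
    proof -
      have "(\<Sum>t\<le>B. of_int ?P ^ t / fact t * (cf t * fls_nth (exp_fls (- of_int k)) (n t)))
         = (\<Sum>t\<le>B. of_int ?P ^ t / fact t * (if 0 \<le> m j then (- of_int k) ^ nat (m j) / fact (nat (m j)) * (of_int k ^ (B - t) / fact (B - t)) else 0))"
        unfolding cf_def by (simp only: exp_difference_coeff[OF n_def])
      also have "\<dots> = (if 0 \<le> m j then (- of_int k) ^ nat (m j) / fact (nat (m j)) *
          (\<Sum>t\<le>B. of_int ?P ^ t / fact t * (of_int k ^ (B - t) / fact (B - t))) else 0)"
        by (simp add: sum_distrib_left mult_ac)
      also have "(\<Sum>t\<le>B. of_int ?P ^ t / fact t * (of_int k ^ (B - t) / fact (B - t))) = (of_int ?P + of_int k :: complex) ^ B / fact B"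
        by (rule exp_convolution_nat)
      finally show ?thesis unfolding fe using True by (simp add: B_def)
    qed
    have "X_series Y ?u (var b) x m s = (\<Sum>t\<le>B. scal (of_int ?P ^ t / fact t * cf t)
        ((if ?P = 0 then scal (fls_nth pair_fls (n t)) s else 0) + (\<Sum>k\<in>I. scal (fls_nth (exp_fls (- of_int k)) (n t)) (?N k))))"
      unfolding X B_def[symmetric] by (intro sum.cong refl) (simp add: u X_coeff_scal_left X_coeff_Y_br_v0 sumI del: fps_to_fls_nth)
    also have "\<dots> = (\<Sum>t\<le>B. scal (of_int ?P ^ t / fact t * cf t) (if ?P = 0 then scal (fls_nth pair_fls (n t)) s else 0))
        + (\<Sum>k\<in>I. scal (\<Sum>t\<le>B. of_int ?P ^ t / fact t * (cf t * fls_nth (exp_fls (- of_int k)) (n t))) (?N k))"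
      unfolding scal.scale_right_distrib sum.distrib scal.scale_sum_right scal.scale_sum_left scal.scale_scale mult.assoc
      by (subst sum.swap) simp
    also have "(\<Sum>t\<le>B. scal (of_int ?P ^ t / fact t * cf t) (if ?P = 0 then scal (fls_nth pair_fls (n t)) s else 0))
       = - scal (lin_subst j (var j - var b) (- pair_fls) m) s"
    proof (cases "?P = 0")
      case P: True
      have "(\<Sum>t\<le>B. scal (of_int ?P ^ t / fact t * cf t) (if ?P = 0 then scal (fls_nth pair_fls (n t)) s else 0))
         = (\<Sum>t\<in>{0}. scal (of_int ?P ^ t / fact t * cf t) (if ?P = 0 then scal (fls_nth pair_fls (n t)) s else 0))"
        by (rule sum.mono_neutral_right) (use P in auto)
      moreover have "lin_subst j (var j - var b) (- pair_fls) m = - (cf 0 * fls_nth pair_fls (n 0))"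
      proof -
        have "\<forall>i. i \<noteq> j \<longrightarrow> i \<noteq> b \<longrightarrow> m i = 0" using True P by metis
        then show ?thesis
          unfolding lin_subst_difference[OF ne(1)] cf_def n_def B_def using True by simp
      qed
      ultimately show ?thesis using P by simp
    next
      case P: False
      then have "lin_subst j (var j - var b) (- pair_fls) m = 0"
        unfolding lin_subst_difference[OF ne(1)] using ne by auto
      then show ?thesis using P by simp
    qed
    finally show ?thesis unfolding hh sumI cfs by (simp only: add.commute diff_conv_add_uminus)
  qed
qed

lemma hh_plus_linear:
  assumes "j \<noteq> b" "x \<noteq> j" "x \<noteq> b"
  shows "hh_plus j (var j) (var b) x m (s + t) = hh_plus j (var j) (var b) x m s + hh_plus j (var j) (var b) x m t"
    and "hh_plus j (var j) (var b) x m (scal c s) = scal c (hh_plus j (var j) (var b) x m s)"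
    and "hh_plus j (var j) (var b) x m 0 = 0"
proof -
  have f: "lin_subst_heis j (var j - var b) (Y_br Y v\<^sub>0 v\<^sub>0) k = 0" if "k x \<noteq> 0 \<or> k b < 0" for k
    using that assms by (auto simp: lin_subst_heis_difference)
  show "hh_plus j (var j) (var b) x m (s + t) = hh_plus j (var j) (var b) x m s + hh_plus j (var j) (var b) x m t"
    "hh_plus j (var j) (var b) x m (scal c s) = scal c (hh_plus j (var j) (var b) x m s)"
    "hh_plus j (var j) (var b) x m 0 = 0"
    unfolding hh_plus_eq_X_series[OF assms]
    by (rule X_series_linear; use assms f in auto)+
qed

lemma hh_plus_support:
  assumes "j \<noteq> b" "x \<noteq> j" "x \<noteq> b" "i \<notin> {x, j, b}" "m i \<noteq> 0"
  shows "hh_plus j (var j) (var b) x m s = 0"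
  unfolding hh_plus_eq_X_series[OF assms(1-3)]
  by (rule X_series_support[of b x "{j, b}" _ i]) (use assms in \<open>auto simp: lin_subst_heis_difference\<close>)

section \<open>The residue formula\<close>

text \<open>
Let \<open>P\<close> and \<open>Q\<close> be the exponents of \<open>x\<^sub>1\<close> and \<open>x\<^sub>2\<close>. The delta function contributes
\<open>e^(P(-w + y\<^sub>2 - y\<^sub>4))\<close> and the vertex operator on the right contributes \<open>e^((P+Q) y\<^sub>4)\<close>. Their product is
\<open>e^(-Pw) e^(P y\<^sub>2) e^(Q y\<^sub>4)\<close>, in which the first factor is the one in \<open>X_commutator\<close> and the other two are
those of the operators on the left.
\<close>

lemma X_series_commutator_residue:
  assumes u: "\<And>k i. i \<notin> {Y1, Y2} \<Longrightarrow> k i \<noteq> 0 \<Longrightarrow> u k = 0" and u2: "\<And>k. k Y2 < 0 \<Longrightarrow> u k = 0"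
    and v: "\<And>k i. i \<notin> {Y3, Y4} \<Longrightarrow> k i \<noteq> 0 \<Longrightarrow> v k = 0" and v4: "\<And>k. k Y4 < 0 \<Longrightarrow> v k = 0"
  shows "op_comm (X_series Y u (var Y2) X1) (X_series Y v (var Y4) X2)
    = op_Res W (ser_mult (fdelta (- var W + var Y2 - var Y4) X1 X2)
        (X_series Y (Y_br_series Y u W v) (var Y4) X2))"
proof (intro ext)
  fix m :: expo and s :: heis
  define P Q where "P = m X1" and "Q = m X2"
  define n2 n4 where "n2 = nat (m Y2)" and "n4 = nat (m Y4)"
  \<comment> \<open>\<open>a\<close>, \<open>d\<close> count the powers of \<open>y\<^sub>2\<close>, \<open>y\<^sub>4\<close> that are taken from the exponentials.\<close>
  define U where "U a = u ((\<lambda>i. 0)(Y1 := m Y1, Y2 := m Y2 - int a))" for a :: nat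
  define V where "V d = v ((\<lambda>i. 0)(Y3 := m Y3, Y4 := m Y4 - int d))" for d :: nat
  have U0: "U a = 0" if "a > n2" for a using that unfolding U_def n2_def by (intro u2) auto
  have V0: "V d = 0" if "d > n4" for d using that unfolding V_def n4_def by (intro v4) auto
  let ?A = "X_series Y u (var Y2) X1" and ?B = "X_series Y v (var Y4) X2"
  let ?Z = "Y_br_series Y u W v"
  let ?c = "- var W + var Y2 - var Y4"
  have uX: "k X1 \<noteq> 0 \<Longrightarrow> u k = 0" for k using u[of X1 k] by simp
  have vX: "k X2 \<noteq> 0 \<Longrightarrow> v k = 0" for k using v[of X2 k] by simp
  have A: "?A k t = 0" if "i \<notin> {X1, Y1, Y2}" "k i \<noteq> 0" for k i t
    by (rule X_series_support[of Y2 X1 "{Y1, Y2}" u i]) (use u u2 that in auto)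
  have B: "?B k t = 0" if "i \<notin> {X2, Y3, Y4}" "k i \<noteq> 0" for k i t
    by (rule X_series_support[of Y4 X2 "{Y3, Y4}" v i]) (use v v4 that in auto)
  have A0: "?A k 0 = 0" and B0: "?B k 0 = 0" for k
    by (rule X_series_linear(3); use uX u2 vX v4 in auto)+
  have outside: "(\<forall>i. i \<notin> {X1, Y1, Y2} \<union> {X2, Y3, Y4} \<longrightarrow> m i = 0) \<longleftrightarrow> m W = 0"
    by (subst all_fvar) auto
  have comm: "op_comm ?A ?B m s = (if m W = 0 then
     ?A (restrict_expo {X1, Y1, Y2} m) (?B (restrict_expo {X2, Y3, Y4} m) s)
      - ?B (restrict_expo {X2, Y3, Y4} m) (?A (restrict_expo {X1, Y1, Y2} m) s) else 0)"
    unfolding outside[symmetric] by (rule op_comm_separated; (fact A B A0 B0)?) auto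
  have Zeq: "?Z k = (if k X1 = 0 \<and> k X2 = 0 then
      Y_br Y (u (restrict_expo {Y1, Y2} k)) (v (restrict_expo {Y3, Y4} k)) (k W) else 0)" for k
  proof -
    have "(\<forall>i. i \<noteq> W \<longrightarrow> i \<notin> {Y1, Y2} \<union> {Y3, Y4} \<longrightarrow> k i = 0) \<longleftrightarrow> k X1 = 0 \<and> k X2 = 0"
      by (subst all_fvar) auto
    then show ?thesis
      by (subst Y_br_series_separated[where S = "{Y1, Y2}" and T = "{Y3, Y4}"]) (use u v in auto)
  qed
  have Z2: "?Z k = 0" if "k X2 \<noteq> 0" for k using that by (simp add: Zeq)
  have Z1: "?Z k = 0" if "k X1 \<noteq> 0" for k using that by (simp add: Zeq)
  have Z4: "?Z k = 0" if "k Y4 < 0" for k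
  proof -
    have "v (restrict_expo {Y3, Y4} k) = 0" using that by (intro v4) (simp add: restrict_expo_def)
    then show ?thesis by (simp add: Zeq)
  qed
  show "op_comm ?A ?B m s = op_Res W (ser_mult (fdelta ?c X1 X2) (X_series Y ?Z (var Y4) X2)) m s"
  proof (cases "m W = 0")
    case False
    then show ?thesis by (simp add: comm op_Res_def)
  next
    case True
    define good where "good a d M \<longleftrightarrow> (\<forall>c\<ge>M. Y_br Y (U a) (V d) (- 1 - int c) = 0) \<and>
        X_coeff Y (U a) P (X_coeff Y (V d) Q s) - X_coeff Y (V d) Q (X_coeff Y (U a) P s)
        = (\<Sum>c<M. scal ((- of_int P) ^ c / fact c) (X_coeff Y (Y_br Y (U a) (V d) (- 1 - int c)) (P + Q) s))"
      for a d M
    have "\<exists>N. \<forall>M\<ge>N. good a d M" for a d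
      unfolding good_def by (rule X_commutator)
    then obtain N where N: "\<And>a d M. N a d \<le> M \<Longrightarrow> good a d M" by metis
    \<comment> \<open>The sum is merely a convenient common upper bound of the finitely many values.\<close>
    define M where "M = (\<Sum>a\<le>n2. \<Sum>d\<le>n4. N a d)"
    have M: "good a d M" if "a \<le> n2" "d \<le> n4" for a d
    proof (rule N)
      have "N a d \<le> (\<Sum>d\<le>n4. N a d)" using that by (intro member_le_sum) auto
      also have "\<dots> \<le> M" unfolding M_def using that by (intro member_le_sum[of a _ "\<lambda>a. \<Sum>d\<le>n4. N a d"]) auto
      finally show "N a d \<le> M" .
    qed
    define R where "R c a d = X_coeff Y (Y_br Y (U a) (V d) (- 1 - int c)) (P + Q) s" for c a d
    have R0: "R c a d = 0" if "a > n2 \<or> d > n4 \<or> c \<ge> M" for c a d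
      using that U0[of a] V0[of d] M[of a d] by (cases "a \<le> n2 \<and> d \<le> n4") (auto simp: R_def good_def)
    have rA: "restrict_expo {X1, Y1, Y2} m X1 = P" "restrict_expo {X1, Y1, Y2} m Y2 = m Y2"
      "(restrict_expo {X1, Y1, Y2} m)(X1 := 0, Y2 := m Y2 - int a) = (\<lambda>i. 0)(Y1 := m Y1, Y2 := m Y2 - int a)" for a
      by (auto simp: restrict_expo_def P_def fun_eq_iff)
    have rB: "restrict_expo {X2, Y3, Y4} m X2 = Q" "restrict_expo {X2, Y3, Y4} m Y4 = m Y4"
      "(restrict_expo {X2, Y3, Y4} m)(X2 := 0, Y4 := m Y4 - int a) = (\<lambda>i. 0)(Y3 := m Y3, Y4 := m Y4 - int a)" for a
      by (auto simp: restrict_expo_def Q_def fun_eq_iff)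
    have XA: "?A (restrict_expo {X1, Y1, Y2} m) t = (\<Sum>a\<le>n2. scal (of_int P ^ a / fact a) (X_coeff Y (U a) P t))" for t
      by (subst X_series_eq) (use uX u2 in \<open>auto simp: rA n2_def U_def\<close>)
    have XB: "?B (restrict_expo {X2, Y3, Y4} m) t = (\<Sum>d\<le>n4. scal (of_int Q ^ d / fact d) (X_coeff Y (V d) Q t))" for t
      by (subst X_series_eq) (use vX v4 in \<open>auto simp: rB n4_def V_def\<close>)
    have "op_comm ?A ?B m s = (\<Sum>a\<le>n2. \<Sum>d\<le>n4. scal (of_int P ^ a / fact a * (of_int Q ^ d / fact d))
        (X_coeff Y (U a) P (X_coeff Y (V d) Q s) - X_coeff Y (V d) Q (X_coeff Y (U a) P s)))"
    proof -
      have "?B (restrict_expo {X2, Y3, Y4} m) (?A (restrict_expo {X1, Y1, Y2} m) s)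
         = (\<Sum>a\<le>n2. \<Sum>d\<le>n4. scal (of_int P ^ a / fact a * (of_int Q ^ d / fact d)) (X_coeff Y (V d) Q (X_coeff Y (U a) P s)))"
        unfolding XA XB X_coeff_sum X_coeff_scal scal.scale_sum_right scal.scale_scale
        by (subst sum.swap) (simp only: mult.commute)
      moreover have "?A (restrict_expo {X1, Y1, Y2} m) (?B (restrict_expo {X2, Y3, Y4} m) s)
         = (\<Sum>a\<le>n2. \<Sum>d\<le>n4. scal (of_int P ^ a / fact a * (of_int Q ^ d / fact d)) (X_coeff Y (U a) P (X_coeff Y (V d) Q s)))"
        unfolding XA XB X_coeff_sum X_coeff_scal scal.scale_sum_right scal.scale_scale ..
      ultimately show ?thesis
        unfolding comm using True by (simp only: simp_thms if_True scal.scale_right_diff_distrib sum_subtractf)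
    qed
    also have "\<dots> = (\<Sum>a\<le>n2. \<Sum>d\<le>n4. scal (of_int P ^ a / fact a * (of_int Q ^ d / fact d))
        (\<Sum>c<M. scal ((- of_int P) ^ c / fact c) (R c a d)))"
      by (intro sum.cong refl arg_cong2[of _ _ _ _ scal]) (use M in \<open>auto simp: R_def good_def\<close>)
    also have "\<dots> = (\<Sum>c<M. \<Sum>a\<le>n2. \<Sum>d\<le>n4. scal ((- of_int P) ^ c / fact c * (of_int P ^ a / fact a) * (of_int Q ^ d / fact d)) (R c a d))"
      unfolding scal.scale_sum_right scal.scale_scale
      by (subst sum.swap[of _ "{..<M}"], subst sum.swap[of _ "{..<M}"]) (simp only: mult_ac)
    also have "\<dots> = (\<Sum>c<M. \<Sum>a\<le>n2. \<Sum>b\<le>n4. scal ((- of_int P) ^ c / fact c * (of_int P ^ a / fact a) * ((- of_int P) ^ b / fact b))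
        (\<Sum>g\<le>n4 - b. scal (of_int (P + Q) ^ g / fact g) (R c a (b + g))))"
    proof (rule sum.cong[OF refl], rule sum.cong[OF refl])
      fix c a
      let ?w = "(- of_int P) ^ c / fact c * (of_int P ^ a / fact a) :: complex"
      have "(\<Sum>b\<le>n4. scal (?w * ((- of_int P) ^ b / fact b)) (\<Sum>g\<le>n4 - b. scal (of_int (P + Q) ^ g / fact g) (R c a (b + g))))
         = (\<Sum>b\<le>n4. \<Sum>g\<le>n4 - b. scal (?w * ((- of_int P) ^ b / fact b * (of_int (P + Q) ^ g / fact g))) (R c a (b + g)))"
        unfolding scal.scale_sum_right scal.scale_scale by (simp only: mult.assoc)
      also have "\<dots> = (\<Sum>(b, g)\<in>{(b, g). b + g \<le> n4}. scal (?w * ((- of_int P) ^ b / fact b * (of_int (P + Q) ^ g / fact g))) (R c a (b + g)))"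
      proof -
        have "{(b, g). b + g \<le> n4} = Sigma {..n4} (\<lambda>b. {..n4 - b})" by auto
        then show ?thesis by (simp only:) (rule sum.Sigma; simp)
      qed
      also have "\<dots> = (\<Sum>d\<le>n4. \<Sum>b\<le>d. scal (?w * ((- of_int P) ^ b / fact b * (of_int (P + Q) ^ (d - b) / fact (d - b)))) (R c a (b + (d - b))))"
        by (rule sum.triangle_reindex_eq)
      also have "\<dots> = (\<Sum>d\<le>n4. scal (?w * (\<Sum>b\<le>d. (- of_int P) ^ b / fact b * (of_int (P + Q) ^ (d - b) / fact (d - b)))) (R c a d))"
        unfolding sum_distrib_left scal.scale_sum_left by (intro sum.cong refl) simp
      also have "\<dots> = (\<Sum>d\<le>n4. scal (?w * (of_int Q ^ d / fact d)) (R c a d))"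
        unfolding exp_convolution_nat by simp
      finally show "(\<Sum>d\<le>n4. scal (?w * (of_int Q ^ d / fact d)) (R c a d))
         = (\<Sum>b\<le>n4. scal (?w * ((- of_int P) ^ b / fact b)) (\<Sum>g\<le>n4 - b. scal (of_int (P + Q) ^ g / fact g) (R c a (b + g))))"
        by (rule sym)
    qed
    also have "\<dots> = ser_mult (fdelta ?c X1 X2) (X_series Y ?Z (var Y4) X2) (m(W := - 1)) s"
    proof -
      let ?m = "m(W := - 1)"
      let ?g = "\<lambda>(c, a, b). (\<lambda>i. 0)(W := int c, Y2 := int a, Y4 := int b)"
      let ?F = "\<lambda>(c, a, b). scal ((- of_int P) ^ c / fact c * (of_int P ^ a / fact a) * ((- of_int P) ^ b / fact b))
        (\<Sum>g\<le>n4 - b. scal (of_int (P + Q) ^ g / fact g) (R c a (b + g)))"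
      have "ser_mult (fdelta ?c X1 X2) (X_series Y ?Z (var Y4) X2) ?m s
        = Sum_any (\<lambda>k. scal (fexp (\<lambda>i. of_int (?m X1) * ?c i) k) (X_series Y ?Z (var Y4) X2 ((?m - k)(X1 := 0, X2 := ?m X1 + ?m X2)) s))"
      proof (rule ser_mult_fdelta)
        fix k :: expo and t assume k: "k X1 \<noteq> 0"
        have "?Z (k(X2 := 0, Y4 := k Y4 - int r)) = 0" for r using k by (intro Z1) simp
        then show "X_series Y ?Z (var Y4) X2 k t = 0"
          by (subst X_series_eq) (use Z2 Z4 in auto)
      qed (simp_all add: var_def)
      also have "\<dots> = Sum_any (\<lambda>x. scal (fexp (\<lambda>i. of_int (?m X1) * ?c i) (?g x)) (X_series Y ?Z (var Y4) X2 ((?m - ?g x)(X1 := 0, X2 := ?m X1 + ?m X2)) s))"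
      proof (rule Sum_any_reindex)
        show "inj ?g"
        proof (rule injI)
          fix x y assume xy: "?g x = ?g y"
          obtain c a b where x: "x = (c, a, b)" by (cases x)
          obtain c' a' b' where y: "y = (c', a', b')" by (cases y)
          show "x = y"
            using fun_cong[OF xy, of W] fun_cong[OF xy, of Y2] fun_cong[OF xy, of Y4] unfolding x y by simp
        qed
        fix k assume k: "k \<notin> range ?g"
        have "fexp (\<lambda>i. of_int (?m X1) * ?c i) k = 0"
        proof (rule ccontr)
          assume nz: "fexp (\<lambda>i. of_int (?m X1) * ?c i) k \<noteq> 0"
          have pos: "k i \<ge> 0" for i using nz fexp_eq_0[of k i] by force
          have "k i = 0" if "i \<notin> {W, Y2, Y4}" for i
            using nz that fexp_eq_0[of k i "\<lambda>i. of_int (?m X1) * ?c i"] by (auto simp: var_def)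
          then have "k = ?g (nat (k W), nat (k Y2), nat (k Y4))"
            using pos by (auto simp: fun_eq_iff)
          then show False using k by blast
        qed
        then show "scal (fexp (\<lambda>i. of_int (?m X1) * ?c i) k) (X_series Y ?Z (var Y4) X2 ((?m - k)(X1 := 0, X2 := ?m X1 + ?m X2)) s) = 0"
          by simp
      qed
      also have "\<dots> = Sum_any ?F"
      proof (rule Sum_any.cong)
        fix x :: "nat \<times> nat \<times> nat"
        obtain c a b where x: "x = (c, a, b)" by (cases x)
        let ?k = "(?m - ?g x)(X1 := 0, X2 := ?m X1 + ?m X2)"
        have fe: "fexp (\<lambda>i. of_int (?m X1) * ?c i) (?g x)
           = (- of_int P) ^ c / fact c * (of_int P ^ a / fact a) * ((- of_int P) ^ b / fact b)"
          unfolding x prod.case by (subst fexp_three) (simp_all add: var_def P_def)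
        have kY4: "?k Y4 = m Y4 - int b" "?k X2 = P + Q" unfolding x by (simp_all add: P_def Q_def)
        have Zk: "?Z (?k(X2 := 0, Y4 := ?k Y4 - int g)) = Y_br Y (U a) (V (b + g)) (- 1 - int c)" for g
        proof -
          let ?l = "?k(X2 := 0, Y4 := ?k Y4 - int g)"
          have "restrict_expo {Y1, Y2} ?l = (\<lambda>i. 0)(Y1 := m Y1, Y2 := m Y2 - int a)"
            unfolding x by (auto simp: restrict_expo_def fun_eq_iff)
          moreover have "restrict_expo {Y3, Y4} ?l = (\<lambda>i. 0)(Y3 := m Y3, Y4 := m Y4 - int (b + g))"
            unfolding x by (auto simp: restrict_expo_def fun_eq_iff)
          moreover have "?l W = - 1 - int c" "?l X1 = 0" "?l X2 = 0" unfolding x by simp_all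
          ultimately show ?thesis unfolding Zeq U_def V_def by (simp only: simp_thms if_True)
        qed
        have "X_series Y ?Z (var Y4) X2 ?k s = (\<Sum>g\<le>nat (?k Y4). scal (of_int (P + Q) ^ g / fact g)
            (X_coeff Y (?Z (?k(X2 := 0, Y4 := ?k Y4 - int g))) (P + Q) s))"
        proof -
          have "X_series Y ?Z (var Y4) X2 ?k s = (\<Sum>g\<le>nat (?k Y4). scal (of_int (?k X2) ^ g / fact g)
            (X_coeff Y (?Z (?k(X2 := 0, Y4 := ?k Y4 - int g))) (?k X2) s))"
            by (rule X_series_eq, simp) (erule Z2, erule Z4)
          then show ?thesis unfolding kY4(2) .
        qed
        also have "\<dots> = (\<Sum>g\<le>nat (?k Y4). scal (of_int (P + Q) ^ g / fact g) (R c a (b + g)))"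
          unfolding Zk R_def ..
        also have "nat (?k Y4) = n4 - b"
          unfolding kY4 n4_def by simp
        finally show "scal (fexp (\<lambda>i. of_int (?m X1) * ?c i) (?g x)) (X_series Y ?Z (var Y4) X2 ?k s) = ?F x"
          unfolding fe by (simp only: x prod.case)
      qed
      also have "\<dots> = (\<Sum>x\<in>{..<M} \<times> {..n2} \<times> {..n4}. ?F x)"
      proof (rule Sum_any_eq_sum)
        fix x assume x: "x \<notin> {..<M} \<times> {..n2} \<times> {..n4}"
        obtain c a b where cab: "x = (c, a, b)" by (cases x)
        have "R c a (b + g) = 0" for g using x cab by (intro R0) auto
        then show "?F x = 0" by (simp add: cab)
      qed simp
      also have "\<dots> = (\<Sum>c<M. \<Sum>a\<le>n2. \<Sum>b\<le>n4. ?F (c, a, b))"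
        by (simp only: sum.cartesian_product' split_conv case_prod_unfold fst_conv snd_conv prod.collapse)
      finally show ?thesis by simp
    qed
    finally show ?thesis using True by (simp add: op_Res_def)
  qed
qed

section \<open>Commutators of normally ordered fields\<close>

text \<open>
The scalar of a double contraction between a product with modes \<open>k\<close>, \<open>l\<close> and one with modes \<open>-k\<close>, \<open>-l\<close>.
\<close>

abbreviation contraction_sign :: "int \<Rightarrow> int \<Rightarrow> complex" where
  "contraction_sign k l \<equiv> of_int (k * l) * ((if l > 0 then 1 else 0) - (if k < 0 then 1 else 0))"

lemma contraction_sign_eq_0: "\<bar>k + l\<bar> < \<bar>l\<bar> \<Longrightarrow> contraction_sign k l = 0"
  by auto

text \<open>
The exponents \<open>P\<close> of \<open>x\<^sub>1\<close> and \<open>Q\<close> of \<open>x\<^sub>2\<close> fix the second mode in each product.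
\<close>

abbreviation mode_commutator :: "int \<Rightarrow> int \<Rightarrow> int \<Rightarrow> int \<Rightarrow> heis \<Rightarrow> heis" where
  "mode_commutator P Q k p s \<equiv> normal_ord k (- P - k) (normal_ord p (- Q - p) s)
     - normal_ord p (- Q - p) (normal_ord k (- P - k) s)"

text \<open>
The index sets must serve both orders of composition. They contain the modes that act
nontrivially on \<open>s\<close>, and those that act nontrivially on the finitely many vectors produced by the
other factor.
\<close>

lemma normal_sum_commutator:
  fixes f g :: "int \<Rightarrow> complex" and P Q :: int
  defines "F \<equiv> \<lambda>t. Sum_any (\<lambda>k. scal (f k) (normal_ord k (- P - k) t))"
    and "G \<equiv> \<lambda>t. Sum_any (\<lambda>p. scal (g p) (normal_ord p (- Q - p) t))"
  shows "F (G s) - G (F s) = Sum_any (\<lambda>(k, p). scal (f k * g p) (mode_commutator P Q k p s))"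
proof -
  let ?M = "\<lambda>k. normal_ord k (- P - k)" and ?N = "\<lambda>p. normal_ord p (- Q - p)"
  define I0 where "I0 = {k. ?M k s \<noteq> 0}"
  define J0 where "J0 = {p. ?N p s \<noteq> 0}"
  define I where "I = I0 \<union> (\<Union>p\<in>J0. {k. ?M k (?N p s) \<noteq> 0})"
  define J where "J = J0 \<union> (\<Union>k\<in>I0. {p. ?N p (?M k s) \<noteq> 0})"
  have fin0: "finite I0" "finite J0" unfolding I0_def J0_def by (rule normal_ord_finite)+
  have fin: "finite I" "finite J" unfolding I_def J_def using fin0 normal_ord_finite by auto
  have zMN: "?M k (?N p s) = 0" if "k \<notin> I \<or> p \<notin> J" for k p
    using that by (cases "p \<in> J0") (auto simp: I_def J_def J0_def)
  have zNM: "?N p (?M k s) = 0" if "k \<notin> I \<or> p \<notin> J" for k p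
    using that by (cases "k \<in> I0") (auto simp: I_def J_def I0_def)
  have G: "G s = (\<Sum>p\<in>J. scal (g p) (?N p s))"
    unfolding G_def by (rule Sum_any_eq_sum[OF fin(2)]) (auto simp: J_def J0_def)
  have F: "F s = (\<Sum>k\<in>I. scal (f k) (?M k s))"
    unfolding F_def by (rule Sum_any_eq_sum[OF fin(1)]) (auto simp: I_def I0_def)
  have FG: "F (G s) = (\<Sum>k\<in>I. \<Sum>p\<in>J. scal (f k * g p) (?M k (?N p s)))"
  proof -
    have "F (G s) = (\<Sum>k\<in>I. scal (f k) (?M k (G s)))"
      unfolding F_def G by (rule Sum_any_eq_sum[OF fin(1)]) (simp add: normal_ord_sum normal_ord_scal zMN)
    then show ?thesis unfolding G normal_ord_sum normal_ord_scal scal.scale_sum_right scal.scale_scale .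
  qed
  have GF: "G (F s) = (\<Sum>k\<in>I. \<Sum>p\<in>J. scal (f k * g p) (?N p (?M k s)))"
  proof -
    have "G (F s) = (\<Sum>p\<in>J. scal (g p) (?N p (F s)))"
      unfolding G_def F by (rule Sum_any_eq_sum[OF fin(2)]) (simp add: normal_ord_sum normal_ord_scal zNM)
    also have "\<dots> = (\<Sum>p\<in>J. \<Sum>k\<in>I. scal (f k * g p) (?N p (?M k s)))"
      unfolding F normal_ord_sum normal_ord_scal scal.scale_sum_right scal.scale_scale by (simp only: mult.commute)
    finally show ?thesis by (subst sum.swap)
  qed
  have zero: "mode_commutator P Q k p s = 0" if "(k, p) \<notin> I \<times> J" for k p
    using that zMN[of k p] zNM[of k p] by auto
  have "Sum_any (\<lambda>(k, p). scal (f k * g p) (mode_commutator P Q k p s))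
     = (\<Sum>(k, p)\<in>I \<times> J. scal (f k * g p) (mode_commutator P Q k p s))"
  proof (rule Sum_any_eq_sum)
    fix x assume "x \<notin> I \<times> J"
    then have "mode_commutator P Q (fst x) (snd x) s = 0" by (intro zero) simp
    then show "(case x of (k, p) \<Rightarrow> scal (f k * g p) (mode_commutator P Q k p s)) = 0"
      by (simp add: case_prod_unfold)
  qed (use fin in simp)
  also have "\<dots> = (\<Sum>k\<in>I. \<Sum>p\<in>J. scal (f k * g p) (mode_commutator P Q k p s))"
    by (rule sum.cartesian_product[symmetric])
  finally show "F (G s) - G (F s) = Sum_any (\<lambda>(k, p). scal (f k * g p) (mode_commutator P Q k p s))"
    unfolding FG GF by (simp add: scal.scale_right_diff_distrib sum_subtractf)
qed

lemma normal_ord_finite': "finite {k. normal_ord (- P - k) (k - Q) s \<noteq> 0}"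
proof -
  have "{k. normal_ord (- P - k) (k - Q) s \<noteq> 0} = (\<lambda>l. - P - l) ` {l. normal_ord l (- P - Q - l) s \<noteq> 0}"
    by (auto simp: image_iff algebra_simps intro!: exI[of _ "- P - _"])
  then show ?thesis using normal_ord_finite by simp
qed

text \<open>
Each Kronecker delta in \<open>normal_ord_commutator\<close> makes \<open>p\<close> a function of \<open>k\<close>. Only after normal ordering do
the four operator sums have finite support separately, which is why the scalars are split off
beforehand. A double contraction requires \<open>P + Q = 0\<close>.
\<close>

lemma mode_commutator_sum:
  fixes e :: "int \<Rightarrow> int \<Rightarrow> complex"
  shows "Sum_any (\<lambda>(k, p). scal (e k p) (mode_commutator P Q k p s)) =
      Sum_any (\<lambda>k. scal (e k (- k) * of_int k) (normal_ord (- P - k) (k - Q) s))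
    + Sum_any (\<lambda>k. scal (e k (P + k) * of_int (- P - k)) (normal_ord k (- (P + Q) - k) s))
    + Sum_any (\<lambda>k. scal (e k (k - Q) * of_int k) (normal_ord (- P - k) (k - Q) s))
    + Sum_any (\<lambda>k. scal (e k (- (P + Q) - k) * of_int (- P - k)) (normal_ord k (- (P + Q) - k) s))
    + (if P + Q = 0 then scal (Sum_any (\<lambda>k. e k (- k) * contraction_sign k (- P - k))) s else 0)
    + (if P + Q = 0 then scal (Sum_any (\<lambda>k. e k (P + k) * contraction_sign k (- P - k))) s else 0)"
proof -
  define F1 where "F1 k = scal (e k (- k) * of_int k) (normal_ord (- P - k) (k - Q) s)" for k
  define F2 where "F2 k = scal (e k (P + k) * of_int (- P - k)) (normal_ord k (- (P + Q) - k) s)" for k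
  define F3 where "F3 k = scal (e k (k - Q) * of_int k) (normal_ord (- P - k) (k - Q) s)" for k
  define F4 where "F4 k = scal (e k (- (P + Q) - k) * of_int (- P - k)) (normal_ord k (- (P + Q) - k) s)" for k
  define F5 where "F5 k = scal (if P + Q = 0 then e k (- k) * contraction_sign k (- P - k) else 0) s" for k
  define F6 where "F6 k = scal (if P + Q = 0 then e k (P + k) * contraction_sign k (- P - k) else 0) s" for k
  let ?G = "\<lambda>F g. \<lambda>(k, p). if p = (g k :: int) then F k else (0 :: heis)"
  have fsign: "finite {k. contraction_sign k (- P - k) \<noteq> 0}"
  proof (rule finite_subset)
    show "{k. contraction_sign k (- P - k) \<noteq> 0} \<subseteq> {- 2 * \<bar>P\<bar>..2 * \<bar>P\<bar>}"
    proof
      fix k assume "k \<in> {k. contraction_sign k (- P - k) \<noteq> 0}"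
      then have "\<not> \<bar>k + (- P - k)\<bar> < \<bar>- P - k\<bar>" using contraction_sign_eq_0 by blast
      then show "k \<in> {- 2 * \<bar>P\<bar>..2 * \<bar>P\<bar>}" by auto
    qed
  qed simp
  have f1: "finite {k. F1 k \<noteq> 0}"
    by (rule finite_subset[OF _ normal_ord_finite'[of P Q s]]) (auto simp: F1_def)
  have f2: "finite {k. F2 k \<noteq> 0}"
    by (rule finite_subset[OF _ normal_ord_finite[of "- (P + Q)" s]]) (auto simp: F2_def)
  have f3: "finite {k. F3 k \<noteq> 0}"
    by (rule finite_subset[OF _ normal_ord_finite'[of P Q s]]) (auto simp: F3_def)
  have f4: "finite {k. F4 k \<noteq> 0}"
    by (rule finite_subset[OF _ normal_ord_finite[of "- (P + Q)" s]]) (auto simp: F4_def)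
  have f5: "finite {k. F5 k \<noteq> 0}"
    by (rule finite_subset[OF _ fsign]) (auto simp: F5_def)
  have f6: "finite {k. F6 k \<noteq> 0}"
    by (rule finite_subset[OF _ fsign]) (auto simp: F6_def)
  note fin = f1[THEN finite_support_graph] f2[THEN finite_support_graph] f3[THEN finite_support_graph]
    f4[THEN finite_support_graph] f5[THEN finite_support_graph] f6[THEN finite_support_graph]
  have fin_add: "finite {x. a x + b x \<noteq> 0}" if "finite {x. a x \<noteq> 0}" "finite {x. b x \<noteq> 0}" for a b :: "int \<times> int \<Rightarrow> heis"
    by (rule finite_subset[OF _ finite_UnI[OF that]]) auto
  have split: "(\<lambda>(k, p). scal (e k p) (mode_commutator P Q k p s)) x
     = ?G F1 uminus x + ?G F2 (\<lambda>k. P + k) x + ?G F3 (\<lambda>k. k - Q) x + ?G F4 (\<lambda>k. - (P + Q) - k) x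
       + ?G F5 uminus x + ?G F6 (\<lambda>k. P + k) x" for x
  proof -
    obtain k p where x: "x = (k, p)" by (cases x)
    have c1: "k + p = 0 \<longleftrightarrow> p = - k" "- P - k + p = 0 \<longleftrightarrow> p = P + k" "k + (- Q - p) = 0 \<longleftrightarrow> p = k - Q"
      "- P - k + (- Q - p) = 0 \<longleftrightarrow> p = - (P + Q) - k" by auto
    have c2: "(p = - k \<and> p = - (P + Q) - k) \<longleftrightarrow> (p = - k \<and> P + Q = 0)"
      "(p = P + k \<and> p = k - Q) \<longleftrightarrow> (p = P + k \<and> P + Q = 0)" by auto
    have idx: "- Q - (- k) = k - Q" "- Q - (P + k) = - (P + Q) - k" "- Q - (- (P + Q) - k) = P + k" by auto
    have t1: "scal (e k p) (if p = - k then scal (of_int k) (normal_ord (- P - k) (- Q - p) s) else 0) = (if p = - k then F1 k else 0)"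
      by (cases "p = - k") (simp_all only: F1_def idx if_True if_False scal.scale_scale scal.scale_zero_right simp_thms)
    have t2: "scal (e k p) (if p = P + k then scal (of_int (- P - k)) (normal_ord k (- Q - p) s) else 0) = (if p = P + k then F2 k else 0)"
      by (cases "p = P + k") (simp_all only: F2_def idx if_True if_False scal.scale_scale scal.scale_zero_right simp_thms)
    have t3: "scal (e k p) (if p = k - Q then scal (of_int k) (normal_ord (- P - k) p s) else 0) = (if p = k - Q then F3 k else 0)"
      by (cases "p = k - Q") (simp_all only: F3_def idx if_True if_False scal.scale_scale scal.scale_zero_right simp_thms)
    have t4: "scal (e k p) (if p = - (P + Q) - k then scal (of_int (- P - k)) (normal_ord k p s) else 0) = (if p = - (P + Q) - k then F4 k else 0)"
      by (cases "p = - (P + Q) - k") (simp_all only: F4_def idx if_True if_False scal.scale_scale scal.scale_zero_right simp_thms)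
    have t5: "scal (e k p) (if p = - k \<and> P + Q = 0 then scal (contraction_sign k (- P - k)) s else 0) = (if p = - k then F5 k else 0)"
      by (cases "p = - k"; cases "P + Q = 0") (simp_all only: F5_def if_True if_False scal.scale_scale scal.scale_zero_right scal.scale_zero_left simp_thms)
    have t6: "scal (e k p) (if p = P + k \<and> P + Q = 0 then scal (contraction_sign k (- P - k)) s else 0) = (if p = P + k then F6 k else 0)"
      by (cases "p = P + k"; cases "P + Q = 0") (simp_all only: F6_def if_True if_False scal.scale_scale scal.scale_zero_right scal.scale_zero_left simp_thms)
    show ?thesis
      unfolding x prod.case normal_ord_commutator c1 c2 scal.scale_right_distrib t1 t2 t3 t4 t5 t6 ..
  qed
  have "Sum_any (\<lambda>(k, p). scal (e k p) (mode_commutator P Q k p s))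
     = Sum_any (\<lambda>x. ?G F1 uminus x + ?G F2 (\<lambda>k. P + k) x + ?G F3 (\<lambda>k. k - Q) x + ?G F4 (\<lambda>k. - (P + Q) - k) x
       + ?G F5 uminus x + ?G F6 (\<lambda>k. P + k) x)"
    by (rule Sum_any.cong) (rule split)
  also have "\<dots> = Sum_any (?G F1 uminus) + Sum_any (?G F2 (\<lambda>k. P + k)) + Sum_any (?G F3 (\<lambda>k. k - Q)) + Sum_any (?G F4 (\<lambda>k. - (P + Q) - k))
       + Sum_any (?G F5 uminus) + Sum_any (?G F6 (\<lambda>k. P + k))"
    by (subst Sum_any.distrib; (intro fin_add fin)?)+ (rule refl)
  also have "\<dots> = Sum_any F1 + Sum_any F2 + Sum_any F3 + Sum_any F4 + Sum_any F5 + Sum_any F6"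
    unfolding Sum_any_graph ..
  also have "Sum_any F5 = (if P + Q = 0 then scal (Sum_any (\<lambda>k. e k (- k) * contraction_sign k (- P - k))) s else 0)"
  proof -
    have "Sum_any (\<lambda>k. scal (e k (- k) * contraction_sign k (- P - k)) s) = scal (Sum_any (\<lambda>k. e k (- k) * contraction_sign k (- P - k))) s"
      by (subst (1 2) Sum_any_eq_sum[OF fsign]) (auto simp: scal.scale_sum_left)
    then show ?thesis by (simp add: F5_def)
  qed
  also have "Sum_any F6 = (if P + Q = 0 then scal (Sum_any (\<lambda>k. e k (P + k) * contraction_sign k (- P - k))) s else 0)"
  proof -
    have "Sum_any (\<lambda>k. scal (e k (P + k) * contraction_sign k (- P - k)) s) = scal (Sum_any (\<lambda>k. e k (P + k) * contraction_sign k (- P - k))) s"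
      by (subst (1 2) Sum_any_eq_sum[OF fsign]) (auto simp: scal.scale_sum_left)
    then show ?thesis by (simp add: F6_def)
  qed
  finally show ?thesis unfolding F1_def F2_def F3_def F4_def .
qed

text \<open>
The scalars that the modified normal ordering adds are central, so the bracket is that of the
normally ordered products.
\<close>

lemma hh_plus_commutator:
  fixes m :: expo and s :: heis
  defines "P \<equiv> m X1" and "Q \<equiv> m X2"
  shows "op_comm (hh_plus Y1 (var Y1) (var Y2) X1) (hh_plus Y3 (var Y3) (var Y4) X2) m s
    = Sum_any (\<lambda>(k, p). scal (fexp (\<lambda>i. - of_int k * var Y1 i + of_int (P + k) * var Y2 i
          - of_int p * var Y3 i + of_int (Q + p) * var Y4 i) (m(X1 := 0, X2 := 0)))
        (mode_commutator P Q k p s))"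
proof -
  let ?A = "hh_plus Y1 (var Y1) (var Y2) X1" and ?B = "hh_plus Y3 (var Y3) (var Y4) X2"
  let ?a = "restrict_expo {X1, Y1, Y2} m" and ?b = "restrict_expo {X2, Y3, Y4} m"
  let ?e = "\<lambda>k p. fexp (\<lambda>i. - of_int k * var Y1 i + of_int (P + k) * var Y2 i
          - of_int p * var Y3 i + of_int (Q + p) * var Y4 i) (m(X1 := 0, X2 := 0))"
  have dA: "(Y1 :: fvar) \<noteq> Y2" "X1 \<noteq> Y1" "X1 \<noteq> Y2" and dB: "(Y3 :: fvar) \<noteq> Y4" "X2 \<noteq> Y3" "X2 \<noteq> Y4" by auto
  note linA = hh_plus_linear[OF dA] and linB = hh_plus_linear[OF dB]
  have A: "?A k t = 0" if "i \<notin> {X1, Y1, Y2}" "k i \<noteq> 0" for k i t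
    by (rule hh_plus_support[of Y1 Y2 X1 i]) (use that in auto)
  have B: "?B k t = 0" if "i \<notin> {X2, Y3, Y4}" "k i \<noteq> 0" for k i t
    by (rule hh_plus_support[of Y3 Y4 X2 i]) (use that in auto)
  have outside: "(\<forall>i. i \<notin> {X1, Y1, Y2} \<union> {X2, Y3, Y4} \<longrightarrow> m i = 0) \<longleftrightarrow> m W = 0"
    by (subst all_fvar) auto
  have comm: "op_comm ?A ?B m s = (if m W = 0 then ?A ?a (?B ?b s) - ?B ?b (?A ?a s) else 0)"
    unfolding outside[symmetric] by (rule op_comm_separated; (fact A B linA linB)?) auto
  show ?thesis
  proof (cases "m W = 0")
    case False
    have "?e k p = 0" for k p
      by (rule fexp_eq_0[of _ W]) (use False in \<open>simp add: var_def\<close>)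
    then show ?thesis using False by (simp add: comm)
  next
    case True
    define f where "f k = fexp (\<lambda>i. - of_int k * var Y1 i - of_int (- P - k) * var Y2 i) (?a(X1 := 0))" for k
    define g where "g p = fexp (\<lambda>i. - of_int p * var Y3 i - of_int (- Q - p) * var Y4 i) (?b(X2 := 0))" for p
    define F where "F t = Sum_any (\<lambda>k. scal (f k) (normal_ord k (- P - k) t))" for t
    define G where "G t = Sum_any (\<lambda>p. scal (g p) (normal_ord p (- Q - p) t))" for t
    have aP: "?a X1 = P" and bQ: "?b X2 = Q" by (simp_all add: restrict_expo_def P_def Q_def)
    \<comment> \<open>\<open>\<alpha>\<close> and \<open>\<beta>\<close> are the scalars subtracted by the modified normal ordering.\<close>
    obtain \<alpha> where \<alpha>: "\<And>t. ?A ?a t = F t - scal \<alpha> t"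
      unfolding hh_plus_def by (auto simp: hh_normal_eq aP F_def f_def)
    obtain \<beta> where \<beta>: "\<And>t. ?B ?b t = G t - scal \<beta> t"
      unfolding hh_plus_def by (auto simp: hh_normal_eq bQ G_def g_def)
    have dif: "?A k (t - t') = ?A k t - ?A k t'" "?B k (t - t') = ?B k t - ?B k t'" for k t t'
      using linA(1)[of k "t - t'" t'] linB(1)[of k "t - t'" t'] by simp_all
    have "?A ?a (?B ?b s) - ?B ?b (?A ?a s) = F (G s) - G (F s)"
    proof -
      have "?A ?a (?B ?b s) = F (G s) - scal \<alpha> (G s) - scal \<beta> (F s - scal \<alpha> s)"
        unfolding \<beta> dif linA(2) unfolding \<alpha> ..
      moreover have "?B ?b (?A ?a s) = G (F s) - scal \<beta> (F s) - scal \<alpha> (G s - scal \<beta> s)"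
        unfolding \<alpha> dif linB(2) unfolding \<beta> ..
      ultimately show ?thesis by (simp add: scal.scale_right_diff_distrib mult.commute)
    qed
    also have "\<dots> = Sum_any (\<lambda>(k, p). scal (f k * g p) (mode_commutator P Q k p s))"
      unfolding F_def G_def by (rule normal_sum_commutator)
    also have "(\<lambda>k p. f k * g p) = ?e"
    proof (intro ext)
      fix k p
      have f: "f k = (if 0 \<le> m Y1 \<and> 0 \<le> m Y2 then (- of_int k) ^ nat (m Y1) / fact (nat (m Y1)) * (of_int (P + k) ^ nat (m Y2) / fact (nat (m Y2))) else 0)"
        unfolding f_def by (subst fexp_two[of Y1 Y2]) (auto simp: var_def restrict_expo_def add.commute)
      have g: "g p = (if 0 \<le> m Y3 \<and> 0 \<le> m Y4 then (- of_int p) ^ nat (m Y3) / fact (nat (m Y3)) * (of_int (Q + p) ^ nat (m Y4) / fact (nat (m Y4))) else 0)"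
        unfolding g_def by (subst fexp_two[of Y3 Y4]) (auto simp: var_def restrict_expo_def add.commute)
      show "f k * g p = ?e k p"
        unfolding f g by (subst fexp_four) (use True in \<open>auto simp: var_def mult.assoc\<close>)
    qed
    finally show ?thesis using True by (simp add: comm)
  qed
qed

section \<open>The explicit formula\<close>

text \<open>
Multiplying by the delta function adds the exponent \<open>P c\<close> to each exponential in the normally ordered
product. The scalar part of \<open>Lbar\<close> does not involve \<open>x\<^sub>2\<close>, so it contributes only for \<open>P + Q = 0\<close>.
\<close>

lemma ser_mult_Lbar:
  fixes m :: expo and s :: heis
  defines "P \<equiv> m X1" and "Q \<equiv> m X2" and "m0 \<equiv> m(X1 := 0, X2 := 0)"
  assumes c: "c X1 = 0" "c X2 = 0" and ab: "a X1 = 0" "b X1 = 0"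
    and L: "\<And>k. lin_subst j (a - b) (- pair_fls) k \<noteq> 0 \<Longrightarrow> k X1 = 0 \<and> k X2 = 0"
    and fin: "finite {k. fexp (\<lambda>i. of_int P * c i) k * lin_subst j (a - b) (- pair_fls) (m0 - k) \<noteq> 0}"
  shows "ser_mult (fdelta c X1 X2) (Lbar j a b X2) m s = scal (1/2)
    (Sum_any (\<lambda>l. scal (fexp (\<lambda>i. of_int P * c i + (- of_int l * a i - of_int (- (P + Q) - l) * b i)) m0)
        (normal_ord l (- (P + Q) - l) s))
     - (if P + Q = 0 then scal (Sum_any (\<lambda>k. fexp (\<lambda>i. of_int P * c i) k * lin_subst j (a - b) (- pair_fls) (m0 - k))) s else 0))"
proof -
  let ?L = "lin_subst j (a - b) (- pair_fls)"
  let ?N = "\<lambda>l. normal_ord l (- (P + Q) - l) s"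
  let ?d = "\<lambda>l. (\<lambda>i. - of_int l * a i - of_int (- (P + Q) - l) * b i)"
  let ?c = "\<lambda>i. of_int P * c i"
  have if_scal: "scal (if P + Q = 0 then z else 0) s = (if P + Q = 0 then scal z s else 0)" for z by simp
  define I where "I = {l. ?N l \<noteq> 0}"
  have finI: "finite I" unfolding I_def by (rule normal_ord_finite)
  have dK: "fls_deriv (1 / (1 - fps_to_fls (fps_exp (-1)))) = - pair_fls" by (simp add: pair_fls_def)
  have A: "Lbar j a b X2 k t = scal (1/2) (hh_normal a b X2 k t - scal (?L k) t)" for k t
    unfolding Lbar_def op_scale_def hh_plus_def dK by simp
  have A0: "Lbar j a b X2 k t = 0" if "k X1 \<noteq> 0" for k t
  proof -
    have "fexp (\<lambda>i. - of_int l * a i - of_int (- k X2 - l) * b i) (k(X2 := 0)) = 0" for l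
      by (rule fexp_eq_0[of _ X1]) (use that ab in simp)
    moreover have "?L k = 0" using L that by blast
    ultimately show ?thesis unfolding A hh_normal_eq by simp
  qed
  define L' where "L' k = (if P + Q = 0 then ?L (m0 - k) else 0)" for k
  have summand: "scal (fexp ?c k) (Lbar j a b X2 ((m - k)(X1 := 0, X2 := P + Q)) s)
     = scal (1/2) ((\<Sum>l\<in>I. scal (fexp ?c k * fexp (?d l) (m0 - k)) (?N l)) - scal (fexp ?c k * L' k) s)" for k
  proof (cases "k X1 = 0 \<and> k X2 = 0")
    case False
    then have "fexp ?c k = 0" using c fexp_eq_0[of k X1 ?c] fexp_eq_0[of k X2 ?c] by auto
    then show ?thesis by simp
  next
    case True
    let ?k = "(m - k)(X1 := 0, X2 := P + Q)"
    have k: "?k X2 = P + Q" "?k(X2 := 0) = m0 - k"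
      using True by (auto simp: m0_def fun_eq_iff)
    have "hh_normal a b X2 ?k s = (\<Sum>l\<in>I. scal (fexp (?d l) (m0 - k)) (?N l))"
      unfolding hh_normal_eq k by (rule Sum_any_eq_sum[OF finI]) (simp add: I_def)
    moreover have "?L ?k = L' k"
    proof (cases "P + Q = 0")
      case PQ: True
      then have "?k = m0 - k" using True by (auto simp: m0_def fun_eq_iff)
      then show ?thesis using PQ by (simp add: L'_def)
    next
      case False
      then have "?L ?k = 0" using L[of ?k] k(1) by auto
      then show ?thesis using False by (simp add: L'_def)
    qed
    ultimately show ?thesis
      unfolding A by (simp add: scal.scale_right_diff_distrib scal.scale_sum_right mult.commute mult.left_commute)
  qed
  define D where "D = (\<Union>l\<in>I. {k. fexp ?c k * fexp (?d l) (m0 - k) \<noteq> 0}) \<union> {k. fexp ?c k * ?L (m0 - k) \<noteq> 0}"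
  have finD: "finite D" unfolding D_def using finI fin fexp_convolution_finite by auto
  have D1: "fexp ?c k * fexp (?d l) (m0 - k) = 0" if "k \<notin> D" "l \<in> I" for k l using that by (auto simp: D_def)
  have D2: "fexp ?c k * L' k = 0" if "k \<notin> D" for k using that by (auto simp: D_def L'_def)
  have "ser_mult (fdelta c X1 X2) (Lbar j a b X2) m s
     = Sum_any (\<lambda>k. scal (1/2) ((\<Sum>l\<in>I. scal (fexp ?c k * fexp (?d l) (m0 - k)) (?N l)) - scal (fexp ?c k * L' k) s))"
  proof -
    have "ser_mult (fdelta c X1 X2) (Lbar j a b X2) m s = Sum_any (\<lambda>k. scal (fexp (\<lambda>i. of_int (m X1) * c i) k)
        (Lbar j a b X2 ((m - k)(X1 := 0, X2 := m X1 + m X2)) s))"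
      by (rule ser_mult_fdelta[OF c]) (rule A0)
    then show ?thesis unfolding P_def[symmetric] Q_def[symmetric] summand .
  qed
  also have "\<dots> = (\<Sum>k\<in>D. scal (1/2) ((\<Sum>l\<in>I. scal (fexp ?c k * fexp (?d l) (m0 - k)) (?N l)) - scal (fexp ?c k * L' k) s))"
  proof (rule Sum_any_eq_sum[OF finD])
    fix k assume k: "k \<notin> D"
    have "(\<Sum>l\<in>I. scal (fexp ?c k * fexp (?d l) (m0 - k)) (?N l)) = 0"
    proof (rule sum.neutral, rule ballI)
      fix l assume "l \<in> I"
      then show "scal (fexp ?c k * fexp (?d l) (m0 - k)) (?N l) = 0"
        by (simp only: D1[OF k] scal.scale_zero_left)
    qed
    then show "scal (1/2) ((\<Sum>l\<in>I. scal (fexp ?c k * fexp (?d l) (m0 - k)) (?N l)) - scal (fexp ?c k * L' k) s) = 0"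
      by (simp only: D2[OF k] scal.scale_zero_left diff_0_right scal.scale_zero_right)
  qed
  also have "\<dots> = scal (1/2) ((\<Sum>l\<in>I. scal (\<Sum>k\<in>D. fexp ?c k * fexp (?d l) (m0 - k)) (?N l)) - scal (\<Sum>k\<in>D. fexp ?c k * L' k) s)"
    unfolding scal.scale_sum_left scal.scale_sum_right[symmetric] sum_subtractf
    by (subst sum.swap) (rule refl)
  also have "(\<Sum>l\<in>I. scal (\<Sum>k\<in>D. fexp ?c k * fexp (?d l) (m0 - k)) (?N l)) = (\<Sum>l\<in>I. scal (fexp (?c + ?d l) m0) (?N l))"
  proof (rule sum.cong[OF refl])
    fix l assume "l \<in> I"
    then have "(\<Sum>k\<in>D. fexp ?c k * fexp (?d l) (m0 - k)) = Sum_any (\<lambda>k. fexp ?c k * fexp (?d l) (m0 - k))"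
      by (intro Sum_any_eq_sum[symmetric] finD D1)
    then show "scal (\<Sum>k\<in>D. fexp ?c k * fexp (?d l) (m0 - k)) (?N l) = scal (fexp (?c + ?d l) m0) (?N l)"
      unfolding fexp_convolution by (rule arg_cong)
  qed
  also have "\<dots> = Sum_any (\<lambda>l. scal (fexp (?c + ?d l) m0) (?N l))"
    by (rule Sum_any_eq_sum[OF finI, symmetric]) (simp add: I_def)
  also have "(\<Sum>k\<in>D. fexp ?c k * L' k) = (if P + Q = 0 then Sum_any (\<lambda>k. fexp ?c k * ?L (m0 - k)) else 0)"
  proof -
    have "(\<Sum>k\<in>D. fexp ?c k * L' k) = Sum_any (\<lambda>k. fexp ?c k * L' k)"
      by (intro Sum_any_eq_sum[symmetric] finD D2)
    then show ?thesis by (simp add: L'_def)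
  qed
  finally show ?thesis unfolding plus_fun_def if_scal .
qed

text \<open>
A uniform treatment of the four derivatives on the right-hand side. The exponents combine so that
the derivative produces the factor \<open>P + l\<close>, which up to sign is the mode being contracted. The
argument \<open>a - y\<^sub>i\<^sub>4\<close> of the singular scalar is \<open>\<plusminus>(y\<^sub>1 - y\<^sub>2 - u + v)\<close>, and the sign does not matter because
\<open>pair_fls\<close> is even.
\<close>

lemma op_deriv_ser_mult_Lbar:
  fixes m :: expo and s :: heis
  defines "P \<equiv> m X1" and "Q \<equiv> m X2" and "m0 \<equiv> m(X1 := 0, X2 := 0)"
  assumes i12: "(i1, i2) = (Y1, Y2) \<or> (i1, i2) = (Y2, Y1)" and i34: "(i3, i4) = (Y3, Y4) \<or> (i3, i4) = (Y4, Y3)"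
    and a: "a = - var i1 + var i2 + var i3"
    and uv: "(u, v) = (if i1 = Y1 then (i3, i4) else (i4, i3))"
  shows "op_deriv i1 (ser_mult (fdelta (var i1 - var i3) X1 X2) (Lbar Y1 a (var i4) X2)) m s = scal (1/2)
    (Sum_any (\<lambda>l. scal (of_int (P + l) * fexp (\<lambda>i. of_int (P + l) * var i1 i - of_int l * var i2 i
          - of_int (P + l) * var i3 i + of_int (P + Q + l) * var i4 i) m0) (normal_ord l (- (P + Q) - l) s))
     - (if P + Q = 0 then scal (of_int (m0 i1 + 1) * Sum_any (\<lambda>k. fexp (\<lambda>i. of_int P * (var i1 - var i3) i) k
          * lin_subst Y1 (var Y1 - var Y2 - var u + var v) (- pair_fls) (m0(i1 := m0 i1 + 1) - k))) s else 0))"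
proof -
  let ?L = "lin_subst Y1 (var Y1 - var Y2 - var u + var v) (- pair_fls)"
  let ?c = "var i1 - var i3"
  have uv34: "(u, v) = (Y3, Y4) \<or> (u, v) = (Y4, Y3)" using uv i34 i12 by (auto split: if_splits)
  have Leq: "lin_subst Y1 (a - var i4) (- pair_fls) = ?L"
  proof (cases "i1 = Y1")
    case True
    then have "a - var i4 = - (var Y1 - var Y2 - var u + var v)"
      using uv i12 by (simp add: a fun_eq_iff)
    then show ?thesis
      by (simp only:) (rule lin_subst_uminus, simp add: pair_fls_odd)
  next
    case False
    then have "a - var i4 = var Y1 - var Y2 - var u + var v"
      using uv i12 by (auto simp: a fun_eq_iff)
    then show ?thesis by simp
  qed
  have L0: "?L k \<noteq> 0 \<Longrightarrow> k X1 = 0 \<and> k X2 = 0" for k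
    unfolding lin_subst_four[OF uv34] by (auto split: if_splits)
  let ?m = "m(i1 := m i1 + 1)"
  have m: "?m X1 = P" "?m X2 = Q" "?m(X1 := 0, X2 := 0) = m0(i1 := m0 i1 + 1)" "m0 i1 = m i1"
    using i12 by (auto simp: P_def Q_def m0_def fun_eq_iff)
  have "ser_mult (fdelta ?c X1 X2) (Lbar Y1 a (var i4) X2) ?m s = scal (1/2)
    (Sum_any (\<lambda>l. scal (fexp (\<lambda>i. of_int P * ?c i + (- of_int l * a i - of_int (- (P + Q) - l) * var i4 i)) (m0(i1 := m0 i1 + 1)))
        (normal_ord l (- (P + Q) - l) s))
     - (if P + Q = 0 then scal (Sum_any (\<lambda>k. fexp (\<lambda>i. of_int P * ?c i) k * ?L (m0(i1 := m0 i1 + 1) - k))) s else 0))"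
    unfolding m(1-3)[symmetric] Leq[symmetric]
  proof (rule ser_mult_Lbar)
    show "?c X1 = 0" "?c X2 = 0" "a X1 = 0" "var i4 X1 = 0"
      using i12 i34 by (auto simp: var_def a)
    show "\<And>k. lin_subst Y1 (a - var i4) (- pair_fls) k \<noteq> 0 \<Longrightarrow> k X1 = 0 \<and> k X2 = 0"
      unfolding Leq by (rule L0)
    show "finite {k. fexp (\<lambda>i. of_int (?m X1) * ?c i) k * lin_subst Y1 (a - var i4) (- pair_fls) (?m(X1 := 0, X2 := 0) - k) \<noteq> 0}"
      unfolding Leq by (rule fexp_lin_subst_finite[OF uv34])
  qed
  moreover have "of_int (m i1 + 1) * fexp (\<lambda>i. of_int P * ?c i + (- of_int l * a i - of_int (- (P + Q) - l) * var i4 i)) (m0(i1 := m0 i1 + 1))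
     = of_int (P + l) * fexp (\<lambda>i. of_int (P + l) * var i1 i - of_int l * var i2 i
          - of_int (P + l) * var i3 i + of_int (P + Q + l) * var i4 i) m0" for l
  proof -
    have e: "(\<lambda>i. of_int P * ?c i + (- of_int l * a i - of_int (- (P + Q) - l) * var i4 i))
       = (\<lambda>i. of_int (P + l) * var i1 i - of_int l * var i2 i - of_int (P + l) * var i3 i + of_int (P + Q + l) * var i4 i)"
      by (rule ext) (simp add: a algebra_simps)
    have "(\<lambda>i. of_int (P + l) * var i1 i - of_int l * var i2 i - of_int (P + l) * var i3 i + of_int (P + Q + l) * var i4 i) i1 = (of_int (P + l) :: complex)"
      using i12 i34 by (auto simp: var_def)
    then show ?thesis unfolding e m(4)[symmetric] fexp_deriv by simp
  qed
  ultimately show ?thesis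
    unfolding op_deriv_def m(4)
    by (simp add: scal.scale_right_diff_distrib Sum_any_scal[symmetric] mult.left_commute[of _ "1/2"] mult.assoc[symmetric] if_distrib[of "scal _"] del: of_int_add)
qed

text \<open>
The form of \<open>scalar_part\<close> in which the sum runs over the contracted mode \<open>k = -P - l\<close>.
\<close>

lemma scalar_part_sum:
  fixes P :: int
  assumes uv: "(u, v) = (Y3, Y4) \<or> (u, v) = (Y4, Y3)"
    and m: "m X1 = 0" "m X2 = 0"
  defines "S a b \<equiv> (\<lambda>m. Sum_any (\<lambda>k. fexp (\<lambda>i. of_int P * (var a - var b) i) k *
     lin_subst Y1 (var Y1 - var Y2 - var u + var v) (- pair_fls) (m - k)))"
  shows "of_int (m Y1 + 1) * S Y1 u (m(Y1 := m Y1 + 1)) + of_int (m Y2 + 1) * S Y2 v (m(Y2 := m Y2 + 1))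
    = Sum_any (\<lambda>k. fexp (\<lambda>i. - of_int k * (var Y1 - var u) i + of_int (P + k) * (var Y2 - var v) i) m
        * contraction_sign k (- P - k))"
proof -
  let ?f = "\<lambda>k. fexp (\<lambda>i. - of_int k * (var Y1 - var u) i + of_int (P + k) * (var Y2 - var v) i) m * contraction_sign k (- P - k)"
  have "Sum_any ?f = Sum_any (\<lambda>l. ?f (- P - l))"
    by (rule Sum_any_reflect[symmetric])
  also have "\<dots> = (\<Sum>l\<in>{-\<bar>P\<bar>..\<bar>P\<bar>}. ?f (- P - l))"
  proof (rule Sum_any_eq_sum)
    fix l assume "l \<notin> {-\<bar>P\<bar>..\<bar>P\<bar>}"
    then have "contraction_sign (- P - l) (- P - (- P - l)) = 0"
      by (intro contraction_sign_eq_0) auto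
    then show "?f (- P - l) = 0" by (simp only: mult_zero_right)
  qed simp
  also have "\<dots> = (\<Sum>l\<in>{-\<bar>P\<bar>..\<bar>P\<bar>}. let k = - P - l in
         of_int (k * l) * ((if l > 0 then 1 else 0) - (if k < 0 then 1 else 0)) *
           fexp (\<lambda>i. - of_int k * (var Y1 - var u) i - of_int l * (var Y2 - var v) i) m)"
  proof (rule sum.cong[OF refl])
    fix l
    have "P + (- P - l) = - l" "- P - (- P - l) = l" by simp_all
    then show "?f (- P - l) = (let k = - P - l in
         of_int (k * l) * ((if l > 0 then 1 else 0) - (if k < 0 then 1 else 0)) *
           fexp (\<lambda>i. - of_int k * (var Y1 - var u) i - of_int l * (var Y2 - var v) i) m)"
      unfolding Let_def by (simp only: of_int_minus mult_minus_left diff_conv_add_uminus mult.commute)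
  qed
  finally show ?thesis
    using scalar_part[OF uv m, of P] unfolding S_def by simp
qed

text \<open>
The four operator sums \<open>N\<close> match the four single contractions after the substitution \<open>l = -P - k\<close> in
those where a mode \<open>k\<close> of \<open>h(e^(y\<^sub>1)x\<^sub>1)\<close> is contracted. The scalars \<open>C\<close> are matched in pairs: the
derivative along \<open>y\<^sub>1\<close> involving \<open>y\<^sub>3\<close> belongs with the one along \<open>y\<^sub>2\<close> involving \<open>y\<^sub>4\<close>, and likewise with
\<open>y\<^sub>3\<close> and \<open>y\<^sub>4\<close> exchanged.
\<close>

lemma Lbar_commutator:
  "op_comm (Lbar Y1 (var Y1) (var Y2) X1) (Lbar Y3 (var Y3) (var Y4) X2) =
     op_scale (- 1/2) (op_deriv Y1
       (ser_mult (fdelta (var Y1 - var Y3) X1 X2)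
          (Lbar Y1 (- var Y1 + var Y2 + var Y3) (var Y4) X2)
        + ser_mult (fdelta (var Y1 - var Y4) X1 X2)
          (Lbar Y1 (- var Y1 + var Y2 + var Y4) (var Y3) X2)))
     + op_scale (- 1/2) (op_deriv Y2
       (ser_mult (fdelta (var Y2 - var Y3) X1 X2)
          (Lbar Y1 (var Y1 - var Y2 + var Y3) (var Y4) X2)
        + ser_mult (fdelta (var Y2 - var Y4) X1 X2)
          (Lbar Y1 (var Y1 - var Y2 + var Y4) (var Y3) X2)))"
proof (intro ext)
  fix m :: expo and s :: heis
  define P Q m0 where "P = m X1" and "Q = m X2" and "m0 = m(X1 := 0, X2 := 0)"
  define e where "e k p = fexp (\<lambda>i. - of_int k * var Y1 i + of_int (P + k) * var Y2 i
          - of_int p * var Y3 i + of_int (Q + p) * var Y4 i) m0" for k p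
  define N where "N i1 i2 i3 i4 = Sum_any (\<lambda>l. scal (of_int (P + l) * fexp (\<lambda>i. of_int (P + l) * var i1 i - of_int l * var i2 i
          - of_int (P + l) * var i3 i + of_int (P + Q + l) * var i4 i) m0) (normal_ord l (- (P + Q) - l) s))" for i1 i2 i3 i4
  define C where "C i1 i3 u v = of_int (m0 i1 + 1) * Sum_any (\<lambda>k. fexp (\<lambda>i. of_int P * (var i1 - var i3) i) k
          * lin_subst Y1 (var Y1 - var Y2 - var u + var v) (- pair_fls) (m0(i1 := m0 i1 + 1) - k))" for i1 i3 u v
  note dterm = op_deriv_ser_mult_Lbar[of _ _ _ _ _ _ _ m s, folded P_def Q_def m0_def, folded N_def C_def]
  have T1: "op_deriv Y1 (ser_mult (fdelta (var Y1 - var Y3) X1 X2) (Lbar Y1 (- var Y1 + var Y2 + var Y3) (var Y4) X2)) m s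
     = scal (1/2) (N Y1 Y2 Y3 Y4 - (if P + Q = 0 then scal (C Y1 Y3 Y3 Y4) s else 0))"
    by (rule dterm) auto
  have T2: "op_deriv Y1 (ser_mult (fdelta (var Y1 - var Y4) X1 X2) (Lbar Y1 (- var Y1 + var Y2 + var Y4) (var Y3) X2)) m s
     = scal (1/2) (N Y1 Y2 Y4 Y3 - (if P + Q = 0 then scal (C Y1 Y4 Y4 Y3) s else 0))"
    by (rule dterm) auto
  have T3: "op_deriv Y2 (ser_mult (fdelta (var Y2 - var Y3) X1 X2) (Lbar Y1 (var Y1 - var Y2 + var Y3) (var Y4) X2)) m s
     = scal (1/2) (N Y2 Y1 Y3 Y4 - (if P + Q = 0 then scal (C Y2 Y3 Y4 Y3) s else 0))"
    by (rule dterm) auto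
  have T4: "op_deriv Y2 (ser_mult (fdelta (var Y2 - var Y4) X1 X2) (Lbar Y1 (var Y1 - var Y2 + var Y4) (var Y3) X2)) m s
     = scal (1/2) (N Y2 Y1 Y4 Y3 - (if P + Q = 0 then scal (C Y2 Y4 Y3 Y4) s else 0))"
    by (rule dterm) auto
  have m0: "m0 X1 = 0" "m0 X2 = 0" by (simp_all add: m0_def)
  have idx: "- (P + Q) - (- P - k) = k - Q" "P + (- P - k) = - k" "P + Q + (- P - k) = Q - k" for k
    by simp_all
  have neg_scal: "scal (a * b) t = - scal (b * - a) t" for a b t
    by (simp add: mult.commute)
  have F1: "Sum_any (\<lambda>k. scal (e k (- k) * of_int k) (normal_ord (- P - k) (k - Q) s)) = - N Y1 Y2 Y3 Y4"
  proof -
    have "N Y1 Y2 Y3 Y4 = Sum_any (\<lambda>k. - scal (e k (- k) * of_int k) (normal_ord (- P - k) (k - Q) s))"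
      unfolding N_def
    proof (subst Sum_any_reflect[of _ "- P", symmetric], unfold idx, rule Sum_any.cong)
      fix k
      have "(\<lambda>i. of_int (- k) * var Y1 i - of_int (- P - k) * var Y2 i - of_int (- k) * var Y3 i + of_int (Q - k) * var Y4 i)
        = (\<lambda>i. - of_int k * var Y1 i + of_int (P + k) * var Y2 i - of_int (- k) * var Y3 i + of_int (Q + - k) * var Y4 i)"
        by (rule ext) (simp add: algebra_simps)
      then show "scal (of_int (- k) * fexp (\<lambda>i. of_int (- k) * var Y1 i - of_int (- P - k) * var Y2 i - of_int (- k) * var Y3 i + of_int (Q - k) * var Y4 i) m0)
          (normal_ord (- P - k) (k - Q) s) = - scal (e k (- k) * of_int k) (normal_ord (- P - k) (k - Q) s)"
        unfolding e_def by (simp only:) (simp add: mult.commute)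
    qed
    then show ?thesis by (simp add: Sum_any_uminus)
  qed
  have F3: "Sum_any (\<lambda>k. scal (e k (k - Q) * of_int k) (normal_ord (- P - k) (k - Q) s)) = - N Y1 Y2 Y4 Y3"
  proof -
    have "N Y1 Y2 Y4 Y3 = Sum_any (\<lambda>k. - scal (e k (k - Q) * of_int k) (normal_ord (- P - k) (k - Q) s))"
      unfolding N_def
    proof (subst Sum_any_reflect[of _ "- P", symmetric], unfold idx, rule Sum_any.cong)
      fix k
      have "(\<lambda>i. of_int (- k) * var Y1 i - of_int (- P - k) * var Y2 i - of_int (- k) * var Y4 i + of_int (Q - k) * var Y3 i)
        = (\<lambda>i. - of_int k * var Y1 i + of_int (P + k) * var Y2 i - of_int (k - Q) * var Y3 i + of_int (Q + (k - Q)) * var Y4 i)"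
        by (rule ext) (simp add: algebra_simps)
      then show "scal (of_int (- k) * fexp (\<lambda>i. of_int (- k) * var Y1 i - of_int (- P - k) * var Y2 i - of_int (- k) * var Y4 i + of_int (Q - k) * var Y3 i) m0)
          (normal_ord (- P - k) (k - Q) s) = - scal (e k (k - Q) * of_int k) (normal_ord (- P - k) (k - Q) s)"
        unfolding e_def by (simp only:) (simp add: mult.commute)
    qed
    then show ?thesis by (simp add: Sum_any_uminus)
  qed
  have F2: "Sum_any (\<lambda>k. scal (e k (P + k) * of_int (- P - k)) (normal_ord k (- (P + Q) - k) s)) = - N Y2 Y1 Y3 Y4"
  proof -
    have "N Y2 Y1 Y3 Y4 = Sum_any (\<lambda>k. - scal (e k (P + k) * of_int (- P - k)) (normal_ord k (- (P + Q) - k) s))"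
      unfolding N_def
    proof (rule Sum_any.cong)
      fix k
      have "(\<lambda>i. of_int (P + k) * var Y2 i - of_int k * var Y1 i - of_int (P + k) * var Y3 i + of_int (P + Q + k) * var Y4 i)
        = (\<lambda>i. - of_int k * var Y1 i + of_int (P + k) * var Y2 i - of_int (P + k) * var Y3 i + of_int (Q + (P + k)) * var Y4 i)"
        by (rule ext) (simp add: algebra_simps)
      moreover have "of_int (- P - k) = (- of_int (P + k) :: complex)" by simp
      ultimately show "scal (of_int (P + k) * fexp (\<lambda>i. of_int (P + k) * var Y2 i - of_int k * var Y1 i - of_int (P + k) * var Y3 i + of_int (P + Q + k) * var Y4 i) m0)
          (normal_ord k (- (P + Q) - k) s) = - scal (e k (P + k) * of_int (- P - k)) (normal_ord k (- (P + Q) - k) s)"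
        unfolding e_def by (simp only:) (rule neg_scal)
    qed
    then show ?thesis by (simp add: Sum_any_uminus)
  qed
  have F4: "Sum_any (\<lambda>k. scal (e k (- (P + Q) - k) * of_int (- P - k)) (normal_ord k (- (P + Q) - k) s)) = - N Y2 Y1 Y4 Y3"
  proof -
    have "N Y2 Y1 Y4 Y3 = Sum_any (\<lambda>k. - scal (e k (- (P + Q) - k) * of_int (- P - k)) (normal_ord k (- (P + Q) - k) s))"
      unfolding N_def
    proof (rule Sum_any.cong)
      fix k
      have "(\<lambda>i. of_int (P + k) * var Y2 i - of_int k * var Y1 i - of_int (P + k) * var Y4 i + of_int (P + Q + k) * var Y3 i)
        = (\<lambda>i. - of_int k * var Y1 i + of_int (P + k) * var Y2 i - of_int (- (P + Q) - k) * var Y3 i + of_int (Q + (- (P + Q) - k)) * var Y4 i)"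
        by (rule ext) (simp add: algebra_simps)
      moreover have "of_int (- P - k) = (- of_int (P + k) :: complex)" by simp
      ultimately show "scal (of_int (P + k) * fexp (\<lambda>i. of_int (P + k) * var Y2 i - of_int k * var Y1 i - of_int (P + k) * var Y4 i + of_int (P + Q + k) * var Y3 i) m0)
          (normal_ord k (- (P + Q) - k) s) = - scal (e k (- (P + Q) - k) * of_int (- P - k)) (normal_ord k (- (P + Q) - k) s)"
        unfolding e_def by (simp only:) (rule neg_scal)
    qed
    then show ?thesis by (simp add: Sum_any_uminus)
  qed
  have F5: "Sum_any (\<lambda>k. e k (- k) * contraction_sign k (- P - k)) = C Y1 Y3 Y3 Y4 + C Y2 Y4 Y3 Y4" if "P + Q = 0"
  proof -
    have Q: "Q = - P" using that by simp
    have "e k (- k) = fexp (\<lambda>i. - of_int k * (var Y1 - var Y3) i + of_int (P + k) * (var Y2 - var Y4) i) m0" for k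
      unfolding e_def Q by (rule arg_cong[of _ _ "\<lambda>c. fexp c m0"], rule ext) (simp add: algebra_simps)
    then show ?thesis
      unfolding C_def using scalar_part_sum[of Y3 Y4 m0 P] m0 by simp
  qed
  have F6: "Sum_any (\<lambda>k. e k (P + k) * contraction_sign k (- P - k)) = C Y1 Y4 Y4 Y3 + C Y2 Y3 Y4 Y3" if "P + Q = 0"
  proof -
    have Q: "Q = - P" using that by simp
    have "e k (P + k) = fexp (\<lambda>i. - of_int k * (var Y1 - var Y4) i + of_int (P + k) * (var Y2 - var Y3) i) m0" for k
      unfolding e_def Q by (rule arg_cong[of _ _ "\<lambda>c. fexp c m0"], rule ext) (simp add: algebra_simps)
    then show ?thesis
      unfolding C_def using scalar_part_sum[of Y4 Y3 m0 P] m0 by simp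
  qed
  have "op_comm (Lbar Y1 (var Y1) (var Y2) X1) (Lbar Y3 (var Y3) (var Y4) X2) m s
     = scal (1/4) (op_comm (hh_plus Y1 (var Y1) (var Y2) X1) (hh_plus Y3 (var Y3) (var Y4) X2) m s)"
    unfolding Lbar_def by (subst op_comm_scale) (simp_all add: hh_plus_linear op_scale_def)
  also have "op_comm (hh_plus Y1 (var Y1) (var Y2) X1) (hh_plus Y3 (var Y3) (var Y4) X2) m s
     = Sum_any (\<lambda>(k, p). scal (e k p) (mode_commutator P Q k p s))"
    unfolding hh_plus_commutator e_def P_def Q_def m0_def ..
  also have "\<dots> = - N Y1 Y2 Y3 Y4 + - N Y2 Y1 Y3 Y4 + - N Y1 Y2 Y4 Y3 + - N Y2 Y1 Y4 Y3
      + (if P + Q = 0 then scal (C Y1 Y3 Y3 Y4 + C Y2 Y4 Y3 Y4) s else 0)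
      + (if P + Q = 0 then scal (C Y1 Y4 Y4 Y3 + C Y2 Y3 Y4 Y3) s else 0)"
    unfolding mode_commutator_sum F1 F2 F3 F4 using F5 F6 by (simp only: cong: if_cong)
  finally have lhs: "op_comm (Lbar Y1 (var Y1) (var Y2) X1) (Lbar Y3 (var Y3) (var Y4) X2) m s
     = scal (1/4) (- N Y1 Y2 Y3 Y4 + - N Y2 Y1 Y3 Y4 + - N Y1 Y2 Y4 Y3 + - N Y2 Y1 Y4 Y3
      + (if P + Q = 0 then scal (C Y1 Y3 Y3 Y4 + C Y2 Y4 Y3 Y4) s else 0)
      + (if P + Q = 0 then scal (C Y1 Y4 Y4 Y3 + C Y2 Y3 Y4 Y3) s else 0))" .
  have op_deriv_add: "op_deriv i (A + B) m s = op_deriv i A m s + op_deriv i B m s" for i A B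
    unfolding op_deriv_def by (simp add: scal.scale_right_distrib)
  have quarter: "scal (- 1/2) (scal (1/2) a + scal (1/2) b) = scal (1/4) (- a + - b)" for a b
    by (simp add: scal.scale_right_distrib scal.scale_right_diff_distrib)
  show "op_comm (Lbar Y1 (var Y1) (var Y2) X1) (Lbar Y3 (var Y3) (var Y4) X2) m s =
     (op_scale (- 1/2) (op_deriv Y1
       (ser_mult (fdelta (var Y1 - var Y3) X1 X2)
          (Lbar Y1 (- var Y1 + var Y2 + var Y3) (var Y4) X2)
        + ser_mult (fdelta (var Y1 - var Y4) X1 X2)
          (Lbar Y1 (- var Y1 + var Y2 + var Y4) (var Y3) X2)))
     + op_scale (- 1/2) (op_deriv Y2
       (ser_mult (fdelta (var Y2 - var Y3) X1 X2)
          (Lbar Y1 (var Y1 - var Y2 + var Y3) (var Y4) X2)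
        + ser_mult (fdelta (var Y2 - var Y4) X1 X2)
          (Lbar Y1 (var Y1 - var Y2 + var Y4) (var Y3) X2)))) m s"
    unfolding lhs plus_fun_apply op_scale_def op_deriv_add T1 T2 T3 T4 quarter
    by (cases "P + Q = 0") (simp_all add: scal.scale_left_distrib flip: scal.scale_right_distrib)
qed

end

theorem theorem3p5:
  fixes Y :: "heis \<Rightarrow> int \<Rightarrow> heis \<Rightarrow> heis"
  assumes "heisenberg_voa Y"
  shows
    "let u12 = lin_subst_heis Y1 (var Y1 - var Y2) (Y_br Y v\<^sub>0 v\<^sub>0);
         u34 = lin_subst_heis Y3 (var Y3 - var Y4) (Y_br Y v\<^sub>0 v\<^sub>0);
         X12 = X_series Y u12 (var Y2) X1;
         X34 = X_series Y u34 (var Y4) X2;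
         L12 = Lbar Y1 (var Y1) (var Y2) X1;
         L34 = Lbar Y3 (var Y3) (var Y4) X2
     in
       L12 = op_scale (1/2) X12 \<and> L34 = op_scale (1/2) X34 \<and>
       op_comm L12 L34 = op_scale (1/4) (op_comm X12 X34) \<and>
       op_scale (1/4) (op_comm X12 X34) =
         op_scale (1/4) (op_Res W
           (ser_mult (fdelta (- var W + var Y2 - var Y4) X1 X2)
             (X_series Y (Y_br_series Y u12 W u34) (var Y4) X2))) \<and>
       op_comm L12 L34 =
         op_scale (- 1/2) (op_deriv Y1
           (ser_mult (fdelta (var Y1 - var Y3) X1 X2)
              (Lbar Y1 (- var Y1 + var Y2 + var Y3) (var Y4) X2)
            + ser_mult (fdelta (var Y1 - var Y4) X1 X2)
              (Lbar Y1 (- var Y1 + var Y2 + var Y4) (var Y3) X2)))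
         + op_scale (- 1/2) (op_deriv Y2
           (ser_mult (fdelta (var Y2 - var Y3) X1 X2)
              (Lbar Y1 (var Y1 - var Y2 + var Y3) (var Y4) X2)
            + ser_mult (fdelta (var Y2 - var Y4) X1 X2)
              (Lbar Y1 (var Y1 - var Y2 + var Y4) (var Y3) X2)))"
proof -
  interpret heisenberg Y
    using assms unfolding heisenberg_voa_def heisenberg_def heisenberg_axioms_def by auto
  let ?u = "lin_subst_heis Y1 (var Y1 - var Y2) (Y_br Y v\<^sub>0 v\<^sub>0)"
  let ?v = "lin_subst_heis Y3 (var Y3 - var Y4) (Y_br Y v\<^sub>0 v\<^sub>0)"
  have h12: "hh_plus Y1 (var Y1) (var Y2) X1 = X_series Y ?u (var Y2) X1"
    by (rule hh_plus_eq_X_series) auto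
  have h34: "hh_plus Y3 (var Y3) (var Y4) X2 = X_series Y ?v (var Y4) X2"
    by (rule hh_plus_eq_X_series) auto
  have comm: "op_comm (Lbar Y1 (var Y1) (var Y2) X1) (Lbar Y3 (var Y3) (var Y4) X2)
      = op_scale (1/4) (op_comm (X_series Y ?u (var Y2) X1) (X_series Y ?v (var Y4) X2))"
    unfolding Lbar_def h12[symmetric] h34[symmetric]
    by (subst op_comm_scale) (simp_all add: hh_plus_linear)
  have res: "op_comm (X_series Y ?u (var Y2) X1) (X_series Y ?v (var Y4) X2)
      = op_Res W (ser_mult (fdelta (- var W + var Y2 - var Y4) X1 X2)
          (X_series Y (Y_br_series Y ?u W ?v) (var Y4) X2))"
    by (rule X_series_commutator_residue) (auto simp: lin_subst_heis_difference)
  show ?thesis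
    unfolding Let_def
    by (intro conjI comm Lbar_commutator)
      (simp_all only: Lbar_def h12 h34 res)
qed

end
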